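(* Let $k$ be an infinite field, $S=k[x_1,\dots,x_n]$ with the standard grading, and let $F=Se_1\oplus\cdots\oplus Se_r$ be a graded free $S$-module with homogeneous basis $e_1,\dots,e_r$, $\deg(e_i)=f_i$, $f_1\le f_2\le\cdots\le f_r$. Let $M\subseteq F$ be a graded submodule, let $m\in\mathbb{N}$, and let $L\subseteq F$ be a graded submodule whose degree $m$ component $L_m$ is the $k$-span of the lex-segment of length $H(M,m)$ in $F_m$, i.e. of the $H(M,m)$ largest monomials of $F_m$. Then, for a generic linear form $\ell\in S_1$, $$H((F/M)_\ell,m)\le H((F/L)_\ell,m).$$ Moreover, for a generic linear form $\ell \in S_1$, $$H((F/L)_\ell,m)=H(F/M,m)_{\{m,r\}}.$$
   Context: For a graded $S$-module $N$, $H(N,d)=\dim_k N_d$ is its Hilbert function. For a graded submodule $N\subseteq F$ and a linear form $\ell\in S_1$, $(F/N)_\ell$ denotes $F/(N+\ell F)$. A property holds for a generic linear form $\ell$ if there is a non-empty Zariski open set $\mathcal{U}\subseteq S_1$ such that it holds for all $\ell\in\mathcal{U}$. A monomial of $F$ is an element $ue_i$ with $u$ a monomial of $S$. Monomials of the same degree in $F$ are ordered as follows: $ue_i>ve_j$ if $i<j$, or if $i=j$ and $u>_{lex}v$ in $S$, where $x_1>x_2>\cdots>x_n$. A lex-segment of length $t$ in $F_m$ is the set of the $t$ largest monomials of $F_m$ in this order. Macaulay representation: for $d\ge 1$ and an integer $a\ge 1$, there is a unique way to write $a=\binom{a_d}{d}+\binom{a_{d-1}}{d-1}+\cdots+\binom{a_\delta}{\delta}$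 with $a_d>a_{d-1}>\cdots>a_\delta\ge\delta\ge 1$; one sets $a_{\langle d\rangle}=\binom{a_d-1}{d}+\binom{a_{d-1}-1}{d-1}+\cdots+\binom{a_\delta-1}{\delta}$, where $\binom{c}{e}=0$ whenever $c<e$. Also $0_{\langle d\rangle}=0$ for every integer $d$, and $1_{\langle 0\rangle}=1$. Definition of $H(F/M,m)_{\{m,r\}}$: set $d_i=m-f_i$ (a non-increasing sequence) and $N_i=\dim_k S_{d_i}$, which equals $\binom{n+d_i-1}{d_i}$ if $d_i\ge 0$ and $0$ if $d_i<0$. Choose $j\in\{1,\dots,r\}$ with $\sum_{i=j+1}^r N_i\le H(F/M,m)\le\sum_{i=j}^r N_i$ and define $$H(F/M,m)_{\{m,r\}}=\Bigl(H(F/M,m)-\sum_{i=j+1}^r N_i\Bigr)_{\langle d_j\rangle}+\sum_{i=j+1}^r (N_i)_{\langle d_i\rangle}.$$ *)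

theory Defs
  imports "HOL-Library.Poly_Mapping" "HOL-Algebra.AbelCoset" "Jordan_Normal_Form.VS_Connect"
begin

alias lookup = Poly_Mapping.lookup
alias keys = Poly_Mapping.keys

section \<open>The polynomial ring and the free module\<close>

text \<open>A power product is a finitely supported exponent vector and a polynomial is a finitely
  supported family of coefficients.  The type admits infinitely many variables \<open>x\<^sub>0, x\<^sub>1, \<dots>\<close>;
  the ring \<open>S = k[x\<^sub>1, \<dots>, x\<^sub>n]\<close> is the subring of polynomials in the variables with index
  in \<open>{1..n}\<close>.\<close>

type_synonym pprod = "nat \<Rightarrow>\<^sub>0 nat"
type_synonym 'k mpoly = "pprod \<Rightarrow>\<^sub>0 'k"
type_synonym 'k fvec = "nat \<Rightarrow>\<^sub>0 'k mpoly"

definition pprod_deg :: "pprod \<Rightarrow> nat"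
  where "pprod_deg t = (\<Sum>i\<in>keys t. lookup t i)"

definition pprods :: "nat \<Rightarrow> pprod set"
  where "pprods n = {t. keys t \<subseteq> {1..n}}"

text \<open>\<open>S\<close> as a record that serves both as a ring and as a module over itself.\<close>

definition poly_ring :: "nat \<Rightarrow> ('k::field mpoly, 'k mpoly) module"
  where "poly_ring n = \<lparr>carrier = {p. keys p \<subseteq> pprods n}, mult = (*), one = 1,
     zero = 0, add = (+), smult = (*)\<rparr>"

text \<open>Degrees are integers because the degrees of the basis elements may be arbitrary integers;
  the components of \<open>S\<close> in negative degrees are zero.\<close>

definition poly_comp :: "nat \<Rightarrow> int \<Rightarrow> 'k::field mpoly set"
  where "poly_comp n d = {p \<in> carrier (poly_ring n). \<forall>t\<in>keys p. int (pprod_deg t) = d}"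

text \<open>\<open>F = S e\<^sub>1 \<oplus> \<dots> \<oplus> S e\<^sub>r\<close>; the vector \<open>v\<close> stands for the sum of the \<open>lookup v i \<cdot> e\<^sub>i\<close>.
  The multiplication and the unit of a module record play no role.\<close>

definition free_module :: "nat \<Rightarrow> nat \<Rightarrow> ('k::field mpoly, 'k fvec) module"
  where "free_module n r = \<lparr>
     carrier = {v. keys v \<subseteq> {1..r} \<and> (\<forall>i. lookup v i \<in> carrier (poly_ring n))},
     mult = undefined, one = undefined, zero = 0, add = (+),
     smult = (\<lambda>p. Poly_Mapping.map ((*) p))\<rparr>"

definition free_comp :: "nat \<Rightarrow> nat \<Rightarrow> (nat \<Rightarrow> int) \<Rightarrow> int \<Rightarrow> 'k::field fvec set"
  where "free_comp n r f d =
    {v \<in> carrier (free_module n r). \<forall>i. \<forall>t\<in>keys (lookup v i). int (pprod_deg t) + f i = d}"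

text \<open>A submodule is graded if it is the sum of its homogeneous components.\<close>

definition graded_submodule :: "nat \<Rightarrow> nat \<Rightarrow> (nat \<Rightarrow> int) \<Rightarrow> 'k::field fvec set \<Rightarrow> bool"
  where "graded_submodule n r f M \<longleftrightarrow>
    Module.submodule M (poly_ring n) (free_module n r) \<and>
    (\<forall>v\<in>M. \<exists>D w. finite D \<and> (\<forall>d\<in>D. w d \<in> M \<inter> free_comp n r f d) \<and> v = (\<Sum>d\<in>D. w d))"


section \<open>Quotients and Hilbert functions\<close>

text \<open>The scalar multiple of a coset \<open>X\<close> is written as a union of cosets of \<open>N\<close>; all of them
  coincide, and for scalar \<open>0\<close> the result is the coset \<open>N\<close> and not just \<open>{0}\<close>.\<close>

definition quotient_module :: "('a, 'b) module \<Rightarrow> 'b set \<Rightarrow> ('a, 'b set) module"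
  where "quotient_module F N = \<lparr>carrier = A_RCOSETS F N,
     mult = undefined, one = undefined, zero = N, add = set_add F,
     smult = (\<lambda>p X. \<Union>x\<in>X. a_r_coset F N (smult F p x))\<rparr>"

text \<open>A subset \<open>C\<close> of an \<open>S\<close>-module, typically a graded component, as a vector space over \<open>k\<close>,
  where \<open>k\<close> acts through the constant polynomials.\<close>

definition k_space :: "('k::field mpoly, 'b) module \<Rightarrow> 'b set \<Rightarrow> ('k, 'b) module"
  where "k_space Q C = \<lparr>carrier = C, mult = undefined, one = undefined, zero = zero Q,
     add = add Q, smult = (\<lambda>c. smult Q (Poly_Mapping.single 0 c))\<rparr>"

definition k_dim :: "('k::field mpoly, 'b) module \<Rightarrow> 'b set \<Rightarrow> nat"
  where "k_dim Q C = vectorspace.dim (class_ring :: 'k ring) (k_space Q C)"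

definition hilbert_sub :: "nat \<Rightarrow> nat \<Rightarrow> (nat \<Rightarrow> int) \<Rightarrow> 'k::field fvec set \<Rightarrow> int \<Rightarrow> nat"
  where "hilbert_sub n r f N d = k_dim (free_module n r) (N \<inter> free_comp n r f d)"

text \<open>\<open>H(F/N, d)\<close>: the degree \<open>d\<close> component of \<open>F/N\<close> is the image of that of \<open>F\<close>.\<close>

definition hilbert_quot :: "nat \<Rightarrow> nat \<Rightarrow> (nat \<Rightarrow> int) \<Rightarrow> 'k::field fvec set \<Rightarrow> int \<Rightarrow> nat"
  where "hilbert_quot n r f N d =
    k_dim (quotient_module (free_module n r) N)
      (a_r_coset (free_module n r) N ` free_comp n r f d)"

text \<open>\<open>N + \<ell>F\<close>, so that \<open>(F/N)\<^sub>\<ell>\<close> is the quotient of \<open>F\<close> by it.\<close>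

definition add_multiples ::
    "nat \<Rightarrow> nat \<Rightarrow> 'k::field fvec set \<Rightarrow> 'k mpoly \<Rightarrow> 'k fvec set"
  where "add_multiples n r N l =
    set_add (free_module n r) N (smult (free_module n r) l ` carrier (free_module n r))"


section \<open>Generic linear forms\<close>

definition poly_eval :: "(nat \<Rightarrow> 'k::field) \<Rightarrow> 'k mpoly \<Rightarrow> 'k"
  where "poly_eval a p = (\<Sum>t\<in>keys p. lookup p t * (\<Prod>i\<in>keys t. a i ^ lookup t i))"

text \<open>\<open>S\<^sub>1\<close> is identified with affine \<open>n\<close>-space through the coefficients of a linear form. The closed
  sets are the common zero loci of families \<open>A\<close> of polynomials in these \<open>n\<close> coefficients.\<close>

definition zariski_open :: "nat \<Rightarrow> 'k::field mpoly set \<Rightarrow> bool"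
  where "zariski_open n U \<longleftrightarrow> (\<exists>A \<subseteq> carrier (poly_ring n).
    U = poly_comp n 1 -
      {l \<in> poly_comp n 1. \<forall>p\<in>A.
         poly_eval (\<lambda>i. lookup l (Poly_Mapping.single i 1)) p = 0})"

definition generic_linear_form :: "nat \<Rightarrow> ('k::field mpoly \<Rightarrow> bool) \<Rightarrow> bool"
  where "generic_linear_form n P \<longleftrightarrow> (\<exists>U. zariski_open n U \<and> U \<noteq> {} \<and> (\<forall>l\<in>U. P l))"


section \<open>Lex-segments\<close>

text \<open>The monomial \<open>u e\<^sub>i\<close> is encoded by the pair \<open>(i, u)\<close>.\<close>

definition monomials :: "nat \<Rightarrow> nat \<Rightarrow> (nat \<Rightarrow> int) \<Rightarrow> int \<Rightarrow> (nat \<times> pprod) set"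
  where "monomials n r f d =
    {(i, t). i \<in> {1..r} \<and> t \<in> pprods n \<and> int (pprod_deg t) + f i = d}"

definition monomial_vec :: "nat \<times> pprod \<Rightarrow> 'k::field fvec"
  where "monomial_vec = (\<lambda>(i, t). Poly_Mapping.single i (Poly_Mapping.single t 1))"

text \<open>The library order on \<open>nat \<Rightarrow>\<^sub>0 nat\<close> compares exponents at the least index where they differ,
  which is the lexicographic order with \<open>x\<^sub>1 > x\<^sub>2 > \<dots> > x\<^sub>n\<close>.\<close>

definition monomial_greater :: "nat \<times> pprod \<Rightarrow> nat \<times> pprod \<Rightarrow> bool"
  where "monomial_greater = (\<lambda>(i, t) (j, u). i < j \<or> i = j \<and> t > u)"

definition lex_segment ::
    "nat \<Rightarrow> nat \<Rightarrow> (nat \<Rightarrow> int) \<Rightarrow> int \<Rightarrow> nat \<Rightarrow> (nat \<times> pprod) set \<Rightarrow> bool"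
  where "lex_segment n r f d len B \<longleftrightarrow> B \<subseteq> monomials n r f d \<and> card B = len \<and>
    (\<forall>b\<in>B. \<forall>w\<in>monomials n r f d - B. monomial_greater b w)"

definition k_span :: "nat \<Rightarrow> nat \<Rightarrow> 'k::field fvec set \<Rightarrow> 'k fvec set"
  where "k_span n r A = LinearCombinations.module.span (class_ring :: 'k ring)
    (k_space (free_module n r) (carrier (free_module n r))) A"


section \<open>Macaulay representations\<close>

definition macaulay_rep :: "nat \<Rightarrow> nat \<Rightarrow> nat \<Rightarrow> (nat \<Rightarrow> nat) \<Rightarrow> bool"
  where "macaulay_rep d a s c \<longleftrightarrow> 1 \<le> s \<and> s \<le> d \<and> s \<le> c s \<and> strict_mono_on {s..d} c \<and>
    a = (\<Sum>i=s..d. c i choose i)"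

text \<open>\<open>a\<^bsub>\<langle>d\<rangle>\<^esub>\<close>.  For \<open>a > 0\<close> it is meaningful only if \<open>d \<ge> 1\<close> or \<open>a = 1, d = 0\<close>.  The subtraction
  does not truncate, since \<open>c i \<ge> i \<ge> 1\<close> in a Macaulay representation.\<close>

definition macaulay_lower :: "nat \<Rightarrow> int \<Rightarrow> nat"
  where "macaulay_lower a d =
    (if a = 0 then 0 else if a = 1 \<and> d = 0 then 1
     else THE b. \<exists>s c. macaulay_rep (nat d) a s c \<and> b = (\<Sum>i=s..nat d. (c i - 1) choose i))"

text \<open>\<open>h\<^bsub>{m,r}\<^esub>\<close>, to be used for \<open>h = H(F/M, m)\<close>; the field \<open>k\<close> enters through the type argument.
  If several \<open>j\<close> are admissible, they give the same value.\<close>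

definition hilbert_lower ::
    "'k::field itself \<Rightarrow> nat \<Rightarrow> nat \<Rightarrow> (nat \<Rightarrow> int) \<Rightarrow> int \<Rightarrow> nat \<Rightarrow> nat"
  where "hilbert_lower k n r f m h =
    (let d = (\<lambda>i. m - f i);
         N = (\<lambda>i. k_dim (poly_ring n :: ('k mpoly, 'k mpoly) module) (poly_comp n (d i)));
         j = (SOME j. j \<in> {1..r} \<and> (\<Sum>i=j+1..r. N i) \<le> h \<and> h \<le> (\<Sum>i=j..r. N i))
     in macaulay_lower (h - (\<Sum>i=j+1..r. N i)) (d j)
        + (\<Sum>i=j+1..r. macaulay_lower (N i) (d i)))"

end

theory Submission
  imports Defs
begin

text \<open>Let \<open>V\<close> be a subspace of \<open>S\<^sub>d\<close> of codimension \<open>c\<close> and let \<open>y\<close> be the codimension of \<open>V + \<ell>S\<^bsub>d-1\<^esub>\<close>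
  for generic \<open>\<ell>\<close>. For two generic forms \<open>h\<close>, \<open>\<ell>\<close>, the subspace \<open>V + h\<ell>S\<^bsub>d-2\<^esub>\<close> lies in the intersection of
  \<open>V + hS\<^bsub>d-1\<^esub>\<close> and \<open>V + \<ell>S\<^bsub>d-1\<^esub>\<close>. Comparing dimensions and using induction for \<open>V + hS\<^bsub>d-1\<^esub>\<close>, whose
  codimension \<open>y\<close> is smaller than \<open>c\<close>, and for the colon space \<open>V : \<ell>\<close> in degree \<open>d - 1\<close>, whose
  codimension is \<open>c - y\<close>, gives \<open>y \<le> y\<^bsub>\<langle>d\<rangle>\<^esub> + (c - y)\<^bsub>\<langle>d-1\<rangle>\<^esub>\<close>, which forces \<open>y \<le> c\<^bsub>\<langle>d\<rangle>\<^esub>\<close>. For a free module one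
  splits off one basis element at a time and adds up the bounds.

  The numerical part becomes transparent if \<open>a\<^bsub>\<langle>d\<rangle>\<^esub>\<close> is read as the number of those among the \<open>a\<close> smallest
  monomials of degree \<open>d\<close> that are not divisible by the last variable, that is, as the sum of a prefix of
  a binary word. For lex-segments this is also the generic value: modulo a linear form with nonzero
  coefficient at \<open>x\<^sub>n\<close>, multiples of \<open>x\<^sub>n\<close> are combinations of larger monomials.\<close>

text \<open>No calculus of generic forms is set up: a form counts as good when the dimension in
  question is large enough, and the bounds for the ring and for free modules only assert that one
  good form exists. Requirements met by different forms are reconciled on a line through these
  forms: in the parameter of the line all coordinates are polynomials, so each requirement fails for
  finitely many parameters, and the field is infinite. Openness in the space of all linear forms
  enters only at the end and comes from the same elimination argument with polynomials in
  \<open>n\<close> coefficients.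

  Adding up the bounds over the basis elements has its own obstacle: nothing is known about how the
  codimension is shared among the summands. For every way of sharing, the separate prefix sums must
  add up to at most one prefix sum of the concatenated word. This is why the words are studied
  through their windows: among all windows of the same length, prefixes have the least and suffixes
  the largest sums.\<close>

section \<open>Words of monomials\<close>

text \<open>The letters belong to the monomials of degree \<open>d\<close> in \<open>q\<close> variables in increasing lexicographic
  order; the letter is \<open>0\<close> if the monomial is divisible by the last variable and \<open>1\<close> otherwise. The
  recursion separates the monomials without the first variable from its multiples.\<close>

fun lexword :: "nat \<Rightarrow> nat \<Rightarrow> nat list" where
  "lexword 0 0 = [1]"
| "lexword 0 (Suc d) = []"
| "lexword (Suc q) 0 = [1]"
| "lexword (Suc q) (Suc d) = lexword q (Suc d) @ (if q = 0 then [0] else lexword (Suc q) d)"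

declare lexword.simps(4) [simp del]

definition pre :: "nat list \<Rightarrow> nat \<Rightarrow> nat"
  where "pre w a = sum_list (take a w)"

lemma pre_0 [simp]: "pre w 0 = 0"
  by (simp add: pre_def)

lemma pre_Nil [simp]: "pre [] a = 0"
  by (simp add: pre_def)

lemma pre_append: "pre (u @ v) a = pre u a + pre v (a - length u)"
  by (simp add: pre_def)

lemma pre_all: "length w \<le> a \<Longrightarrow> pre w a = sum_list w"
  by (simp add: pre_def)

lemma pre_add: "pre w (a + b) = pre w a + pre (drop a w) b"
  by (simp add: pre_def take_add)

lemma pre_mono: "a \<le> b \<Longrightarrow> pre w a \<le> pre w b"
  using pre_add[of w a "b - a"] by simp

lemma pre_le_sum_list: "pre w a \<le> sum_list w"
  by (metis append_take_drop_id le_add1 pre_def sum_list_append)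

lemma sum_list_binary_le: "set w \<subseteq> {0, 1::nat} \<Longrightarrow> sum_list w \<le> length w"
  by (induction w) auto

lemma pre_diff_le:
  assumes "set w \<subseteq> {0, 1}" "a \<le> b"
  shows "pre w b \<le> pre w a + (b - a)"
proof -
  have "set (take (b - a) (drop a w)) \<subseteq> {0, 1}"
    using assms(1) by (meson in_set_dropD in_set_takeD subset_iff)
  then have "pre (drop a w) (b - a) \<le> b - a"
    unfolding pre_def by (rule order_trans[OF sum_list_binary_le]) simp
  then show ?thesis using pre_add[of w a "b - a"] assms(2) by simp
qed

lemma set_lexword: "set (lexword q d) \<subseteq> {0, 1}"
  by (induction q d rule: lexword.induct) (auto simp: lexword.simps(4))

lemma lexword_0_right [simp]: "lexword q 0 = [1]"
  by (cases q) auto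

lemma lexword_1 [simp]: "0 < d \<Longrightarrow> lexword (Suc 0) d = [0]"
  by (cases d) (auto simp: lexword.simps(4))

lemma lexword_0_left [simp]: "0 < d \<Longrightarrow> lexword 0 d = []"
  by (cases d) auto

lemma lexword_Suc:
  "0 < d \<Longrightarrow> lexword (Suc (Suc q)) d = lexword (Suc q) d @ lexword (Suc (Suc q)) (d - 1)"
  by (cases d) (auto simp: lexword.simps(4))

lemma lexword_Suc_2:
  "2 \<le> d \<Longrightarrow> lexword (Suc q) d = lexword q d @ lexword (Suc q) (d - 1)"
  by (cases d) (auto simp: lexword.simps(4))

lemma lexword_prefix: "p \<le> q \<Longrightarrow> 0 < d \<Longrightarrow> \<exists>w. lexword q d = lexword p d @ w"
proof (induction q rule: dec_induct)
  case (step q)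
  then obtain e where "d = Suc e" by (cases d) auto
  with step show ?case by (auto simp: lexword.simps(4))
qed auto

text \<open>The multiples of a power of the first variable are the greatest monomials, and division
  by that power keeps order and letters. With a single variable the letter could change, hence at
  least two variables.\<close>

lemma lexword_suffix: "e \<le> d \<Longrightarrow> \<exists>w. lexword (Suc (Suc q)) d = w @ lexword (Suc (Suc q)) e"
proof (induction d rule: dec_induct)
  case (step d)
  then show ?case by (auto simp: lexword.simps(4))
qed auto

lemma length_lexword: "0 < q \<Longrightarrow> length (lexword q d) = (q + d - 1) choose d"
proof (induction q d rule: lexword.induct)
  case (4 q d)
  then show ?case by (cases q) (auto simp: lexword.simps(4))
qed auto

text \<open>A letter 1 belongs to a monomial without the last variable, so the sum counts monomials
  in one variable fewer.\<close>

lemma sum_list_lexword: "0 < d \<Longrightarrow> sum_list (lexword (Suc q) d) = length (lexword q d)"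
proof (induction q arbitrary: d)
  case (Suc q)
  note IH = Suc.IH
  from Suc.prems show ?case
  proof (induction d)
    case (Suc d)
    show ?case
    proof (cases d)
      case 0
      then show ?thesis using IH[of 1] by (cases q) (auto simp: lexword.simps(4))
    next
      case (Suc e)
      then show ?thesis using IH[of "Suc d"] Suc.IH by (cases q) (auto simp: lexword.simps(4))
    qed
  qed simp
qed simp

lemma length_lexword_Suc:
  "0 < d \<Longrightarrow> length (lexword (Suc q) d) = length (lexword q d) + length (lexword (Suc q) (d - 1))"
  using length_lexword[of 1 "d - 1"] by (cases d; cases q) (auto simp: lexword.simps(4))

text \<open>The smallest monomial of positive degree is a power of the last variable; without
  variables the word is empty.\<close>

lemma pre_1_lexword: "0 < d \<Longrightarrow> pre (lexword q d) 1 = 0"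
proof (induction q)
  case (Suc q)
  show ?case
  proof (cases q)
    case 0
    then show ?thesis using Suc.prems by (simp add: pre_def)
  next
    case (Suc p)
    have "0 < length (lexword q d)" using Suc by (simp add: length_lexword)
    then have "1 - length (lexword q d) = 0" by linarith
    then show ?thesis using Suc Suc.IH Suc.prems by (simp add: lexword_Suc pre_append)
  qed
qed simp

lemma pre_lexword_less: "0 < d \<Longrightarrow> 0 < c \<Longrightarrow> pre (lexword q d) c < c"
  using pre_diff_le[OF set_lexword, of 1 c q d] pre_1_lexword[of d q] by simp

text \<open>Written without subtraction: the window of length \<open>a\<close> that starts at
  \<open>i\<close> has at least the sum of the prefix of length \<open>a\<close>. Likewise
  \<open>suffix_max\<close> bounds a window by the suffix of the same length.\<close>

definition prefix_min :: "nat list \<Rightarrow> bool"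
  where "prefix_min w \<longleftrightarrow> (\<forall>i a. i + a \<le> length w \<longrightarrow> pre w a + pre w i \<le> pre w (i + a))"

definition suffix_max :: "nat list \<Rightarrow> bool"
  where "suffix_max w \<longleftrightarrow> (\<forall>i a. i + a \<le> length w \<longrightarrow>
    pre w (i + a) + pre w (length w - a) \<le> pre w i + sum_list w)"

lemma prefix_minD: "prefix_min w \<Longrightarrow> i + a \<le> length w \<Longrightarrow> pre w a + pre w i \<le> pre w (i + a)"
  by (auto simp: prefix_min_def)

lemma suffix_maxD: "suffix_max w \<Longrightarrow> i + a \<le> length w \<Longrightarrow>
    pre w (i + a) + pre w (length w - a) \<le> pre w i + sum_list w"
  by (auto simp: suffix_max_def)

text \<open>A window that straddles the boundary is a suffix of \<open>u\<close> followed by a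
  prefix of \<open>v\<close> with \<open>t\<close> letters. The suffix is at least the equally long
  window of \<open>u\<close> after the first \<open>t\<close> letters, the prefix of
  \<open>v\<close> at least that of \<open>u\<close>, and these two pieces of \<open>u\<close> form
  a prefix. So even the claim on prefixes uses \<open>suffix_max u\<close>.\<close>

lemma prefix_min_append:
  assumes u: "prefix_min u" "suffix_max u" and v: "prefix_min v"
    and uv: "\<And>a. a \<le> length u \<Longrightarrow> a \<le> length v \<Longrightarrow> pre u a \<le> pre v a"
  shows "prefix_min (u @ v)"
  unfolding prefix_min_def
proof (intro allI impI)
  fix i a
  assume le: "i + a \<le> length (u @ v)"
  let ?m = "length u" 
  consider "i + a \<le> ?m" | "i \<le> ?m" "a \<le> ?m" "?m < i + a" | "i \<le> ?m" "?m < a" | "?m < i" "a \<le> ?m"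
    | "?m < i" "?m < a" by linarith
  then show "pre (u @ v) a + pre (u @ v) i \<le> pre (u @ v) (i + a)"
  proof cases
    case 1
    then show ?thesis using prefix_minD[OF u(1), of i a] by (simp add: pre_append)
  next
    case 2
    define t where "t = i + a - ?m"
    have "pre u t \<le> pre v t" using 2 le by (intro uv) (auto simp: t_def)
    moreover have "pre u a + pre u i \<le> pre u t + sum_list u"
      using suffix_maxD[OF u(2), of t "?m - i"] 2 by (simp add: t_def)
    ultimately show ?thesis using 2 by (simp add: pre_append pre_all t_def)
  next
    case 3
    have "pre u i \<le> pre v i" using 3 le by (intro uv) auto
    moreover have "pre v i + pre v (a - ?m) \<le> pre v (i + a - ?m)"
      using prefix_minD[OF v, of "a - ?m" i] 3 le by (simp add: add.commute)
    ultimately show ?thesis using 3 by (simp add: pre_append pre_all)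
  next
    case 4
    have "pre u a \<le> pre v a" using 4 le by (intro uv) auto
    moreover have "pre v a + pre v (i - ?m) \<le> pre v (i + a - ?m)"
      using prefix_minD[OF v, of "i - ?m" a] 4 le by simp
    ultimately show ?thesis using 4 by (simp add: pre_append pre_all)
  next
    case 5
    have "pre u ?m \<le> pre v ?m" using 5 le by (intro uv) auto
    moreover have "pre v ?m + pre v (i - ?m) \<le> pre v i"
      using prefix_minD[OF v, of "i - ?m" ?m] 5 le by simp
    moreover have "pre v (a - ?m) + pre v i \<le> pre v (i + a - ?m)"
      using prefix_minD[OF v, of i "a - ?m"] 5 le by (simp add: add.commute)
    ultimately show ?thesis using 5 by (simp add: pre_append pre_all)
  qed
qed

text \<open>Mirror image of the previous argument: the part of the window in \<open>u\<close> is
  compared with a suffix of \<open>v\<close>, and the part in \<open>v\<close>, being a prefix, is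
  bounded by the window of \<open>v\<close> just before that suffix.\<close>

lemma suffix_max_append:
  assumes u: "suffix_max u" and v: "prefix_min v" "suffix_max v"
    and uv: "\<And>a. a \<le> length u \<Longrightarrow> a \<le> length v \<Longrightarrow>
      sum_list u + pre v (length v - a) \<le> pre u (length u - a) + sum_list v"
  shows "suffix_max (u @ v)"
  unfolding suffix_max_def
proof (intro allI impI)
  fix i a
  assume le: "i + a \<le> length (u @ v)"
  let ?m = "length u" and ?k = "length v"
  consider "?m \<le> i" | "i \<le> ?m" "?m \<le> i + a" "a \<le> ?k" | "i \<le> ?m" "?m \<le> i + a" "?k < a"
    | "i + a < ?m" "a \<le> ?k" | "i + a < ?m" "?k < a" by linarith
  then show "pre (u @ v) (i + a) + pre (u @ v) (length (u @ v) - a) \<le> pre (u @ v) i + sum_list (u @ v)"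
  proof cases
    case 1
    then show ?thesis using suffix_maxD[OF v(2), of "i - ?m" a] le by (simp add: pre_append pre_all)
  next
    case 2
    have "sum_list u + pre v (?k - (?m - i)) \<le> pre u i + sum_list v"
      using uv[of "?m - i"] 2 le by simp
    moreover have "pre v (i + a - ?m) + pre v (?k - a) \<le> pre v (?k - (?m - i))"
      using prefix_minD[OF v(1), of "?k - a" "i + a - ?m"] 2 le by simp
    ultimately show ?thesis using 2 le by (simp add: pre_append pre_all)
  next
    case 3
    \<comment> \<open>\<open>t\<close> letters follow the window. As \<open>a\<close> exceeds the
      length of \<open>v\<close>, the suffix of length \<open>a\<close> starts inside
      \<open>u\<close>, at position \<open>i + t\<close>.\<close>
    define t where "t = ?m + ?k - (i + a)"
    have "sum_list u + pre v (?k - t) \<le> pre u (?m - t) + sum_list v"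
      using uv[of t] 3 le by (simp add: t_def)
    moreover have "pre u (i + t) + pre u (?m - t) \<le> pre u i + sum_list u"
      using suffix_maxD[OF u, of i t] 3 le by (simp add: t_def)
    moreover have "pre (u @ v) (i + a) = sum_list u + pre v (?k - t)"
    proof -
      have "i + a - ?m = ?k - t" using 3 le by (simp add: t_def)
      then show ?thesis using 3 by (simp add: pre_append pre_all)
    qed
    moreover have "pre (u @ v) (length (u @ v) - a) = pre u (i + t)"
    proof -
      have "length (u @ v) - a = i + t" "i + t \<le> ?m" using 3 le by (simp_all add: t_def)
      then show ?thesis by (simp only: pre_append) simp
    qed
    moreover have "pre (u @ v) i = pre u i" using 3 by (simp add: pre_append)
    ultimately show ?thesis by simp
  next
    case 4
    have "sum_list u + pre v (?k - a) \<le> pre u (?m - a) + sum_list v"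
      using uv[of a] 4 le by simp
    moreover have "pre u (i + a) + pre u (?m - a) \<le> pre u i + sum_list u"
      using suffix_maxD[OF u, of i a] 4 le by simp
    ultimately show ?thesis using 4 le by (simp add: pre_append pre_all)
  next
    case 5
    have "sum_list u \<le> pre u (?m - ?k) + sum_list v"
      using uv[of ?k] 5 le by simp
    moreover have "pre u (i + a) + pre u (?m - ?k) \<le> pre u (i + a - ?k) + sum_list u"
      using suffix_maxD[OF u, of "i + a - ?k" ?k] 5 le by simp
    moreover have "pre u (i + a - ?k) + pre u (?m - (a - ?k)) \<le> pre u i + sum_list u"
      using suffix_maxD[OF u, of i "a - ?k"] 5 le by simp
    ultimately show ?thesis using 5 le by (simp add: pre_append pre_all)
  qed
qed

text \<open>Supplies the comparison of prefixes when the two blocks of the recursion are glued. The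
  first block of the second word is a suffix of \<open>lexword p e\<close>, so a prefix inside it is
  a window of that word; a longer prefix uses up the block, which is a largest window, and the rest
  follows by induction.\<close>

lemma pre_lexword_le_Suc:
  assumes w: "prefix_min (lexword p e)" "suffix_max (lexword p e)" and "2 \<le> p"
  shows "e' \<le> e \<Longrightarrow> a \<le> length (lexword p e) \<Longrightarrow> a \<le> length (lexword (Suc p) e') \<Longrightarrow>
    pre (lexword p e) a \<le> pre (lexword (Suc p) e') a"
proof (induction e' arbitrary: a)
  case 0
  then have "a = 0 \<or> a = 1" by auto
  then show ?case using pre_diff_le[OF set_lexword, of 0 1 p e] by (auto simp: pre_def)
next
  case (Suc e')
  let ?u = "lexword p e" and ?f = "lexword p (Suc e')"
  obtain p' where p: "p = Suc (Suc p')" using \<open>2 \<le> p\<close> by (metis add_2_eq_Suc le_Suc_ex)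
  have v: "lexword (Suc p) (Suc e') = ?f @ lexword (Suc p) e'" using p by (simp add: lexword.simps(4))
  obtain x where x: "?u = x @ ?f"
    using lexword_suffix[OF Suc.prems(1), of p'] p by auto
  show ?case
  proof (cases "a \<le> length ?f")
    case True
    then show ?thesis using prefix_minD[OF w(1), of "length x" a]
      by (simp add: v pre_append) (simp add: x pre_append pre_all)
  next
    case False
    let ?m = "length ?f"
    have "pre ?u (a - ?m) \<le> pre (lexword (Suc p) e') (a - ?m)"
      using Suc.prems v by (intro Suc.IH) auto
    moreover have "pre ?u a + pre ?u (length ?u - ?m) \<le> pre ?u (a - ?m) + sum_list ?u"
      using suffix_maxD[OF w(2), of "a - ?m" ?m] False Suc.prems by simp
    moreover have "pre ?u (length ?u - ?m) + sum_list ?f = sum_list ?u"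
      by (simp add: x pre_append pre_all)
    ultimately show ?thesis using False by (simp add: v pre_append pre_all)
  qed
qed

text \<open>Supplies the comparison of suffixes. The last block of the first word is a prefix of
  \<open>lexword q e\<close>, so its suffixes are windows there; once the block is used up,
  induction on \<open>p\<close> takes over, because a prefix is a smallest window.\<close>

lemma suffix_lexword_le:
  assumes v: "prefix_min (lexword q e)" "suffix_max (lexword q e)" and "0 < p"
  shows "p \<le> q \<Longrightarrow> a \<le> length (lexword p (Suc e)) \<Longrightarrow> a \<le> length (lexword q e) \<Longrightarrow>
    sum_list (lexword p (Suc e)) + pre (lexword q e) (length (lexword q e) - a)
      \<le> pre (lexword p (Suc e)) (length (lexword p (Suc e)) - a) + sum_list (lexword q e)"
  using \<open>0 < p\<close>
proof (induction p arbitrary: a rule: nat_induct_non_zero)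
  case 1
  then show ?case by (simp add: pre_le_sum_list trans_le_add2)
next
  case (Suc p)
  let ?v = "lexword q e" and ?f = "lexword (Suc p) e"
  show ?case
  proof (cases "e = 0")
    case True
    then have "a = 0 \<or> a = 1" using Suc.prems by auto
    then show ?thesis
      using True pre_diff_le[OF set_lexword, of "length (lexword (Suc p) (Suc e)) - 1" "length (lexword (Suc p) (Suc e))" "Suc p" "Suc e"]
      by (auto simp: pre_def)
  next
    case False
    then obtain x where x: "?v = ?f @ x" using lexword_prefix[OF Suc.prems(1), of e] by auto
    let ?u = "lexword p (Suc e)" and ?m = "length ?f"
    have w: "lexword (Suc p) (Suc e) = ?u @ ?f" using \<open>0 < p\<close> by (simp add: lexword.simps(4))
    show ?thesis
    proof (cases "a \<le> ?m")
      case True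
      have "pre ?v ?m + pre ?v (length ?v - a) \<le> pre ?v (?m - a) + sum_list ?v"
        using suffix_maxD[OF v(2), of "?m - a" a] True x by simp
      moreover have "pre ?v ?m = sum_list ?f" "pre ?v (?m - a) = pre ?f (?m - a)"
        by (auto simp: x pre_append pre_all)
      ultimately show ?thesis using True by (simp add: w pre_append pre_all)
    next
      case False
      let ?L = "length ?v"
      have "sum_list ?u + pre ?v (?L - (a - ?m)) \<le> pre ?u (length ?u - (a - ?m)) + sum_list ?v"
        using Suc.prems w False by (intro Suc.IH) auto
      moreover have "pre ?v ?m + pre ?v (?L - a) \<le> pre ?v (?L - (a - ?m))"
        using prefix_minD[OF v(1), of "?L - a" ?m] False Suc.prems by simp
      moreover have "pre ?v ?m = sum_list ?f"
        by (auto simp: x pre_append pre_all)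
      ultimately show ?thesis using False by (simp add: w pre_append pre_all)
    qed
  qed
qed

lemma prefix_min_suffix_max_short:
  assumes "length w \<le> 1"
  shows "prefix_min w \<and> suffix_max w"
proof (cases w)
  case (Cons x v)
  then have "w = [x]" using assms by simp
  moreover have "i + a \<le> Suc 0 \<longleftrightarrow> i = 0 \<and> a = 0 \<or> i = 0 \<and> a = 1 \<or> i = 1 \<and> a = 0" for i a :: nat
    by linarith
  ultimately show ?thesis by (auto simp: prefix_min_def suffix_max_def pre_def)
qed (simp add: prefix_min_def suffix_max_def)

text \<open>Both properties have to be proved together: gluing two blocks uses prefix and suffix
  bounds, whichever of the two is claimed.\<close>

lemma lexword_windows: "prefix_min (lexword q d) \<and> suffix_max (lexword q d)"
proof (induction q d rule: lexword.induct)
  case (4 q d)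
  show ?case
  proof (cases "q = 0")
    case True
    then show ?thesis by (simp add: prefix_min_suffix_max_short)
  next
    case False
    let ?u = "lexword q (Suc d)" and ?v = "lexword (Suc q) d"
    have u: "prefix_min ?u" "suffix_max ?u" and v: "prefix_min ?v" "suffix_max ?v"
      using 4 False by auto
    have w: "lexword (Suc q) (Suc d) = ?u @ ?v" using False by (simp add: lexword.simps(4))
    have "pre ?u a \<le> pre ?v a" if "a \<le> length ?u" "a \<le> length ?v" for a
    \<comment> \<open>With one variable the first block is \<open>[0]\<close> and the claim is
      immediate; the comparison lemma assumes two variables.\<close>
    proof (cases "q = 1")
      case True
      then show ?thesis using that pre_le_sum_list[of "lexword 1 (Suc d)" a] by simp
    next
      case False
      then show ?thesis using that \<open>q \<noteq> 0\<close> by (intro pre_lexword_le_Suc u) auto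
    qed
    then have "prefix_min (?u @ ?v)" by (intro prefix_min_append u v)
    moreover have "suffix_max (?u @ ?v)"
      using False by (intro suffix_max_append u v suffix_lexword_le) auto
    ultimately show ?thesis using w by metis
  qed
qed (simp_all add: prefix_min_suffix_max_short)

text \<open>What is needed to move letters from \<open>w\<close> into a word \<open>u\<close> that
  stands in front: a prefix of \<open>w\<close> has at most the sum of any equally long window of
  \<open>u\<close>, and a window of \<open>w\<close> at most that of the equally long suffix of
  \<open>u\<close>. Both hold if \<open>u\<close> is a suffix of \<open>w\<close> and
  \<open>w\<close> has the two window properties.\<close>

definition dominates :: "nat list \<Rightarrow> nat list \<Rightarrow> bool"
  where "dominates u w \<longleftrightarrow>
    (\<forall>a b. a \<le> length w \<longrightarrow> a + b \<le> length u \<longrightarrow> pre w a + pre u b \<le> pre u (a + b)) \<and>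
    (\<forall>s t. s \<le> length u \<longrightarrow> t + s \<le> length w \<longrightarrow>
      pre w (t + s) + pre u (length u - s) \<le> pre w t + sum_list u)"

lemma dominates_Nil: "dominates [] w"
  by (simp add: dominates_def)

lemma lexword_dominates:
  assumes "e \<le> d"
  shows "dominates (lexword n e) (lexword n d)"
proof -
  let ?w = "lexword n d" and ?u = "lexword n e"
  have *: ?thesis if "?w = x @ ?u" for x
    unfolding dominates_def
  proof (intro conjI allI impI)
    fix a b assume "a + b \<le> length ?u"
    then have "pre ?w a + pre ?w (length x + b) \<le> pre ?w (length x + b + a)"
      using that lexword_windows[of n d] by (intro prefix_minD) auto
    then show "pre ?w a + pre ?u b \<le> pre ?u (a + b)"
      by (simp add: that pre_append pre_all add_ac)
  next
    fix s t assume "s \<le> length ?u" "t + s \<le> length ?w"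
    moreover from this have "pre ?w (t + s) + pre ?w (length ?w - s) \<le> pre ?w t + sum_list ?w"
      using lexword_windows by (intro suffix_maxD) auto
    ultimately show "pre ?w (t + s) + pre ?u (length ?u - s) \<le> pre ?w t + sum_list ?u"
      by (simp add: that pre_append pre_all add_ac)
  qed
  \<comment> \<open>With at least two variables the word of the smaller degree is a suffix.
    Otherwise it need not be, as \<open>[1]\<close> against \<open>[0]\<close> for
    \<open>e = 0\<close> shows, but then the word of degree \<open>d\<close> has sum zero.\<close>
  consider "e = d" | "n \<le> 1" "e < d" | "2 \<le> n" using assms by linarith
  then show ?thesis
  proof cases
    case 1
    then show ?thesis using *[of "[]"] by simp
  next
    case 2
    then have "sum_list ?w = 0" by (cases n) auto
    then have "pre ?w a = 0" for a using pre_le_sum_list[of ?w a] by linarith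
    then show ?thesis by (simp add: dominates_def pre_mono pre_le_sum_list)
  next
    case 3
    then obtain q where "n = Suc (Suc q)" by (metis add_2_eq_Suc le_Suc_ex)
    then show ?thesis using * lexword_suffix[OF assms, of q] by auto
  qed
qed

text \<open>However \<open>a + b\<close> is shared, the sum does not decrease if all letters are
  taken from the front of the concatenation. The first unfinished word is filled up at the expense
  of \<open>w\<close>: its remaining suffix outweighs the final window that \<open>w\<close> gives
  up.\<close>

lemma pre_merge:
  assumes "\<And>u. u \<in> set us \<Longrightarrow> dominates u w"
  shows "a \<le> length w \<Longrightarrow> b \<le> length (concat us) \<Longrightarrow>
    pre w a + pre (concat us) b \<le> pre (concat us @ w) (a + b)"
  using assms
proof (induction us arbitrary: a b)
  case (Cons u us)
  have u: "dominates u w" using Cons.prems by simp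
  consider "length u \<le> b" | "a + b \<le> length u" | "b < length u" "length u < a + b" by linarith
  then show ?case
  proof cases
    case 1
    then have "pre w a + pre (concat us) (b - length u) \<le> pre (concat us @ w) (a + (b - length u))"
      using Cons.prems by (intro Cons.IH) auto
    then show ?thesis using 1 by (simp add: pre_append pre_all)
  next
    case 2
    then show ?thesis using u Cons.prems by (simp add: pre_append dominates_def)
  next
    case 3
    let ?s = "length u - b"
    have "pre w (a - ?s) + pre (concat us) 0 \<le> pre (concat us @ w) (a - ?s + 0)"
      using Cons.prems by (intro Cons.IH) auto
    moreover have "pre w (a - ?s + ?s) + pre u (length u - ?s) \<le> pre w (a - ?s) + sum_list u"
    proof -
      have "?s \<le> length u" "a - ?s + ?s \<le> length w" using 3 Cons.prems(1) by auto
      then show ?thesis using u unfolding dominates_def by blast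
    qed
    ultimately show ?thesis using 3 by (simp add: pre_append pre_all)
  qed
qed simp

section \<open>The numerical inequality behind the induction on the degree\<close>

lemma lexword_1_right: "lexword (Suc q) (Suc 0) = 0 # replicate q 1"
  by (induction q) (auto simp: replicate_append_same lexword.simps(4))

text \<open>The least value of \<open>y\<close> that violates the bound; \<open>pre w y - y\<close> decreases with \<open>y\<close>, so it is
  enough to exclude this one.\<close>

lemma pre_green_step:
  "0 < d \<Longrightarrow> c \<le> length (lexword q d) \<Longrightarrow> y = pre (lexword q d) c + 1 \<Longrightarrow> y \<le> c \<Longrightarrow>
    pre (lexword q d) y + pre (lexword q (d - 1)) (c - y) \<le> pre (lexword q d) c"
proof (induction q d arbitrary: c y rule: lexword.induct)
  case (4 q d c y)
  let ?w = "lexword (Suc q) (Suc d)" and ?u = "lexword q (Suc d)" and ?v = "lexword (Suc q) d"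
  consider "d = 0" | "0 < d" "c \<le> length ?u" | "0 < d" "length ?u < c" by linarith
  then show ?case
  proof cases
    case 1
    \<comment> \<open>In degree 1 only the smallest monomial has the letter 0, so
      \<open>y = c\<close> and nothing is left to prove.\<close>
    obtain c' where c': "c = Suc c'" using "4.prems"(3, 4) by (cases c) auto
    have w: "?w = 0 # replicate q 1" using 1 lexword_1_right by simp
    have cq: "c' \<le> q" using "4.prems"(2) by (simp add: w c')
    have yc: "y = c" using "4.prems"(3) cq by (simp add: w c' pre_def sum_list_replicate min_def)
    show ?thesis by (simp add: yc)
  next
    case 2
    then have w: "?w = ?u @ ?v" using lexword_Suc_2[of "Suc d" q] by simp
    show ?thesis
    proof (cases q)
      case 0
      then show ?thesis using 2 "4.prems" by simp
    next
      case (Suc p)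
      have y: "y = pre ?u c + 1" using "4.prems" 2 by (simp add: w pre_append)
      then have IH: "pre ?u y + pre (lexword q d) (c - y) \<le> pre ?u c"
        using "4.IH"(1)[of c y] "4.prems" 2 by simp
      obtain x where x: "?v = lexword q d @ x" using lexword_prefix[of q "Suc q" d] 2 by auto
      \<comment> \<open>\<open>c - y\<close> is less than the number of letters 0 in
        \<open>u\<close>, which is the length of \<open>lexword q d\<close>; hence the second prefix
        stays inside that word.\<close>
      have "pre ?u (length ?u) \<le> pre ?u c + (length ?u - c)"
        using 2 by (intro pre_diff_le set_lexword)
      then have "c - y \<le> length (lexword q d)"
        using y 2 "4.prems" Suc sum_list_lexword[of "Suc d" p] length_lexword_Suc[of "Suc d" p] by (simp add: pre_all)
      then have "pre ?v (c - y) = pre (lexword q d) (c - y)" by (simp add: x pre_append)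
      then show ?thesis using IH "4.prems" 2 unfolding w by (simp add: pre_append)
    qed
  next
    case 3
    then have w: "?w = ?u @ ?v" using lexword_Suc_2[of "Suc d" q] by simp
    \<comment> \<open>The same question for the second block: \<open>c\<close> is shifted by the
      length of \<open>u\<close> and \<open>y\<close> by its sum, so \<open>c - y\<close> changes by
      the number of zeros of \<open>u\<close>.\<close>
    define c' y' where "c' = c - length ?u" and "y' = pre ?v c' + 1"
    have c': "0 < c'" "c' \<le> length ?v" "c = length ?u + c'" using 3 "4.prems"(2) by (auto simp: c'_def w)
    have "y' \<le> c'" using pre_lexword_less[OF 3(1) c'(1)] by (simp add: y'_def Suc_leI)
    show ?thesis
    proof (cases q)
      case 0
      then have "?v = [0]" "?u = []" using 3 by auto
      moreover have "c' = 1" using \<open>y' \<le> c'\<close> calculation c' y'_def by simp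
      ultimately show ?thesis using "4.prems" c' by (simp add: w pre_append pre_def)
    next
      case (Suc p)
      let ?u' = "lexword p (Suc d)" and ?f = "lexword q d"
      have wu: "?u = ?u' @ ?f" using Suc 3 lexword_Suc_2[of "Suc d" p] by simp
      have u1: "sum_list ?u = length ?u'" using Suc sum_list_lexword[of "Suc d" p] by simp
      have v1: "sum_list ?v = length ?f" using 3 sum_list_lexword[of d q] by simp
      have pc: "pre ?w c = length ?u' + pre ?v c'" by (simp add: w pre_append pre_all c' u1)
      then have y: "y = length ?u' + y'" using "4.prems" by (simp add: y'_def)
      have cy: "c - y = length ?f + (c' - y')" using \<open>y' \<le> c'\<close> c' wu y by simp
      obtain x where x: "?v = ?f @ x" using lexword_prefix[of q "Suc q" d] 3 by auto
      show ?thesis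
      proof (cases "y' \<le> length ?f")
        case True
        have "pre ?v y' + pre (lexword (Suc q) (d - 1)) (c' - y') \<le> pre ?v c'"
          using "4.IH"(2)[of c' y'] 3 c' y'_def \<open>y' \<le> c'\<close> Suc by simp
        moreover have "pre ?v y' = pre ?f y'" using True by (simp add: x pre_append)
        moreover have "pre ?w y = sum_list ?u' + pre ?f y'"
          using y True by (simp add: w wu pre_append pre_all)
        moreover have "pre ?v (c - y) = sum_list ?f + pre (lexword (Suc q) (d - 1)) (c' - y')"
          using Suc 3 lexword_Suc[of d p] cy by (simp add: pre_append pre_all)
        moreover have "sum_list ?u' + sum_list ?f = length ?u'" using wu u1 by simp
        ultimately show ?thesis using pc by simp
      next
        case False
        \<comment> \<open>Here the prefix of length \<open>c'\<close> contains all ones of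
          \<open>?v\<close>, and \<open>y\<close> reaches just one letter, a 0, into
          \<open>?v\<close>.\<close>
        have "pre ?v c' \<le> length ?f" using pre_le_sum_list[of ?v c'] v1 by simp
        then have "y' = length ?f + 1" "pre ?v c' = length ?f" using False y'_def by auto
        then have "pre ?w y = length ?u' + pre ?v 1" using y wu u1 by (simp add: w pre_append pre_all)
        then have "pre ?w y = length ?u'" using pre_1_lexword[OF 3(1), of "Suc q"] by simp
        moreover have "pre ?v (c - y) \<le> length ?f" using pre_le_sum_list[of ?v] v1 by simp
        ultimately show ?thesis using pc \<open>pre ?v c' = length ?f\<close> by simp
      qed
    qed
  qed
next
  case (1 c y)
  then show ?case by simp
next
  case (2 d c y)
  then show ?case by simp
next
  case (3 q c y)
  then show ?case by simp
qed

lemma pre_green: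
  assumes "0 < d" "c \<le> length (lexword q d)" "y \<le> c"
    and y: "y \<le> pre (lexword q d) y + pre (lexword q (d - 1)) (c - y)"
  shows "y \<le> pre (lexword q d) c"
proof (rule ccontr)
  let ?w = "lexword q d" and ?v = "lexword q (d - 1)"
  define y0 where "y0 = pre ?w c + 1"
  assume "\<not> ?thesis"
  then have "y0 \<le> y" by (simp add: y0_def)
  have "pre ?w y \<le> pre ?w y0 + (y - y0)"
    by (intro pre_diff_le set_lexword \<open>y0 \<le> y\<close>)
  moreover have "pre ?v (c - y) \<le> pre ?v (c - y0)"
    using \<open>y0 \<le> y\<close> by (intro pre_mono) auto
  moreover have "pre ?w y0 + pre ?v (c - y0) \<le> pre ?w c"
    by (rule pre_green_step) (use assms(1-3) \<open>y0 \<le> y\<close> y0_def in linarith)+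
  ultimately show False using y \<open>y0 \<le> y\<close> y0_def by linarith
qed

section \<open>Finitely spanned subspaces\<close>

text \<open>The ambient spaces are infinite-dimensional, where \<open>dim\<close> carries no
  information; this condition marks the sets whose dimensions may be compared. The span is a
  parameter so that one notion serves all vector spaces.\<close>

definition fin_spanned :: "('b set \<Rightarrow> 'b set) \<Rightarrow> 'b set \<Rightarrow> bool"
  where "fin_spanned sp A \<longleftrightarrow> (\<exists>T. finite T \<and> A \<subseteq> sp T)"

context vector_space begin

lemma fin_spanned_subset: "A \<subseteq> B \<Longrightarrow> fin_spanned span B \<Longrightarrow> fin_spanned span A"
  by (auto simp: fin_spanned_def)

lemma fin_spanned_span: "finite T \<Longrightarrow> fin_spanned span (span T)"
  by (auto simp: fin_spanned_def)

lemma fin_spanned_indep: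
  assumes "fin_spanned span A" "B \<subseteq> A" "independent B"
  shows "finite B"
  using assms independent_span_bound unfolding fin_spanned_def by (meson order_trans)

lemma fin_spanned_basis:
  assumes "fin_spanned span A"
  obtains B where "B \<subseteq> A" "independent B" "A \<subseteq> span B" "finite B" "card B = dim A"
  using assms basis_exists[of A] fin_spanned_indep by metis

lemma dim_mono:
  assumes "A \<subseteq> B" "fin_spanned span B"
  shows "dim A \<le> dim B"
proof -
  obtain C where C: "B \<subseteq> span C" "finite C" "card C = dim B"
    using assms(2) by (rule fin_spanned_basis)
  then show ?thesis using dim_le_card[of A C] assms(1) by auto
qed

lemma indep_card_le_dim:
  assumes "fin_spanned span A" "B \<subseteq> A" "independent B"
  shows "card B \<le> dim A"
  using dim_mono[OF assms(2,1)] dim_eq_card_independent[OF assms(3)] by simp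

lemma subspace_dim_le_imp_subset:
  assumes "subspace A" "A \<subseteq> B" "fin_spanned span B" "dim B \<le> dim A"
  shows "B \<subseteq> A"
proof (rule ccontr)
  assume "\<not> B \<subseteq> A"
  then obtain x where x: "x \<in> B" "x \<notin> A" by auto
  obtain C where C: "C \<subseteq> A" "independent C" "A \<subseteq> span C" "finite C" "card C = dim A"
    using fin_spanned_subset[OF assms(2,3)] by (rule fin_spanned_basis)
  have "span C \<subseteq> A" using C(1) assms(1) by (rule span_minimal)
  then have "independent (insert x C)" using C(2) x by (intro independent_insertI) auto
  then have "card (insert x C) \<le> dim B"
    using C(1) assms(2,3) x by (intro indep_card_le_dim) auto
  moreover have "x \<notin> C" using C(1) x by auto
  ultimately show False using C(4,5) assms(4) by simp
qed

text \<open>The relation with coefficients 1 and -1 excludes repetitions, so the image set is as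
  large as the index set.\<close>

lemma independent_family:
  assumes "finite J"
    and J: "\<And>u. (\<Sum>j\<in>J. scale (u j) (w j)) = 0 \<Longrightarrow> \<forall>j\<in>J. u j = 0"
  shows "inj_on w J" "independent (w ` J)"
proof -
  show inj: "inj_on w J"
  proof (rule inj_onI, rule ccontr)
    fix i j assume ij: "i \<in> J" "j \<in> J" "w i = w j" "i \<noteq> j"
    let ?u = "(\<lambda>k. if k = i then 1 else if k = j then - 1 else 0) :: _ \<Rightarrow> 'a"
    have "(\<Sum>k\<in>J. scale (?u k) (w k)) = (\<Sum>k\<in>{i, j}. scale (?u k) (w k))"
      using ij assms(1) by (intro sum.mono_neutral_right) auto
    also have "\<dots> = 0" using ij by simp
    finally have "\<forall>k\<in>J. ?u k = 0" by (rule J)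
    then show False using ij(1) by force
  qed
  show "independent (w ` J)"
  proof (rule independent_if_scalars_zero)
    fix f x assume f: "(\<Sum>x\<in>w ` J. scale (f x) x) = 0" and x: "x \<in> w ` J"
    have "(\<Sum>j\<in>J. scale (f (w j)) (w j)) = 0"
      using f by (simp add: sum.reindex[OF inj])
    then show "f x = 0" using J[of "\<lambda>j. f (w j)"] x by auto
  qed (simp add: assms)
qed

end

context vector_space_pair begin

text \<open>Rank-nullity for the map from \<open>T\<close> into the quotient by \<open>V\<close>
  induced by \<open>f\<close>, done with bases instead of the quotient: a basis of the preimage is
  extended to one of \<open>T\<close>, and the images of the added vectors complete a basis of
  \<open>V\<close> to one of the sum.\<close>

lemma dim_sum_preimage:
  assumes f: "Vector_Spaces.linear s1 s2 f" and T: "vs1.subspace T" "fin_spanned vs1.span T"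
    and V: "vs2.subspace V" "fin_spanned vs2.span V"
  shows "vs2.dim {x + f y |x y. x \<in> V \<and> y \<in> T} + vs1.dim {y \<in> T. f y \<in> V} = vs2.dim V + vs1.dim T"
proof -
  interpret f: Vector_Spaces.linear s1 s2 f by (rule f)
  let ?K = "{y \<in> T. f y \<in> V}" and ?S = "{x + f y |x y. x \<in> V \<and> y \<in> T}"
  have K: "vs1.subspace ?K"
    using T(1) V(1) by (auto simp: vs1.subspace_def vs2.subspace_def f.add f.scale f.zero)
  obtain BK where BK: "BK \<subseteq> ?K" "vs1.independent BK" "?K \<subseteq> vs1.span BK" "finite BK" "card BK = vs1.dim ?K"
    using vs1.fin_spanned_subset[OF _ T(2), of ?K] vs1.fin_spanned_basis[of ?K] by blast
  obtain BV where BV: "BV \<subseteq> V" "vs2.independent BV" "V \<subseteq> vs2.span BV" "finite BV" "card BV = vs2.dim V"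
    using V(2) by (rule vs2.fin_spanned_basis)
  obtain BT where BT: "BK \<subseteq> BT" "BT \<subseteq> T" "vs1.independent BT" "T \<subseteq> vs1.span BT"
    using vs1.maximal_independent_subset_extend[of BK T] BK by blast
  have finT: "finite BT" using vs1.fin_spanned_indep[OF T(2) BT(2,3)] .
  define D where "D = BT - BK"
  have cardT: "card BT = vs1.dim T" using BT by (intro vs1.basis_card_eq_dim)
  have cardD: "card D + card BK = vs1.dim T"
    using card_Diff_subset[OF BK(4) BT(1)] card_mono[OF finT BT(1)] cardT by (simp add: D_def)
  \<comment> \<open>The disjoint union keeps a vector of \<open>BV\<close> and an equal image of a
    vector of \<open>D\<close> apart until independence shows that there is no such
    coincidence.\<close>
  let ?J = "BV <+> D" and ?w = "case_sum (\<lambda>b. b) f"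
  have finD: "finite D" using finT by (simp add: D_def)
  have fam: "\<forall>j\<in>?J. u j = 0" if u: "(\<Sum>j\<in>?J. s2 (u j) (?w j)) = 0" for u
  proof -
    define y where "y = (\<Sum>d\<in>D. s1 (u (Inr d)) d)"
    have sum: "(\<Sum>b\<in>BV. s2 (u (Inl b)) b) + f y = 0"
      using u BV(4) finD by (simp add: sum.Plus y_def f.sum f.scale)
    have "f y = - (\<Sum>b\<in>BV. s2 (u (Inl b)) b)"
      using sum by (simp add: eq_neg_iff_add_eq_0 add.commute)
    then have "f y \<in> V"
      using BV(1) V(1) by (auto intro!: vs2.subspace_neg vs2.subspace_sum vs2.subspace_scale)
    moreover have "y \<in> T"
      unfolding y_def using BT(2) T(1) by (auto simp: D_def intro!: vs1.subspace_sum vs1.subspace_scale)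
    ultimately have "y \<in> vs1.span BK" using BK(3) by auto
    then obtain e where e: "y = (\<Sum>b\<in>BK. s1 (e b) b)"
      using vs1.span_finite[OF BK(4)] by auto
    define c where "c = (\<lambda>b. if b \<in> BK then e b else - u (Inr b))"
    have "(\<Sum>b\<in>BT. s1 (c b) b) = (\<Sum>b\<in>D. s1 (c b) b) + (\<Sum>b\<in>BK. s1 (c b) b)"
      unfolding D_def using sum.subset_diff[OF BT(1) finT] by blast
    also have "(\<Sum>b\<in>D. s1 (c b) b) = - y"
      unfolding y_def sum_negf[symmetric] by (intro sum.cong) (auto simp: D_def c_def)
    also have "(\<Sum>b\<in>BK. s1 (c b) b) = y" unfolding e by (intro sum.cong) (auto simp: c_def)
    finally have c0: "(\<Sum>b\<in>BT. s1 (c b) b) = 0" by simp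
    have "c b = 0" if "b \<in> BT" for b
      using vs1.independentD[OF BT(3) finT subset_refl c0 that] .
    then have uD: "u (Inr d) = 0" if "d \<in> D" for d
      using that by (force simp: D_def c_def)
    then have "y = 0" by (simp add: y_def)
    then have sum0: "(\<Sum>b\<in>BV. s2 (u (Inl b)) b) = 0" using sum f.zero by simp
    have "u (Inl b) = 0" if "b \<in> BV" for b
      using vs2.independentD[OF BV(2,4) subset_refl sum0 that] .
    with uD show ?thesis by auto
  qed
  have finJ: "finite ?J" using BV(4) finD by simp
  note ind = vs2.independent_family[OF finJ, of ?w, OF fam]
  have "vs2.dim ?S = card (?w ` ?J)"
  proof (rule vs2.dim_unique)
    have "0 \<in> T" "0 \<in> V" using T(1) V(1) vs1.subspace_0 vs2.subspace_0 by auto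
    have "v + f 0 \<in> ?S" if "v \<in> V" for v using that \<open>0 \<in> T\<close> by blast
    moreover have "0 + f t \<in> ?S" if "t \<in> T" for t using that \<open>0 \<in> V\<close> by blast
    ultimately show "?w ` ?J \<subseteq> ?S"
      using BV(1) BT(2) by (auto simp: D_def f.zero)
    let ?B = "BV \<union> f ` D"
    have img: "?w ` ?J = ?B" by force
    have "x + f y \<in> vs2.span ?B" if "x \<in> V" "y \<in> T" for x y
    proof -
      have "x \<in> vs2.span ?B" using that BV(3) vs2.span_mono[of BV ?B] by auto
      moreover have "f b \<in> vs2.span ?B" if "b \<in> BT" for b
      proof (cases "b \<in> BK")
        case True
        then have "f b \<in> V" using BK(1) by auto
        then show ?thesis using BV(3) vs2.span_mono[of BV ?B] by auto
      next
        case False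
        then show ?thesis using that by (intro vs2.span_base) (auto simp: D_def)
      qed
      then have "f ` BT \<subseteq> vs2.span ?B" by auto
      then have "vs2.span (f ` BT) \<subseteq> vs2.span ?B" by (rule vs2.span_minimal) simp
      then have "f y \<in> vs2.span ?B" using that BT(4) f.span_image[of BT] by auto
      ultimately show ?thesis by (rule vs2.span_add)
    qed
    then show "?S \<subseteq> vs2.span (?w ` ?J)" unfolding img by auto
    show "vs2.independent (?w ` ?J)" by (rule ind(2))
  qed simp
  also have "\<dots> = card BV + card D"
    using ind(1) BV(4) finD by (simp add: card_image card_Plus)
  finally show ?thesis using cardD BK(5) BV(5) by simp
qed

end

text \<open>Gaussian elimination: the pivots of an independent family at \<open>x0\<close> multiply to a function whose
  nonvanishing preserves independence.\<close>

lemma independence_open: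
  fixes A :: "('x \<Rightarrow> 'a::field) set" and w :: "'j \<Rightarrow> 'x \<Rightarrow> 'c \<Rightarrow> 'a"
  assumes one: "(\<lambda>x. 1) \<in> A"
    and mult: "\<And>f g. f \<in> A \<Longrightarrow> g \<in> A \<Longrightarrow> (\<lambda>x. f x * g x) \<in> A"
    and diff: "\<And>f g. f \<in> A \<Longrightarrow> g \<in> A \<Longrightarrow> (\<lambda>x. f x - g x) \<in> A"
  shows "finite J \<Longrightarrow> (\<And>j c. j \<in> J \<Longrightarrow> (\<lambda>x. w j x c) \<in> A) \<Longrightarrow>
    (\<And>u. (\<And>c. (\<Sum>j\<in>J. u j * w j x0 c) = 0) \<Longrightarrow> \<forall>j\<in>J. u j = 0) \<Longrightarrow>
    \<exists>g\<in>A. g x0 \<noteq> 0 \<and>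
      (\<forall>x. g x \<noteq> 0 \<longrightarrow> (\<forall>u. (\<forall>c. (\<Sum>j\<in>J. u j * w j x c) = 0) \<longrightarrow> (\<forall>j\<in>J. u j = 0)))"
proof (induction J arbitrary: w rule: finite_induct)
  case empty
  then show ?case using one by (intro bexI[of _ "\<lambda>x. 1"]) auto
next
  case (insert i J)
  have "\<exists>c. w i x0 c \<noteq> 0"
  proof (rule ccontr)
    assume "\<nexists>c. w i x0 c \<noteq> 0"
    then have z: "w i x0 c = 0" for c by blast
    have "\<forall>j\<in>insert i J. (if j = i then 1 else 0 :: 'a) = 0"
    proof (rule insert.prems(2))
      show "(\<Sum>j\<in>insert i J. (if j = i then 1 else 0) * w j x0 c) = 0" for c
        by (rule sum.neutral) (simp add: z)
    qed
    then show False by simp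
  qed
  then obtain c0 where c0: "w i x0 c0 \<noteq> 0" ..
  \<comment> \<open>Elimination of the coordinate \<open>c0\<close> by cross multiplication, so that
    no division leaves the class \<open>A\<close>.\<close>
  define w' where "w' = (\<lambda>j x c. w i x c0 * w j x c - w j x c0 * w i x c)"
  have w': "(\<Sum>j\<in>J. u j * w' j x c) =
      w i x c0 * (\<Sum>j\<in>J. u j * w j x c) - (\<Sum>j\<in>J. u j * w j x c0) * w i x c" for u x c
    by (simp add: w'_def sum_subtractf sum_distrib_left sum_distrib_right right_diff_distrib ac_simps)
  have "\<exists>g\<in>A. g x0 \<noteq> 0 \<and>
      (\<forall>x. g x \<noteq> 0 \<longrightarrow> (\<forall>u. (\<forall>c. (\<Sum>j\<in>J. u j * w' j x c) = 0) \<longrightarrow> (\<forall>j\<in>J. u j = 0)))"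
  proof (rule insert.IH)
    show "(\<lambda>x. w' j x c) \<in> A" if "j \<in> J" for j c
      unfolding w'_def using that insert.prems(1) by (intro mult diff) auto
    fix u assume u: "\<And>c. (\<Sum>j\<in>J. u j * w' j x0 c) = 0"
    \<comment> \<open>The coefficient at \<open>i\<close> is forced by the coordinate
      \<open>c0\<close>; the others carry the pivot as a factor to match the cross
      multiplication.\<close>
    let ?u = "\<lambda>j. if j = i then - (\<Sum>j\<in>J. u j * w j x0 c0) else w i x0 c0 * u j"
    have "(\<Sum>j\<in>J. ?u j * w j x0 c) = w i x0 c0 * (\<Sum>j\<in>J. u j * w j x0 c)" for c
      unfolding sum_distrib_left using insert.hyps(2) by (intro sum.cong) auto
    then have "(\<Sum>j\<in>insert i J. ?u j * w j x0 c) = 0" for c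
      using u[of c] insert.hyps by (simp add: w' algebra_simps)
    then have "\<forall>j\<in>insert i J. ?u j = 0" by (rule insert.prems(2))
    then show "\<forall>j\<in>J. u j = 0" using c0 insert.hyps(2) by (metis insertCI mult_eq_0_iff)
  qed
  then obtain g where g: "g \<in> A" "g x0 \<noteq> 0" and
    gx: "\<And>x u j. g x \<noteq> 0 \<Longrightarrow> (\<forall>c. (\<Sum>j\<in>J. u j * w' j x c) = 0) \<Longrightarrow> j \<in> J \<Longrightarrow> u j = 0"
    by blast
  show ?case
  proof (intro bexI conjI allI impI)
    show "(\<lambda>x. w i x c0 * g x) \<in> A" using insert.prems(1) g by (intro mult) auto
    show "w i x0 c0 * g x0 \<noteq> 0" using g c0 by simp
    fix x u assume x: "w i x c0 * g x \<noteq> 0" and "\<forall>c. (\<Sum>j\<in>insert i J. u j * w j x c) = 0"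
    then have u: "u i * w i x c + (\<Sum>j\<in>J. u j * w j x c) = 0" for c
      using insert.hyps by simp
    have "(\<Sum>j\<in>J. u j * w' j x c) = 0" for c
    proof -
      have *: "(\<Sum>j\<in>J. u j * w j x c) = - (u i * w i x c)" for c
        using u[of c] by (simp add: eq_neg_iff_add_eq_0 add.commute)
      show ?thesis unfolding w' * by simp
    qed
    then have uJ: "\<forall>j\<in>J. u j = 0" using gx x by auto
    then have "u i * w i x c0 = 0" using u[of c0] by simp
    then show "\<forall>j\<in>insert i J. u j = 0" using uJ x by simp
  qed
qed

text \<open>Indices are chosen whose vectors form a basis of \<open>W x0\<close>; by elimination the
  vectors with these indices stay independent wherever \<open>g\<close> is nonzero, and they lie in
  \<open>W x\<close>. The class \<open>A\<close> is left open because it will consist of polynomial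
  functions of one parameter in one use and of the coefficients of a linear form in the
  other.\<close>

lemma (in vector_space) dim_lower_semicontinuous:
  fixes A :: "('x \<Rightarrow> 'a) set" and w :: "'j \<Rightarrow> 'x \<Rightarrow> 'b" and \<phi> :: "'c \<Rightarrow> 'b \<Rightarrow> 'a"
  assumes one: "(\<lambda>x. 1) \<in> A"
    and mult: "\<And>f g. f \<in> A \<Longrightarrow> g \<in> A \<Longrightarrow> (\<lambda>x. f x * g x) \<in> A"
    and diff: "\<And>f g. f \<in> A \<Longrightarrow> g \<in> A \<Longrightarrow> (\<lambda>x. f x - g x) \<in> A"
    and \<phi>: "\<And>c. Vector_Spaces.linear scale (*) (\<phi> c)" "\<And>v. (\<And>c. \<phi> c v = 0) \<Longrightarrow> v = 0"
    and w: "\<And>j c. j \<in> J \<Longrightarrow> (\<lambda>x. \<phi> c (w j x)) \<in> A" "\<And>j x. j \<in> J \<Longrightarrow> w j x \<in> W x"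
    and W: "\<And>x. fin_spanned span (W x)" "W x0 \<subseteq> span ((\<lambda>j. w j x0) ` J)"
  shows "\<exists>g\<in>A. g x0 \<noteq> 0 \<and> (\<forall>x. g x \<noteq> 0 \<longrightarrow> dim (W x0) \<le> dim (W x))"
proof -
  have lin: "\<phi> c (\<Sum>j\<in>K. scale (u j) (v j)) = (\<Sum>j\<in>K. u j * \<phi> c (v j))" for c K u and v :: "'y \<Rightarrow> 'b"
  proof -
    interpret f: Vector_Spaces.linear scale "(*)" "\<phi> c" by (rule \<phi>)
    show ?thesis by (simp add: f.sum f.scale)
  qed
  obtain B where B: "B \<subseteq> (\<lambda>j. w j x0) ` J" "independent B" "(\<lambda>j. w j x0) ` J \<subseteq> span B"
    using maximal_independent_subset by blast
  then obtain K where K: "K \<subseteq> J" "inj_on (\<lambda>j. w j x0) K" "B = (\<lambda>j. w j x0) ` K"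
    by (auto simp: subset_image_inj)
  have BW: "B \<subseteq> W x0" using B(1) w(2) by auto
  have "span ((\<lambda>j. w j x0) ` J) \<subseteq> span B" using B(3) by (rule span_minimal) simp
  then have cardB: "card B = dim (W x0)" using BW W(2) B(2) by (intro basis_card_eq_dim) auto
  have "finite B" using fin_spanned_indep[OF W(1) BW B(2)] .
  then have finK: "finite K" using K(2,3) finite_image_iff by blast
  have "\<exists>g\<in>A. g x0 \<noteq> 0 \<and>
      (\<forall>x. g x \<noteq> 0 \<longrightarrow> (\<forall>u. (\<forall>c. (\<Sum>j\<in>K. u j * \<phi> c (w j x)) = 0) \<longrightarrow> (\<forall>j\<in>K. u j = 0)))"
  proof (rule independence_open[OF one mult diff finK])
    show "(\<lambda>x. \<phi> c (w j x)) \<in> A" if "j \<in> K" for j c using that K(1) w(1) by auto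
    fix u assume "\<And>c. (\<Sum>j\<in>K. u j * \<phi> c (w j x0)) = 0"
    then have "(\<Sum>j\<in>K. scale (u j) (w j x0)) = 0" by (intro \<phi>(2)) (simp add: lin)
    moreover define v where "v = (\<lambda>b. u (the_inv_into K (\<lambda>j. w j x0) b))"
    have v: "v (w j x0) = u j" if "j \<in> K" for j using that the_inv_into_f_f[OF K(2) that] by (simp add: v_def)
    ultimately have "(\<Sum>b\<in>B. scale (v b) b) = 0"
      by (simp add: K(3) sum.reindex[OF K(2)] v)
    then have "v b = 0" if "b \<in> B" for b
      using independentD[OF B(2) \<open>finite B\<close> subset_refl _ that] by blast
    then show "\<forall>j\<in>K. u j = 0" using v K(3) by force
  qed
  then obtain g where g: "g \<in> A" "g x0 \<noteq> 0" and
    gx: "\<And>x u. g x \<noteq> 0 \<Longrightarrow> (\<And>c. (\<Sum>j\<in>K. u j * \<phi> c (w j x)) = 0) \<Longrightarrow> \<forall>j\<in>K. u j = 0" by blast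
  have "dim (W x0) \<le> dim (W x)" if x: "g x \<noteq> 0" for x
  proof -
    have fam: "\<forall>j\<in>K. u j = 0" if "(\<Sum>j\<in>K. scale (u j) (w j x)) = 0" for u
    proof (rule gx[OF x])
      interpret f: Vector_Spaces.linear scale "(*)" "\<phi> c" for c by (rule \<phi>)
      show "(\<Sum>j\<in>K. u j * \<phi> c (w j x)) = 0" for c
        using arg_cong[OF that, of "\<phi> c"] f.zero by (simp add: lin)
    qed
    note ind = independent_family[OF finK, of "\<lambda>j. w j x", OF fam]
    have "card ((\<lambda>j. w j x) ` K) \<le> dim (W x)"
      using w(2) K(1) by (intro indep_card_le_dim W ind(2)) auto
    then show ?thesis using cardB K ind(1) by (simp add: card_image)
  qed
  then show ?thesis using g by blast
qed

section \<open>Vector spaces given by records\<close>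

lemma vectorspace_class_ringI:
  fixes V :: "('a::field, 'v) module"
  assumes "abelian_group V"
    and "\<And>c x. x \<in> carrier V \<Longrightarrow> c \<odot>\<^bsub>V\<^esub> x \<in> carrier V"
    and "\<And>a b x. x \<in> carrier V \<Longrightarrow> (a + b) \<odot>\<^bsub>V\<^esub> x = a \<odot>\<^bsub>V\<^esub> x \<oplus>\<^bsub>V\<^esub> b \<odot>\<^bsub>V\<^esub> x"
    and "\<And>a x y. x \<in> carrier V \<Longrightarrow> y \<in> carrier V \<Longrightarrow> a \<odot>\<^bsub>V\<^esub> (x \<oplus>\<^bsub>V\<^esub> y) = a \<odot>\<^bsub>V\<^esub> x \<oplus>\<^bsub>V\<^esub> a \<odot>\<^bsub>V\<^esub> y"
    and "\<And>a b x. x \<in> carrier V \<Longrightarrow> (a * b) \<odot>\<^bsub>V\<^esub> x = a \<odot>\<^bsub>V\<^esub> (b \<odot>\<^bsub>V\<^esub> x)"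
    and "\<And>x. x \<in> carrier V \<Longrightarrow> 1 \<odot>\<^bsub>V\<^esub> x = x"
  shows "vectorspace (class_ring :: 'a ring) V"
proof (rule vectorspace.intro)
  show "field (class_ring :: 'a ring)" by (rule class_field)
  show "Module.module (class_ring :: 'a ring) V"
  proof (rule moduleI)
    have "field (class_ring :: 'a ring)" by (rule class_field)
    then show "cring (class_ring :: 'a ring)" by (simp add: field_def domain_def)
  qed (use assms in auto)
qed

context vector_space begin

lemma vectorspace_subspace:
  fixes V :: "('a, 'b) module"
  assumes C: "subspace C" and V: "carrier V = C" "zero V = 0" "add V = (+)" "module.smult V = scale"
  shows "vectorspace (class_ring :: 'a ring) V"
proof (rule vectorspace_class_ringI)
  show "abelian_group V"
  proof (rule abelian_groupI)
    show "\<exists>y\<in>carrier V. y \<oplus>\<^bsub>V\<^esub> x = \<zero>\<^bsub>V\<^esub>" if "x \<in> carrier V" for x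
      using that subspace_neg[OF C, of x] by (intro bexI[of _ "- x"]) (simp_all add: V)
  qed (use C in \<open>auto simp: V subspace_def add_ac\<close>)
qed (use C in \<open>auto simp: V subspace_def scale_left_distrib scale_right_distrib\<close>)

lemma finsum_subspace:
  fixes V :: "('a, 'b) module"
  assumes C: "subspace C" and V: "carrier V = C" "zero V = 0" "add V = (+)" "module.smult V = scale"
    and "finite A" "g ` A \<subseteq> C"
  shows "finsum V g A = sum g A"
proof -
  interpret V: vectorspace class_ring V by (rule vectorspace_subspace[OF C V])
  show ?thesis using assms(6,7)
  proof (induction A rule: finite_induct)
    case (insert x F)
    have "finsum V g (insert x F) = g x \<oplus>\<^bsub>V\<^esub> finsum V g F"
      by (rule V.M.finsum_insert) (use insert V(1) in auto)
    then show ?case using insert by (simp add: V(3))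
  qed (simp add: V(2))
qed

lemma span_subspace_record:
  fixes V :: "('a, 'b) module"
  assumes C: "subspace C" and V: "carrier V = C" "zero V = 0" "add V = (+)" "module.smult V = scale"
    and A: "finite A" "A \<subseteq> C"
  shows "LinearCombinations.module.span (class_ring :: 'a ring) V A = span A"
proof -
  interpret V: vectorspace class_ring V by (rule vectorspace_subspace[OF C V])
  have L: "V.lincomb a A = (\<Sum>v\<in>A. scale (a v) v)" for a
    unfolding V.lincomb_def using A subspace_scale[OF C]
    by (subst finsum_subspace[OF C V A(1)]) (auto simp: V(4))
  have "V.span A = {V.lincomb a A |a. a \<in> A \<rightarrow> carrier class_ring}"
    by (rule V.finite_span) (use A V(1) in auto)
  also have "\<dots> = range (\<lambda>u. \<Sum>v\<in>A. scale (u v) v)" unfolding L by auto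
  also have "\<dots> = span A" by (rule span_finite[OF A(1), symmetric])
  finally show ?thesis .
qed

text \<open>In a record the dimension is the least size of a finite generating set. A basis attains
  it, and no generating set has fewer than \<open>dim C\<close> elements.\<close>

lemma vectorspace_dim_subspace:
  fixes V :: "('a, 'b) module"
  assumes C: "subspace C" "fin_spanned span C"
    and V: "carrier V = C" "zero V = 0" "add V = (+)" "module.smult V = scale"
  shows "vectorspace.dim (class_ring :: 'a ring) V = dim C" "vectorspace.fin_dim (class_ring :: 'a ring) V"
proof -
  interpret V: vectorspace class_ring V by (rule vectorspace_subspace[OF C(1) V])
  obtain B where B: "B \<subseteq> C" "C \<subseteq> span B" "finite B" "card B = dim C"
    using C(2) by (rule fin_spanned_basis)
  have "span B = C" using span_minimal[OF B(1) C(1)] B(2) by (rule equalityI)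
  then have gen: "V.span B = carrier V" using span_subspace_record[OF C(1) V B(3,1)] V(1) by simp
  then show "V.fin_dim" unfolding V.fin_dim_def using B V(1) by blast
  show "V.dim = dim C"
    unfolding V.dim_def
  proof (rule Least_equality)
    show "\<exists>A. finite A \<and> card A = dim C \<and> A \<subseteq> carrier V \<and> V.span A = carrier V"
      using B gen V(1) by blast
    fix k assume "\<exists>A. finite A \<and> card A = k \<and> A \<subseteq> carrier V \<and> V.span A = carrier V"
    then obtain A where A: "finite A" "card A = k" "A \<subseteq> C" "V.span A = C" using V(1) by auto
    then have "C = span A" using span_subspace_record[OF C(1) V A(1,3)] by simp
    then show "dim C \<le> k" using dim_le_card[of C A] A by auto
  qed
qed

text \<open>Rank-nullity for the linear map \<open>T\<close> on \<open>C\<close>, whose kernel is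
  \<open>N \<inter> C\<close>. In the application \<open>T\<close> sends a vector to its
  coset.\<close>

lemma vectorspace_dim_quotient:
  fixes W :: "('a, 'w) module" and T :: "'b \<Rightarrow> 'w"
  assumes C: "subspace C" "fin_spanned span C"
    and W: "carrier W = T ` C" "zero W = T 0"
    and add: "\<And>v w. v \<in> C \<Longrightarrow> w \<in> C \<Longrightarrow> T v \<oplus>\<^bsub>W\<^esub> T w = T (v + w)"
    and smult: "\<And>c v. v \<in> C \<Longrightarrow> c \<odot>\<^bsub>W\<^esub> T v = T (scale c v)"
    and ker: "\<And>v. v \<in> C \<Longrightarrow> T v = T 0 \<longleftrightarrow> v \<in> N"
  shows "vectorspace.dim (class_ring :: 'a ring) W + dim (N \<inter> C) = dim C"
proof -
  let ?V = "\<lparr>carrier = C, mult = undefined, one = undefined, zero = 0, add = (+), smult = scale\<rparr> :: ('a, 'b) module"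
  have V: "vectorspace class_ring ?V" by (rule vectorspace_subspace[OF C(1)]) auto
  note cl = subspace_0[OF C(1)] subspace_add[OF C(1)] subspace_scale[OF C(1)] subspace_neg[OF C(1)]
  have W': "vectorspace (class_ring :: 'a ring) W"
  proof (rule vectorspace_class_ringI)
    show "abelian_group W"
    proof (rule abelian_groupI)
      show "\<exists>y\<in>carrier W. y \<oplus>\<^bsub>W\<^esub> x = \<zero>\<^bsub>W\<^esub>" if x: "x \<in> carrier W" for x
      proof -
        obtain v where v: "v \<in> C" "x = T v" using x W(1) by auto
        then show ?thesis using cl by (intro bexI[of _ "T (- v)"]) (auto simp: W add)
      qed
    qed (use cl in \<open>auto simp: W add add_ac\<close>)
  qed (use cl in \<open>auto simp: W add smult scale_left_distrib scale_right_distrib\<close>)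
  have hom: "mod_hom class_ring ?V W T"
    using V W' cl by (auto simp: mod_hom_def mod_hom_axioms_def vectorspace_def LinearCombinations.module_hom_def W add smult)
  interpret T: linear_map class_ring ?V W T
    by (intro linear_map.intro V W' hom)
  have "vectorspace.dim class_ring (W\<lparr>carrier := T.imT\<rparr>) + vectorspace.dim class_ring (?V\<lparr>carrier := T.kerT\<rparr>) = T.V.dim"
    by (rule T.rank_nullity) (rule vectorspace_dim_subspace[OF C], auto)
  moreover have "W\<lparr>carrier := T.imT\<rparr> = W" by (simp add: T.im_def W(1)[symmetric])
  moreover have kerT: "T.kerT = N \<inter> C" using ker by (auto simp: T.ker_def W(2))
  moreover have "T.V.dim = dim C" by (rule vectorspace_dim_subspace[OF C]) auto
  moreover have "vectorspace.dim class_ring (?V\<lparr>carrier := T.kerT\<rparr>) = dim (N \<inter> C)"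
  proof (rule vectorspace_dim_subspace(1))
    have "N \<inter> C = {v \<in> C. T v = T 0}" using ker by auto
    moreover have "T (v + w) = T 0" if "v \<in> C" "w \<in> C" "T v = T 0" "T w = T 0" for v w
      using that cl(1) add[of v w] add[of 0 0] by simp
    moreover have "T (scale c v) = T 0" if "v \<in> C" "T v = T 0" for c v
      using that cl(1) smult[of v c] smult[of 0 c] by simp
    ultimately show "subspace (N \<inter> C)" using cl unfolding subspace_def by auto
    show "fin_spanned span (N \<inter> C)" using C(2) by (rule fin_spanned_subset[rotated]) auto
  qed (auto simp: kerT)
  ultimately show ?thesis by simp
qed

end

section \<open>Polynomials and monomials of fixed degree\<close>

text \<open>Common frame for polynomials, with a coordinate for each power product, and for vectors,
  with a coordinate for each pair of a basis index and a power product.\<close>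

locale coordinates = vector_space scale for scale :: "'a::field \<Rightarrow> 'b::ab_group_add \<Rightarrow> 'b" +
  fixes coord :: "'c \<Rightarrow> 'b \<Rightarrow> 'a" and unit_vec :: "'c \<Rightarrow> 'b"
  assumes coord_linear: "Vector_Spaces.linear scale (*) (coord c)"
    and coord_eqI: "(\<And>c. coord c v = coord c w) \<Longrightarrow> v = w"
    and coord_unit_vec: "coord c (unit_vec c') = (if c = c' then 1 else 0)"
begin

lemma coord_sum: "coord c (\<Sum>j\<in>K. scale (u j) (v j)) = (\<Sum>j\<in>K. u j * coord c (v j))"
proof -
  interpret f: Vector_Spaces.linear scale "(*)" "coord c" by (rule coord_linear)
  show ?thesis by (simp add: f.sum f.scale)
qed

lemma coord_zero [simp]: "coord c 0 = 0"
  and coord_add: "coord c (v + w) = coord c v + coord c w"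
  and coord_scale: "coord c (scale a v) = a * coord c v"
proof -
  interpret f: Vector_Spaces.linear scale "(*)" "coord c" by (rule coord_linear)
  show "coord c 0 = 0" "coord c (v + w) = coord c v + coord c w" "coord c (scale a v) = a * coord c v"
    by (rule f.zero f.add f.scale)+
qed

definition supported :: "'c set \<Rightarrow> 'b set"
  where "supported A = {v. \<forall>c. coord c v \<noteq> 0 \<longrightarrow> c \<in> A}"

lemma subspace_supported: "subspace (supported A)"
  unfolding subspace_def supported_def by (auto simp: coord_add coord_scale) (metis add_0)

lemma
  assumes "finite A"
  shows span_unit_vec: "span (unit_vec ` A) = supported A"
    and dim_supported: "dim (supported A) = card A"
    and fin_spanned_supported: "fin_spanned span (supported A)"
proof -
  have fam: "\<forall>j\<in>A. u j = 0" if "(\<Sum>j\<in>A. scale (u j) (unit_vec j)) = 0" for u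
  proof
    fix c assume "c \<in> A"
    have "0 = coord c (\<Sum>j\<in>A. scale (u j) (unit_vec j))" unfolding that by simp
    also have "\<dots> = u c"
      using \<open>c \<in> A\<close> assms by (simp add: coord_sum coord_unit_vec if_distrib[of "\<lambda>x. _ * x"] cong: if_cong)
    finally show "u c = 0" by simp
  qed
  note ind = independent_family[OF assms, of unit_vec, OF fam]
  have "v \<in> span (unit_vec ` A)" if "v \<in> supported A" for v
  proof -
    have "v = (\<Sum>c\<in>A. scale (coord c v) (unit_vec c))"
    proof (rule coord_eqI)
      fix c
      have "coord c (\<Sum>c\<in>A. scale (coord c v) (unit_vec c)) = (if c \<in> A then coord c v else 0)"
        using assms by (simp add: coord_sum coord_unit_vec if_distrib[of "\<lambda>x. _ * x"] cong: if_cong)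
      also have "\<dots> = coord c v" using that by (auto simp: supported_def)
      finally show "coord c v = coord c (\<Sum>c\<in>A. scale (coord c v) (unit_vec c))" ..
    qed
    moreover have "\<dots> \<in> span (unit_vec ` A)" by (intro span_sum span_scale span_base) auto
    ultimately show ?thesis by simp
  qed
  moreover have "unit_vec ` A \<subseteq> supported A" by (auto simp: supported_def coord_unit_vec split: if_splits)
  then have "span (unit_vec ` A) \<subseteq> supported A" using subspace_supported by (rule span_minimal)
  ultimately show sp: "span (unit_vec ` A) = supported A" by auto
  show "dim (supported A) = card A"
    unfolding sp[symmetric] dim_span using dim_eq_card_independent[OF ind(2)] ind(1) by (simp add: card_image)
  show "fin_spanned span (supported A)" unfolding sp[symmetric] using assms by (intro fin_spanned_span) auto
qed

text \<open>The function found by elimination is now a polynomial in \<open>t\<close> that is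
  nonzero at \<open>t0\<close>, so it has finitely many roots. Over an infinite field several such
  conditions can be met at once.\<close>

lemma dim_line_semicontinuous:
  fixes w :: "'j \<Rightarrow> 'a \<Rightarrow> 'b"
  assumes "\<And>j c. j \<in> J \<Longrightarrow> \<exists>p. \<forall>t. coord c (w j t) = poly p t"
    and "\<And>t. fin_spanned span ((\<lambda>j. w j t) ` J)"
  shows "finite {t. dim ((\<lambda>j. w j t) ` J) < dim ((\<lambda>j. w j t0) ` J)}"
proof -
  have "\<exists>g\<in>range poly. g t0 \<noteq> 0 \<and>
      (\<forall>t. g t \<noteq> 0 \<longrightarrow> dim ((\<lambda>j. w j t0) ` J) \<le> dim ((\<lambda>j. w j t) ` J))"
  proof (rule dim_lower_semicontinuous[where \<phi> = coord and w = w and J = J])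
    show "(\<lambda>x::'a. 1) \<in> range poly" by (rule range_eqI[of _ _ 1]) auto
    show "(\<lambda>x. f x * g x) \<in> range poly" if fg: "f \<in> range poly" "g \<in> range poly" for f g :: "'a \<Rightarrow> 'a"
    proof -
      obtain p q where "f = poly p" "g = poly q" using fg by auto
      then show ?thesis by (intro range_eqI[of _ _ "p * q"]) auto
    qed
    show "(\<lambda>x. f x - g x) \<in> range poly" if fg: "f \<in> range poly" "g \<in> range poly" for f g :: "'a \<Rightarrow> 'a"
    proof -
      obtain p q where "f = poly p" "g = poly q" using fg by auto
      then show ?thesis by (intro range_eqI[of _ _ "p - q"]) auto
    qed
    show "(\<lambda>x. coord c (w j x)) \<in> range poly" if j: "j \<in> J" for j c
    proof -
      obtain p where "\<forall>t. coord c (w j t) = poly p t" using assms(1)[OF j] by blast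
      then show ?thesis by (intro range_eqI[of _ _ p]) auto
    qed
    show "v = 0" if "\<And>c. coord c v = 0" for v using that by (intro coord_eqI) simp
  qed (use assms(2) span_superset coord_linear in auto)
  then obtain p where p: "poly p t0 \<noteq> 0"
    "\<And>t. poly p t \<noteq> 0 \<Longrightarrow> dim ((\<lambda>j. w j t0) ` J) \<le> dim ((\<lambda>j. w j t) ` J)" by blast
  have "finite {t. poly p t = 0}" using p(1) by (intro poly_roots_finite) auto
  then show ?thesis by (rule finite_subset[rotated]) (use p(2) in force)
qed

end

section \<open>Polynomials as a vector space with coordinates\<close>

lemma lookup_single_0_mult: "lookup (Poly_Mapping.single 0 c * p) t = c * lookup p t"
  for p :: "'a::comm_monoid_add \<Rightarrow>\<^sub>0 'b::semiring_0"
  by (simp add: mult_map_scale_conv_mult[symmetric] Poly_Mapping.map.rep_eq when_def)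

definition pscale :: "'k::field \<Rightarrow> 'k mpoly \<Rightarrow> 'k mpoly"
  where "pscale c p = Poly_Mapping.single 0 c * p"

lemma lookup_pscale: "lookup (pscale c p) t = c * lookup p t"
  by (simp add: pscale_def lookup_single_0_mult)

interpretation PV: vector_space pscale
  by unfold_locales (simp_all add: pscale_def algebra_simps single_add mult_single flip: mult.assoc)

lemma vector_space_mult: "vector_space ((*) :: 'a \<Rightarrow> 'a \<Rightarrow> 'a::field)"
  by unfold_locales (auto simp: algebra_simps)

lemma linear_pscaleI:
  assumes "\<And>x y. f (x + y) = f x + f y" "\<And>c x. f (pscale c x) = s c (f x)" "vector_space s"
  shows "Vector_Spaces.linear pscale s f"
  using assms PV.vector_space_axioms
  by (simp add: Vector_Spaces.linear_def module_hom_def module_hom_axioms_def vector_space_def module_iff_vector_space)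

interpretation PV: coordinates pscale "\<lambda>t p. lookup p t" "\<lambda>t. Poly_Mapping.single t 1"
proof (intro coordinates.intro coordinates_axioms.intro PV.vector_space_axioms)
  show "Vector_Spaces.linear pscale (*) (\<lambda>p. lookup p t)" for t :: pprod
    by (rule linear_pscaleI) (auto simp: lookup_add lookup_pscale vector_space_mult)
qed (auto intro!: poly_mapping_eqI simp: lookup_single when_def)

section \<open>Monomials in increasing order\<close>

lemma pprod_deg_superset: "finite A \<Longrightarrow> keys t \<subseteq> A \<Longrightarrow> pprod_deg t = (\<Sum>i\<in>A. lookup t i)"
  unfolding pprod_deg_def by (rule sum.mono_neutral_left) (auto simp: in_keys_iff)

lemma pprod_deg_add: "pprod_deg (s + t) = pprod_deg s + pprod_deg t"
proof -
  let ?A = "keys s \<union> keys t"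
  have "keys (s + t) \<subseteq> ?A" by (rule Poly_Mapping.keys_add)
  then show ?thesis
    by (simp add: pprod_deg_superset[of ?A] lookup_add sum.distrib)
qed

lemma pprod_deg_0 [simp]: "pprod_deg 0 = 0"
  by (simp add: pprod_deg_def)

lemma pprod_deg_single [simp]: "pprod_deg (Poly_Mapping.single i k) = k"
  by (cases "k = 0") (auto simp: pprod_deg_def)

lemma keys_add_pprod: "keys (s + t) = keys s \<union> keys t" for s t :: pprod
  by (auto simp: in_keys_iff lookup_add)

definition mons :: "nat \<Rightarrow> int \<Rightarrow> pprod set"
  where "mons n d = {t \<in> pprods n. int (pprod_deg t) = d}"

lemma poly_comp_iff: "p \<in> poly_comp n d \<longleftrightarrow> keys p \<subseteq> mons n d"
  by (auto simp: poly_comp_def mons_def poly_ring_def)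

lemma poly_comp_eq_supported: "poly_comp n d = PV.supported (mons n d)"
  unfolding PV.supported_def by (auto simp: poly_comp_iff in_keys_iff subset_iff)

text \<open>The recursion of \<open>lexword\<close> run on the monomials themselves: only the last
  \<open>q\<close> of the \<open>n\<close> variables occur, and passing to \<open>Suc q\<close> adds
  the variable with index \<open>n - q\<close>.\<close>

fun monlist :: "nat \<Rightarrow> nat \<Rightarrow> nat \<Rightarrow> pprod list" where
  "monlist n 0 0 = [0]"
| "monlist n 0 (Suc d) = []"
| "monlist n (Suc q) 0 = [0]"
| "monlist n (Suc q) (Suc d) =
    monlist n q (Suc d) @ map ((+) (Poly_Mapping.single (n - q) 1)) (monlist n (Suc q) d)"

lemma pprod_deg_eq_0_iff: "pprod_deg t = 0 \<longleftrightarrow> t = 0"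
  by (auto simp: pprod_deg_def in_keys_iff intro: poly_mapping_eqI)

lemma pprod_split:
  assumes "i \<in> keys (t :: pprod)"
  obtains s where "t = Poly_Mapping.single i 1 + s"
proof
  show "t = Poly_Mapping.single i 1 + (t - Poly_Mapping.single i 1)"
    using assms by (intro poly_mapping_eqI) (auto simp: lookup_add lookup_minus lookup_single when_def in_keys_iff)
qed

lemma set_monlist: "q \<le> n \<Longrightarrow> set (monlist n q d) = {t. keys t \<subseteq> {n + 1 - q..n} \<and> pprod_deg t = d}"
proof (induction n q d rule: monlist.induct)
  case (4 n q d)
  let ?x = "Poly_Mapping.single (n - q) 1 :: pprod"
  have I: "{n + 1 - Suc q..n} = insert (n - q) {n + 1 - q..n}" using 4 by auto
  have "t \<in> set (monlist n (Suc q) (Suc d))"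
    if t: "keys t \<subseteq> {n + 1 - Suc q..n}" "pprod_deg t = Suc d" for t
  proof (cases "n - q \<in> keys t")
    case True
    then obtain s where s: "t = ?x + s" by (rule pprod_split)
    then have "s \<in> set (monlist n (Suc q) d)"
      using 4 t by (simp add: pprod_deg_add keys_add_pprod)
    then show ?thesis using s by auto
  next
    case False
    then have "keys t \<subseteq> {n + 1 - q..n}" using t unfolding I by auto
    then show ?thesis using 4 t by simp
  qed
  moreover have "keys t \<subseteq> {n + 1 - Suc q..n} \<and> pprod_deg t = Suc d"
    if "t \<in> set (monlist n (Suc q) (Suc d))" for t
    using that 4 unfolding I by (auto simp: keys_add_pprod pprod_deg_add)
  ultimately show ?case by blast
qed (auto simp: pprod_deg_eq_0_iff)

lemma sorted_monlist: "q \<le> n \<Longrightarrow> sorted_wrt (<) (monlist n q d)"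
proof (induction n q d rule: monlist.induct)
  case (4 n q d)
  let ?x = "Poly_Mapping.single (n - q) 1 :: pprod"
  have less: "s < ?x + t"
    if "s \<in> set (monlist n q (Suc d))" "t \<in> set (monlist n (Suc q) d)" for s t
  proof -
    have "keys s \<subseteq> {n + 1 - q..n}" "keys t \<subseteq> {n - q..n}"
      using that 4 by (auto simp: set_monlist)
    then have s: "lookup s k = 0" if "k \<le> n - q" for k
      using that \<open>Suc q \<le> n\<close> by (force simp: in_keys_iff)
    have t: "lookup t k = 0" if "k < n - q" for k
      using that \<open>keys t \<subseteq> {n - q..n}\<close> by (force simp: in_keys_iff)
    have "less_fun (lookup s) (lookup (?x + t))"
      unfolding less_fun_def using s t
      by (intro exI[of _ "n - q"]) (auto simp: lookup_add lookup_single when_def)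
    then show ?thesis by (simp add: less_poly_mapping.rep_eq)
  qed
  then show ?case using 4
    by (auto simp: sorted_wrt_append sorted_wrt_map)
qed auto

lemma lexword_monlist:
  "q \<le> n \<Longrightarrow> map (\<lambda>t. if n \<in> keys t then 0 else 1) (monlist n q d) = lexword q d"
proof (induction n q d rule: monlist.induct)
  case (4 n q d)
  let ?\<chi> = "\<lambda>t :: pprod. if n \<in> keys t then 0 else 1 :: nat"
  show ?case
  proof (cases "q = 0")
    \<comment> \<open>The added variable is the last variable itself: all its multiples have the
      letter 0, whatever the letter of the cofactor. This is the exceptional value
      \<open>[0]\<close> in \<open>lexword\<close>.\<close>
    case True
    have "map (?\<chi> \<circ> (+) (Poly_Mapping.single n 1)) (monlist n (Suc 0) d) = map (\<lambda>_. 0) (monlist n (Suc 0) d)"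
      by (auto simp: keys_add_pprod)
    moreover have "length (monlist n (Suc 0) d) = 1"
      using 4 True length_lexword[of "Suc 0" d] by (auto dest!: arg_cong[of _ _ length])
    ultimately show ?thesis using True by (cases "monlist n (Suc 0) d") (auto simp: lexword.simps(4))
  next
    case False
    have e: "map (?\<chi> \<circ> (+) (Poly_Mapping.single (n - q) 1)) (monlist n (Suc q) d) = map ?\<chi> (monlist n (Suc q) d)"
      using "4.prems" False by (auto simp: keys_add_pprod)
    have m: "map ?\<chi> (monlist n (Suc q) (Suc d)) = map ?\<chi> (monlist n q (Suc d)) @ map ?\<chi> (monlist n (Suc q) d)"
      unfolding monlist.simps map_append map_map e ..
    show ?thesis unfolding m using 4 False by (simp add: lexword.simps(4))
  qed
qed auto

definition monword :: "nat \<Rightarrow> int \<Rightarrow> nat list"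
  where "monword n d = (if d < 0 then [] else lexword n (nat d))"

definition sorted_mons :: "nat \<Rightarrow> int \<Rightarrow> pprod list"
  where "sorted_mons n d = (if d < 0 then [] else monlist n n (nat d))"

lemma set_sorted_mons: "set (sorted_mons n d) = mons n d"
  by (auto simp: sorted_mons_def mons_def pprods_def set_monlist)

lemma sorted_sorted_mons: "sorted_wrt (<) (sorted_mons n d)"
  by (simp add: sorted_mons_def sorted_monlist)

lemma monword_eq: "monword n d = map (\<lambda>t. if n \<in> keys t then 0 else 1) (sorted_mons n d)"
  by (simp add: monword_def sorted_mons_def lexword_monlist)

lemma finite_mons: "finite (mons n d)"
  by (metis set_sorted_mons finite_set)

lemma card_mons: "card (mons n d) = length (monword n d)"
proof -
  have "distinct (sorted_mons n d)"
    using sorted_sorted_mons[of n d] by (simp add: strict_sorted_iff)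
  then show ?thesis
    unfolding set_sorted_mons[symmetric] monword_eq by (simp add: distinct_card)
qed

lemma fin_spanned_poly_comp: "fin_spanned PV.span (poly_comp n d)"
  and dim_poly_comp: "PV.dim (poly_comp n d) = length (monword n d)"
  and subspace_poly_comp: "PV.subspace (poly_comp n d)"
  by (simp_all add: poly_comp_eq_supported PV.fin_spanned_supported PV.dim_supported
      PV.subspace_supported finite_mons card_mons)

lemma mons_add: "s \<in> mons n d \<Longrightarrow> t \<in> mons n e \<Longrightarrow> s + t \<in> mons n (d + e)"
  by (auto simp: mons_def pprods_def pprod_deg_add keys_add_pprod)

lemma poly_comp_mult: "p \<in> poly_comp n d \<Longrightarrow> q \<in> poly_comp n e \<Longrightarrow> p * q \<in> poly_comp n (d + e)"
  using Poly_Mapping.keys_mult[of p q] mons_add by (fastforce simp: poly_comp_iff)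

text \<open>Every monomial of positive degree is a variable times a monomial of degree
  \<open>d - 1\<close>. This settles the case in which no linear form enlarges
  \<open>V\<close>.\<close>

lemma poly_comp_subset_of_multiples:
  assumes V: "PV.subspace V" and "0 < d"
    and mult: "\<And>l q. l \<in> poly_comp n 1 \<Longrightarrow> q \<in> poly_comp n (d - 1) \<Longrightarrow> l * q \<in> V"
  shows "poly_comp n d \<subseteq> V"
proof -
  have "Poly_Mapping.single t 1 \<in> V" if "t \<in> mons n d" for t
  proof -
    have "t \<noteq> 0" using that assms(2) by (auto simp: mons_def)
    then obtain i where i: "i \<in> keys t" by (metis keys_eq_empty equals0I)
    then obtain s where s: "t = Poly_Mapping.single i 1 + s" by (rule pprod_split)
    then have "Poly_Mapping.single i 1 \<in> mons n 1" "s \<in> mons n (d - 1)"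
      using that by (auto simp: mons_def pprods_def pprod_deg_add keys_add_pprod)
    then have "Poly_Mapping.single (Poly_Mapping.single i 1) 1 * Poly_Mapping.single s 1 \<in> V"
      by (intro mult) (auto simp: poly_comp_iff)
    then show ?thesis by (simp add: mult_single s)
  qed
  then have "PV.span ((\<lambda>t. Poly_Mapping.single t 1) ` mons n d) \<subseteq> V"
    using V by (intro PV.span_minimal) auto
  then show ?thesis by (simp add: poly_comp_eq_supported PV.span_unit_vec finite_mons)
qed

section \<open>Green's theorem for the polynomial ring\<close>

text \<open>The type is general so that the notion also serves vectors, where a form
  \<open>l\<close> acts through \<open>Poly_Mapping.single 0 l\<close>; with \<open>l = 1\<close> it
  is the sum of two subspaces.\<close>

definition plus_mult :: "'a::semiring_0 set \<Rightarrow> 'a \<Rightarrow> 'a set \<Rightarrow> 'a set"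
  where "plus_mult V l T = {x + l * y |x y. x \<in> V \<and> y \<in> T}"

lemma plus_mult_image: "plus_mult V l T = (\<lambda>(x, y). x + l * y) ` (V \<times> T)"
  by (auto simp: plus_mult_def)

lemma pscale_mult: "pscale c (p * q) = p * pscale c q"
  by (simp add: pscale_def mult.left_commute)

lemma linear_mult: "Vector_Spaces.linear pscale pscale ((*) l)"
  by (rule linear_pscaleI) (auto simp: distrib_left pscale_mult PV.vector_space_axioms)

interpretation PP: vector_space_pair pscale pscale ..

lemma subspace_plus_mult:
  assumes "PV.subspace V" "PV.subspace T"
  shows "PV.subspace (plus_mult V l T)"
proof -
  interpret f: Vector_Spaces.linear pscale pscale "(*) l" by (rule linear_mult)
  have "plus_mult V l T = {x + y |x y. x \<in> V \<and> y \<in> (*) l ` T}" by (auto simp: plus_mult_def)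
  then show ?thesis using assms by (simp add: PV.subspace_sums f.subspace_image)
qed

lemma plus_mult_subset_poly_comp:
  assumes "V \<subseteq> poly_comp n d" "l \<in> poly_comp n 1" "T \<subseteq> poly_comp n (d - 1)"
  shows "plus_mult V l T \<subseteq> poly_comp n d"
proof -
  have "l * y \<in> poly_comp n d" if "y \<in> T" for y
    using poly_comp_mult[OF assms(2), of y "d - 1"] that assms(3) by auto
  then show ?thesis
    using assms(1) PV.subspace_add[OF subspace_poly_comp] by (fastforce simp: plus_mult_def)
qed

lemma dim_plus_mult:
  assumes "PV.subspace V" "V \<subseteq> poly_comp n d" "PV.subspace T" "T \<subseteq> poly_comp n e"
  shows "PV.dim (plus_mult V l T) + PV.dim {y \<in> T. l * y \<in> V} = PV.dim V + PV.dim T"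
  unfolding plus_mult_def
  by (rule PP.dim_sum_preimage[OF linear_mult])
     (use assms PV.fin_spanned_subset[OF _ fin_spanned_poly_comp] in blast)+

lemma dim_sum_Int_le:
  assumes "PV.subspace V" "V \<subseteq> poly_comp n d" "PV.subspace W" "W \<subseteq> poly_comp n d"
    and "X \<subseteq> V \<inter> W"
  shows "PV.dim (plus_mult V 1 W) + PV.dim X \<le> PV.dim V + PV.dim W"
proof -
  have "fin_spanned PV.span {y \<in> W. 1 * y \<in> V}"
    using assms(4) by (intro PV.fin_spanned_subset[OF _ fin_spanned_poly_comp]) auto
  then have "PV.dim X \<le> PV.dim {y \<in> W. 1 * y \<in> V}"
    using assms(5) by (intro PV.dim_mono) auto
  then show ?thesis using dim_plus_mult[OF assms(1-4), of 1] by simp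
qed

section \<open>Coordinates along a line of linear forms\<close>

lemma poly_line:
  "\<exists>P. \<forall>t. lookup (a + pscale t b + pscale t (pscale t c)) s = poly P t"
  by (rule exI[of _ "[:lookup a s, lookup b s, lookup c s:]"])
     (simp add: lookup_add lookup_pscale algebra_simps)

lemma poly_line_mult:
  fixes x l l' h h' q q' :: "'k::field mpoly"
  shows "\<exists>P. \<forall>t. lookup (x + (l + pscale t l') * q + (h + pscale t h') * q') s = poly P t"
proof -
  have "x + (l + pscale t l') * q + (h + pscale t h') * q' =
      (x + l * q + h * q') + pscale t (l' * q + h' * q') + pscale t (pscale t 0)" for t
    by (simp add: pscale_def algebra_simps)
  then show ?thesis by (simp only: poly_line)
qed

lemma poly_line_mult_single:
  fixes x l l' q :: "'k::field mpoly"
  shows "\<exists>P. \<forall>t. lookup (x + (l + pscale t l') * q) s = poly P t"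
  using poly_line_mult[of x l l' q 0 0 0 s] by simp

lemma poly_line_mult_mult:
  fixes x l l' h h' q :: "'k::field mpoly"
  shows "\<exists>P. \<forall>t. lookup (x + (l + pscale t l') * ((h + pscale t h') * q)) s = poly P t"
proof -
  have "x + (l + pscale t l') * ((h + pscale t h') * q) =
      (x + l * h * q) + pscale t ((l' * h + l * h') * q) + pscale t (pscale t (l' * h' * q))" for t
    by (simp add: pscale_def algebra_simps)
  then show ?thesis by (simp only: poly_line)
qed

lemma poly_comp_line:
  "l \<in> poly_comp n d \<Longrightarrow> l' \<in> poly_comp n d \<Longrightarrow> l + pscale t l' \<in> poly_comp n d"
  by (intro PV.subspace_add PV.subspace_scale subspace_poly_comp)

text \<open>Existence of one form is claimed because this is what the two inductions hand on: the
  one on \<open>d\<close> is applied to the colon space, the one on the codimension to the enlarged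
  space.\<close>

lemma green_ring:
  fixes V :: "'k::field mpoly set"
  assumes inf: "infinite (UNIV :: 'k set)"
  shows "PV.subspace V \<Longrightarrow> V \<subseteq> poly_comp n (int d) \<Longrightarrow>
    \<exists>l\<in>poly_comp n 1. PV.dim (poly_comp n (int d) :: 'k mpoly set) \<le> PV.dim (plus_mult V l (poly_comp n (int d - 1))) +
      pre (lexword n d) (PV.dim (poly_comp n (int d) :: 'k mpoly set) - PV.dim V)"
proof (induction d arbitrary: V)
  case 0
  let ?S = "poly_comp n 0 :: 'k mpoly set"
  \<comment> \<open>The component of degree -1 is zero, so no form can enlarge \<open>V\<close>; the
    word \<open>[1]\<close> makes the bound equal to the codimension.\<close>
  have 0: "0 \<in> (poly_comp n 1 :: 'k mpoly set)" "0 \<in> poly_comp n (- 1 :: int)"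
    using PV.subspace_0 subspace_poly_comp by auto
  have "V \<subseteq> plus_mult V 0 (poly_comp n (- 1))"
    unfolding plus_mult_def using 0 by force
  moreover have "plus_mult V 0 (poly_comp n (- 1)) \<subseteq> ?S"
    using 0 "0.prems" by (intro plus_mult_subset_poly_comp) auto
  ultimately have "PV.dim V \<le> PV.dim (plus_mult V 0 (poly_comp n (- 1)))"
    by (intro PV.dim_mono PV.fin_spanned_subset[OF _ fin_spanned_poly_comp])
  moreover have "PV.dim ?S = 1" by (simp add: dim_poly_comp monword_def)
  moreover have "pre (lexword n 0) (1 - PV.dim V) = 1 - PV.dim V"
    by (cases "PV.dim V") (auto simp: pre_def)
  ultimately show ?case using 0 by (intro bexI[of _ 0]) auto
next
  case (Suc d)
  let ?S = "poly_comp n (int (Suc d)) :: 'k mpoly set" and ?S' = "poly_comp n (int d) :: 'k mpoly set"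
    and ?S'' = "poly_comp n (int d - 1) :: 'k mpoly set" and ?L = "poly_comp n 1 :: 'k mpoly set"
  let ?w = "lexword n (Suc d)" and ?v = "lexword n d"
  define N where "N = PV.dim ?S"
  have lenw: "N = length ?w" by (simp add: N_def dim_poly_comp monword_def nat_add_distrib)
  have fin: "fin_spanned PV.span X" if "X \<subseteq> ?S" for X
    using that fin_spanned_poly_comp by (rule PV.fin_spanned_subset)
  have eq: "int (Suc d) - 1 = int d" by simp
  have sub': "PV.subspace ?S'" by (rule subspace_poly_comp)
  have mult_sub: "plus_mult X l ?S' \<subseteq> ?S" if "X \<subseteq> ?S" "l \<in> ?L" for X l
    using plus_mult_subset_poly_comp[OF that, of ?S'] eq by simp
  have "PV.subspace V \<Longrightarrow> V \<subseteq> ?S \<Longrightarrow>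
      \<exists>l\<in>?L. N \<le> PV.dim (plus_mult V l ?S') + pre ?w (N - PV.dim V)" for V
  proof (induction "N - PV.dim V" arbitrary: V rule: less_induct)
    case less
    note V = less.prems
    define Y where "Y = (\<lambda>l. plus_mult V l ?S')"
    have Y: "PV.subspace (Y l)" "Y l \<subseteq> ?S" if "l \<in> ?L" for l
    proof -
      show "PV.subspace (Y l)" unfolding Y_def by (intro subspace_plus_mult subspace_poly_comp V)
      show "Y l \<subseteq> ?S" unfolding Y_def by (rule mult_sub[OF V(2) that])
    qed
    have leN: "PV.dim X \<le> N" if "X \<subseteq> ?S" for X
      unfolding N_def using that fin by (intro PV.dim_mono) auto
    have "0 \<in> ?L" using PV.subspace_0 subspace_poly_comp by auto
    moreover have "\<forall>l. l \<in> ?L \<longrightarrow> PV.dim (Y l) < Suc N" using leN[OF Y(2)] by (simp add: less_Suc_eq_le)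
    \<comment> \<open>A form with the largest dimension takes the place of a generic one.\<close>
    ultimately obtain h0 where h0: "h0 \<in> ?L" and max: "\<And>l. l \<in> ?L \<Longrightarrow> PV.dim (Y l) \<le> PV.dim (Y h0)"
      using ex_has_greatest_nat[of "\<lambda>l. l \<in> ?L" 0 "\<lambda>l. PV.dim (Y l)" "Suc N"] by blast
    define D where "D = PV.dim (Y h0)"
    show ?case
    proof (cases "D \<le> PV.dim V")
      case True
      \<comment> \<open>No form enlarges \<open>V\<close>, so \<open>V\<close> absorbs all products
        of a linear form with \<open>?S'\<close> and is the whole component.\<close>
      have "l * q \<in> V" if "l \<in> ?L" "q \<in> ?S'" for l q
      proof -
        have sub: "V \<subseteq> Y l"
          unfolding Y_def plus_mult_def using PV.subspace_0[OF subspace_poly_comp, of n "int d"] by force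
        have "Y l \<subseteq> V"
          using V(1) sub fin[OF Y(2)[OF that(1)]] by (rule PV.subspace_dim_le_imp_subset) (use max[OF that(1)] True D_def in simp)
        moreover have "0 + l * q \<in> Y l"
          unfolding Y_def plus_mult_def using that PV.subspace_0[OF V(1)] by blast
        ultimately show ?thesis by auto
      qed
      then have "?S \<subseteq> V" by (intro poly_comp_subset_of_multiples V(1)) auto
      then have "V = ?S" using V(2) by auto
      have "V \<subseteq> Y 0"
        unfolding Y_def plus_mult_def using PV.subspace_0[OF subspace_poly_comp, of n "int d"] by force
      then have "N \<le> PV.dim (Y 0)"
        unfolding N_def \<open>V = ?S\<close>[symmetric] using fin Y(2)[OF \<open>0 \<in> ?L\<close>] by (intro PV.dim_mono)
      then show ?thesis using \<open>0 \<in> ?L\<close> by (intro bexI[of _ 0]) (auto simp: Y_def)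
    next
      case False
      define y where "y = N - D"
      have DN: "D \<le> N" unfolding D_def using Y h0 by (intro leN)
      have "N - D < N - PV.dim V" using False DN by linarith
      then obtain l3 where l3: "l3 \<in> ?L" "N \<le> PV.dim (plus_mult (Y h0) l3 ?S') + pre ?w y"
        using less.hyps[of "Y h0"] Y[OF h0] by (auto simp: D_def y_def)
      \<comment> \<open>Taking the colon space with respect to the maximal form \<open>h0\<close>
        makes its codimension known exactly: it is \<open>D - PV.dim V\<close>.\<close>
      define K where "K = {q \<in> ?S'. h0 * q \<in> V}"
      have K: "PV.subspace K" "K \<subseteq> ?S'"
        using V(1) sub'
        by (auto simp: K_def PV.subspace_def distrib_left pscale_mult[symmetric])
      obtain h4 where h4: "h4 \<in> ?L" "PV.dim ?S' \<le> PV.dim (plus_mult K h4 ?S'') + pre ?v (PV.dim ?S' - PV.dim K)"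
        using Suc.IH[OF K] by auto
      define T where "T = plus_mult K h4 ?S''"
      have T: "PV.subspace T" "T \<subseteq> ?S'"
      proof -
        show "PV.subspace T" unfolding T_def by (intro subspace_plus_mult subspace_poly_comp K)
        show "T \<subseteq> ?S'" unfolding T_def by (rule plus_mult_subset_poly_comp[OF K(2) h4(1) order_refl])
      qed
      have dimK: "D + PV.dim K = PV.dim V + PV.dim ?S'"
        unfolding D_def Y_def K_def
        using V subspace_poly_comp by (intro dim_plus_mult[where n = n]) auto
      have KT: "{q \<in> T. h0 * q \<in> V} = K"
      proof -
        have "K \<subseteq> T" unfolding T_def plus_mult_def
          using PV.subspace_0[OF subspace_poly_comp, of n "int d - 1"] by force
        then show ?thesis using T(2) by (auto simp: K_def)
      qed
      have dimT: "PV.dim (plus_mult V h0 T) + PV.dim K = PV.dim V + PV.dim T"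
        using dim_plus_mult[OF V T, of h0] KT by simp
      \<comment> \<open>Since \<open>h0 * K\<close> lies in \<open>V\<close>, the part
        \<open>K\<close> of \<open>T\<close> adds nothing.\<close>
      have VT: "plus_mult V h0 T = plus_mult V (h0 * h4) ?S''"
      proof -
        have "x + h0 * (k + h4 * q) \<in> plus_mult V (h0 * h4) ?S''" if "x \<in> V" "k \<in> K" "q \<in> ?S''" for x k q
        proof -
          have "x + h0 * k \<in> V" using that V(1) by (auto simp: K_def intro: PV.subspace_add)
          moreover have "x + h0 * (k + h4 * q) = (x + h0 * k) + h0 * h4 * q" by (simp add: algebra_simps)
          ultimately show ?thesis unfolding plus_mult_def using that by blast
        qed
        moreover have "x + h0 * h4 * q \<in> plus_mult V h0 T" if "x \<in> V" "q \<in> ?S''" for x q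
        proof -
          have "0 + h4 * q \<in> T" unfolding T_def plus_mult_def using that PV.subspace_0[OF K(1)] by blast
          moreover have "x + h0 * h4 * q = x + h0 * (0 + h4 * q)" by (simp add: algebra_simps)
          ultimately show ?thesis unfolding plus_mult_def using that by blast
        qed
        ultimately show ?thesis by (auto simp: plus_mult_def T_def)
      qed
      define z where "z = N - PV.dim V - y"
      have z: "z = D - PV.dim V" "PV.dim ?S' - PV.dim K = z"
        using dimK DN False by (auto simp: z_def y_def)
      have dimX: "D \<le> PV.dim (plus_mult V (h0 * h4) ?S'') + pre ?v z"
      proof -
        have "PV.dim ?S' \<le> PV.dim T + pre ?v z" using h4(2) unfolding T_def z(2) .
        then show ?thesis using dimT dimK False unfolding VT by linarith
      qed
      \<comment> \<open>The pair \<open>(h0, l3)\<close> maximizes the dimensions of \<open>W1\<close>, \<open>W3\<close> as far as needed and \<open>(h4, h0)\<close> those of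
        \<open>W2\<close>, \<open>W4\<close>; on the line through both, all but finitely many points serve for all four.\<close>
      define h l where "h = (\<lambda>t. h0 + pscale t (h4 - h0))" and "l = (\<lambda>t. l3 + pscale t (h0 - l3))"
      have L: "h t \<in> ?L" "l t \<in> ?L" for t
        unfolding h_def l_def using h0 h4(1) l3(1)
        by (auto intro!: poly_comp_line PV.subspace_diff subspace_poly_comp)
      have hl: "h 0 = h0" "l 0 = l3" "h 1 = h4" "l 1 = h0" by (auto simp: h_def l_def)
      define W1 W2 W3 W4 where "W1 = (\<lambda>t. (\<lambda>(x, q). x + h t * q) ` (V \<times> ?S'))"
        and "W2 = (\<lambda>t. (\<lambda>(x, q). x + l t * q) ` (V \<times> ?S'))"
        and "W3 = (\<lambda>t. (\<lambda>(x, q, q'). x + h t * q + l t * q') ` (V \<times> ?S' \<times> ?S'))"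
        and "W4 = (\<lambda>t. (\<lambda>(x, q). x + l t * (h t * q)) ` (V \<times> ?S''))"
      have W1: "W1 t = Y (h t)" and W2: "W2 t = Y (l t)" for t
        by (auto simp: W1_def W2_def Y_def plus_mult_image)
      have W3: "W3 t = plus_mult (Y (h t)) (l t) ?S'" for t
        by (force simp: W3_def Y_def plus_mult_image image_iff)
      \<comment> \<open>The same space once more, now as the sum of two subspaces whose intersection
        contains \<open>W4 t\<close>.\<close>
      have W3': "W3 t = plus_mult (Y (h t)) 1 (Y (l t))" for t
      proof (intro equalityI subsetI)
        fix w assume "w \<in> W3 t"
        then obtain x q q' where w: "w = x + h t * q + l t * q'" "x \<in> V" "q \<in> ?S'" "q' \<in> ?S'"
          by (auto simp: W3_def)
        then have "x + h t * q \<in> Y (h t)" "0 + l t * q' \<in> Y (l t)" "w = (x + h t * q) + 1 * (0 + l t * q')"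
          unfolding Y_def plus_mult_def using PV.subspace_0[OF V(1)] by (blast, blast, simp)
        then show "w \<in> plus_mult (Y (h t)) 1 (Y (l t))" unfolding plus_mult_def by blast
      next
        fix w assume "w \<in> plus_mult (Y (h t)) 1 (Y (l t))"
        then obtain x q x' q' where w: "w = (x + h t * q) + 1 * (x' + l t * q')"
          "x \<in> V" "q \<in> ?S'" "x' \<in> V" "q' \<in> ?S'"
          by (auto simp: Y_def plus_mult_def)
        then have "w = (x + x') + h t * q + l t * q'" "x + x' \<in> V"
          using PV.subspace_add[OF V(1)] by (simp_all add: algebra_simps)
        then show "w \<in> W3 t" unfolding W3_def using w by (intro image_eqI[of _ _ "(x + x', q, q')"]) auto
      qed
      have W4: "W4 t = plus_mult V (l t * h t) ?S''" for t
        by (auto simp: W4_def plus_mult_image mult.assoc)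
      have W4_sub: "W4 t \<subseteq> Y (h t) \<inter> Y (l t)" for t
      proof -
        have "h t * q \<in> ?S'" "l t * q \<in> ?S'" if "q \<in> ?S''" for q
          using poly_comp_mult[OF L(1), of q "int d - 1"] poly_comp_mult[OF L(2), of q "int d - 1"] that by auto
        moreover have "x + l t * (h t * q) = x + h t * (l t * q)" for x q by (simp add: algebra_simps)
        ultimately show ?thesis unfolding W4_def Y_def plus_mult_def by (auto, blast+)
      qed
      have sub: "W1 t \<subseteq> ?S" "W2 t \<subseteq> ?S" "W3 t \<subseteq> ?S" "W4 t \<subseteq> ?S" for t
        using Y L W4_sub[of t] mult_sub unfolding W1 W2 W3 by blast+
      let ?bad = "\<lambda>W t0. {t. PV.dim (W t) < PV.dim (W t0)}"
      have "finite (?bad W1 0)"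
        unfolding W1_def
      proof (rule PV.dim_line_semicontinuous)
        show "\<exists>P. \<forall>t. lookup (case j of (x, q) \<Rightarrow> x + h t * q) s = poly P t" for j s
          unfolding h_def by (cases j) (simp add: poly_line_mult_single)
      qed (use sub fin W1_def in simp)
      moreover have "finite (?bad W2 1)"
        unfolding W2_def
      proof (rule PV.dim_line_semicontinuous)
        show "\<exists>P. \<forall>t. lookup (case j of (x, q) \<Rightarrow> x + l t * q) s = poly P t" for j s
          unfolding l_def by (cases j) (simp add: poly_line_mult_single)
      qed (use sub fin W2_def in simp)
      moreover have "finite (?bad W3 0)"
        unfolding W3_def
      proof (rule PV.dim_line_semicontinuous)
        show "\<exists>P. \<forall>t. lookup (case j of (x, q, q') \<Rightarrow> x + h t * q + l t * q') s = poly P t" for j s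
          unfolding h_def l_def by (cases j) (simp add: poly_line_mult)
      qed (use sub fin W3_def in simp)
      moreover have "finite (?bad W4 1)"
        unfolding W4_def
      proof (rule PV.dim_line_semicontinuous)
        show "\<exists>P. \<forall>t. lookup (case j of (x, q) \<Rightarrow> x + l t * (h t * q)) s = poly P t" for j s
          unfolding h_def l_def by (cases j) (simp add: poly_line_mult_mult)
      qed (use sub fin W4_def in simp)
      ultimately have "finite (?bad W1 0 \<union> ?bad W2 1 \<union> ?bad W3 0 \<union> ?bad W4 1)" by simp
      from ex_new_if_finite[OF inf this]
      obtain t where t: "t \<notin> ?bad W1 0 \<union> ?bad W2 1 \<union> ?bad W3 0 \<union> ?bad W4 1" ..
      \<comment> \<open>By the choice of \<open>h0\<close> these dimensions are at most
        \<open>D\<close>, and outside the exceptional set they are not smaller.\<close>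
      have "PV.dim (W1 t) = D" "PV.dim (W2 t) = D"
        using t max[OF L(1)[of t]] max[OF L(2)[of t]] by (simp_all add: W1 W2 hl D_def)
      moreover have "N \<le> PV.dim (W3 t) + pre ?w y"
        using t l3(2) by (simp add: W3 hl)
      moreover have "D \<le> PV.dim (W4 t) + pre ?v z"
        using t dimX by (simp add: W4 hl)
      moreover have "PV.dim (W3 t) + PV.dim (W4 t) \<le> PV.dim (Y (h t)) + PV.dim (Y (l t))"
        unfolding W3'
        by (rule dim_sum_Int_le[OF Y(1)[OF L(1)] Y(2)[OF L(1)] Y(1)[OF L(2)] Y(2)[OF L(2)] W4_sub])
      ultimately have "N - D \<le> pre ?w y + pre ?v z" unfolding W1 W2 using DN by linarith
      then have "y \<le> pre ?w (N - PV.dim V)"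
        using pre_green[of "Suc d" "N - PV.dim V" n y] lenw DN False by (simp add: y_def z_def)
      then have "N \<le> PV.dim (Y h0) + pre ?w (N - PV.dim V)"
        using DN by (simp add: D_def y_def)
      then show ?thesis using h0 by (auto simp: Y_def)
    qed
  qed
  from this[OF Suc.prems] show ?case unfolding N_def eq .
qed

section \<open>Green's theorem for free modules\<close>

lemma green_ring_int:
  fixes V :: "'k::field mpoly set"
  assumes "infinite (UNIV :: 'k set)" and V: "PV.subspace V" "V \<subseteq> poly_comp n d"
  shows "\<exists>l\<in>poly_comp n 1. PV.dim (poly_comp n d :: 'k mpoly set) \<le> PV.dim (plus_mult V l (poly_comp n (d - 1))) +
      pre (monword n d) (PV.dim (poly_comp n d :: 'k mpoly set) - PV.dim V)"
proof (cases "d < 0")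
  case True
  then have "PV.dim (poly_comp n d :: 'k mpoly set) = 0" by (simp add: dim_poly_comp monword_def)
  then show ?thesis using PV.subspace_0 subspace_poly_comp by (intro bexI[of _ 0]) auto
next
  case False
  then obtain e where "d = int e" using nonneg_int_cases by (metis not_less)
  then show ?thesis using green_ring[OF assms(1) V(1), of n e] V(2) by (simp add: monword_def)
qed

text \<open>Finitely supported families over \<open>nat\<close> form a ring under convolution, and a
  factor concentrated at index 0 acts on each component separately. Thus multiplication of vectors
  by polynomials becomes a ring multiplication.\<close>

definition fscale :: "'k::field \<Rightarrow> 'k fvec \<Rightarrow> 'k fvec"
  where "fscale c v = Poly_Mapping.single 0 (Poly_Mapping.single 0 c) * v"

lemma lookup_fscale: "lookup (fscale c v) i = pscale c (lookup v i)"
  by (simp add: fscale_def pscale_def lookup_single_0_mult)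

interpretation FV: vector_space fscale
  by unfold_locales (simp_all add: fscale_def algebra_simps single_add mult_single flip: mult.assoc)

lemma linear_fscaleI:
  assumes "\<And>x y. f (x + y) = f x + f y" "\<And>c x. f (fscale c x) = s c (f x)" "vector_space s"
  shows "Vector_Spaces.linear fscale s f"
  using assms FV.vector_space_axioms
  by (simp add: Vector_Spaces.linear_def module_hom_def module_hom_axioms_def vector_space_def module_iff_vector_space)

definition fcoord :: "nat \<times> pprod \<Rightarrow> 'k::field fvec \<Rightarrow> 'k"
  where "fcoord = (\<lambda>(i, t) v. lookup (lookup v i) t)"

lemma fcoord_Pair [simp]: "fcoord (i, t) v = lookup (lookup v i) t"
  by (simp add: fcoord_def)

interpretation FV: coordinates fscale fcoord monomial_vec
proof (intro coordinates.intro coordinates_axioms.intro FV.vector_space_axioms)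
  show "Vector_Spaces.linear fscale (*) (fcoord c)" for c
    by (cases c, rule linear_fscaleI)
      (auto simp: lookup_add lookup_fscale lookup_pscale vector_space_mult)
  show "v = w" if "\<And>c. fcoord c v = fcoord c w" for v w :: "'a fvec"
  proof (intro poly_mapping_eqI)
    show "lookup (lookup v i) t = lookup (lookup w i) t" for i t using that[of "(i, t)"] by simp
  qed
  show "fcoord c (monomial_vec c') = (if c = c' then 1 else 0)" for c c'
    by (cases c; cases c') (auto simp: monomial_vec_def lookup_single when_def)
qed

interpretation PF: vector_space_pair pscale fscale ..
interpretation FF: vector_space_pair fscale fscale ..

lemma (in vector_space_pair) dim_image_kernel:
  assumes f: "Vector_Spaces.linear s1 s2 f" and T: "vs1.subspace T" "fin_spanned vs1.span T"
  shows "vs2.dim (f ` T) + vs1.dim {y \<in> T. f y = 0} = vs1.dim T"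
proof -
  have "fin_spanned vs2.span {0}" by (intro vs2.fin_spanned_subset[OF _ vs2.fin_spanned_span[of "{}"]]) auto
  then have "vs2.dim {x + f y |x y. x \<in> {0} \<and> y \<in> T} + vs1.dim {y \<in> T. f y \<in> {0}} = vs2.dim {0} + vs1.dim T"
    using assms vs2.subspace_0 by (intro dim_sum_preimage) (auto simp: vs2.subspace_def)
  moreover have "{x + f y |x y. x \<in> {0} \<and> y \<in> T} = f ` T" by auto
  moreover have "vs2.dim {0} = 0" using vs2.dim_le_card[of "{0}" "{}"] by simp
  ultimately show ?thesis by simp
qed

section \<open>Graded parts of the free module on chosen basis elements\<close>

definition graded_part :: "nat \<Rightarrow> nat set \<Rightarrow> (nat \<Rightarrow> int) \<Rightarrow> int \<Rightarrow> 'k::field fvec set"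
  where "graded_part n I f d = {v. keys v \<subseteq> I \<and> (\<forall>i. lookup v i \<in> poly_comp n (d - f i))}"

lemma free_comp_eq: "free_comp n r f d = graded_part n {1..r} f d"
  by (auto simp: free_comp_def free_module_def graded_part_def poly_comp_def eq_diff_eq)

lemma single_graded_partD:
  "Poly_Mapping.single i p \<in> graded_part n I f d \<Longrightarrow> p \<in> poly_comp n (d - f i)"
  unfolding graded_part_def by (auto dest: spec[of _ i])

lemma keys_subset_iff: "keys v \<subseteq> I \<longleftrightarrow> (\<forall>i. i \<notin> I \<longrightarrow> lookup v i = 0)"
  by (auto simp: in_keys_iff)

lemma graded_part_eq_supported:
  "graded_part n I f d = FV.supported (SIGMA i:I. mons n (d - f i))"
  unfolding graded_part_def FV.supported_def keys_subset_iff
  by (auto simp: poly_comp_iff in_keys_iff subset_iff intro!: poly_mapping_eqI)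
     (metis lookup_zero)+

lemma subspace_graded_part: "FV.subspace (graded_part n I f d)"
  by (simp add: graded_part_eq_supported FV.subspace_supported)

lemma fin_spanned_graded_part: "finite I \<Longrightarrow> fin_spanned FV.span (graded_part n I f d)"
  by (simp add: graded_part_eq_supported FV.fin_spanned_supported finite_mons)

definition module_word :: "nat \<Rightarrow> (nat \<Rightarrow> int) \<Rightarrow> int \<Rightarrow> nat list \<Rightarrow> nat list"
  where "module_word n f d is = concat (map (\<lambda>i. monword n (d - f i)) is)"

lemma dim_graded_part:
  assumes "distinct is"
  shows "FV.dim (graded_part n (set is) f d) = length (module_word n f d is)"
proof -
  have "FV.dim (graded_part n (set is) f d) = card (SIGMA i:set is. mons n (d - f i))"
    by (simp add: graded_part_eq_supported FV.dim_supported finite_mons)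
  also have "\<dots> = (\<Sum>i\<in>set is. length (monword n (d - f i)))"
    by (simp add: card_SigmaI finite_mons card_mons)
  also have "\<dots> = length (module_word n f d is)"
    using assms by (simp add: module_word_def length_concat comp_def sum_list_distinct_conv_sum_set)
  finally show ?thesis .
qed

lemma linear_mult_fvec: "Vector_Spaces.linear fscale fscale ((*) (Poly_Mapping.single 0 p))"
  by (rule linear_fscaleI) (auto simp: fscale_def algebra_simps FV.vector_space_axioms)

lemma graded_part_mult:
  assumes "l \<in> poly_comp n 1" "v \<in> graded_part n I f (d - 1)"
  shows "Poly_Mapping.single 0 l * v \<in> graded_part n I f d"
proof -
  have "l * lookup v i \<in> poly_comp n (d - f i)" for i
    using poly_comp_mult[OF assms(1), of "lookup v i" "d - 1 - f i"] assms(2)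
    by (auto simp: graded_part_def algebra_simps)
  then show ?thesis
    using assms(2) by (auto simp: graded_part_def keys_subset_iff lookup_single_0_mult)
qed

lemma plus_mult_subset_graded_part:
  assumes "V \<subseteq> graded_part n I f d" "l \<in> poly_comp n 1" "T \<subseteq> graded_part n I f (d - 1)"
  shows "plus_mult V (Poly_Mapping.single 0 l) T \<subseteq> graded_part n I f d"
proof
  fix w assume "w \<in> plus_mult V (Poly_Mapping.single 0 l) T"
  then obtain x y where "w = x + Poly_Mapping.single 0 l * y" "x \<in> V" "y \<in> T"
    by (auto simp: plus_mult_def)
  then show "w \<in> graded_part n I f d"
    using assms(1,3) graded_part_mult[OF assms(2), of y]
    by (auto intro!: FV.subspace_add[OF subspace_graded_part])
qed

lemma subspace_plus_mult_fvec:
  assumes "FV.subspace V" "FV.subspace T"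
  shows "FV.subspace (plus_mult V (Poly_Mapping.single 0 l) T)"
proof -
  interpret f: Vector_Spaces.linear fscale fscale "(*) (Poly_Mapping.single 0 l)" by (rule linear_mult_fvec)
  have "plus_mult V (Poly_Mapping.single 0 l) T = {x + y |x y. x \<in> V \<and> y \<in> (*) (Poly_Mapping.single 0 l) ` T}"
    by (auto simp: plus_mult_def)
  then show ?thesis using assms by (simp add: FV.subspace_sums f.subspace_image)
qed

lemma linear_single: "Vector_Spaces.linear pscale fscale (Poly_Mapping.single i)"
  by (rule linear_pscaleI) (auto simp: single_add fscale_def pscale_def mult_single FV.vector_space_axioms)

definition drop_comp :: "nat \<Rightarrow> 'k::field fvec \<Rightarrow> 'k fvec"
  where "drop_comp i v = v - Poly_Mapping.single i (lookup v i)"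

lemma lookup_drop_comp: "lookup (drop_comp i v) j = (if j = i then 0 else lookup v j)"
  by (simp add: drop_comp_def lookup_minus lookup_single when_def)

lemma linear_drop_comp: "Vector_Spaces.linear fscale fscale (drop_comp i)"
  by (rule linear_fscaleI)
    (auto intro!: poly_mapping_eqI simp: lookup_drop_comp lookup_add lookup_fscale lookup_pscale FV.vector_space_axioms)

lemma drop_comp_eq_0_iff: "drop_comp i v = 0 \<longleftrightarrow> (\<exists>p. v = Poly_Mapping.single i p)"
  by (auto simp: drop_comp_def)

text \<open>Rank-nullity for the projection that forgets the component \<open>i\<close>; its kernel
  on \<open>V\<close> is a copy of the set of polynomials \<open>p\<close> with \<open>p e_i\<close>
  in \<open>V\<close>.\<close>

lemma dim_split:
  fixes V :: "'k::field fvec set"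
  assumes V: "FV.subspace V" "V \<subseteq> graded_part n I f d" and "finite I"
  shows "FV.dim V = FV.dim (drop_comp i ` V) + PV.dim {p. Poly_Mapping.single i p \<in> V}"
proof -
  let ?K = "{p. Poly_Mapping.single i p \<in> V}"
  interpret s: Vector_Spaces.linear pscale fscale "Poly_Mapping.single i" by (rule linear_single)
  have sub: "PV.subspace ?K"
    using V(1) by (auto simp: PV.subspace_def FV.subspace_def s.add s.scale)
  have "?K \<subseteq> poly_comp n (d - f i)"
    using V(2) single_graded_partD by blast
  then have fin: "fin_spanned PV.span ?K" using fin_spanned_poly_comp by (rule PV.fin_spanned_subset)
  have "{p \<in> ?K. Poly_Mapping.single i p = 0} = {0}" using FV.subspace_0[OF V(1)] by (auto dest: arg_cong[of _ _ "\<lambda>v. lookup v i"])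
  moreover have "PV.dim {0 :: 'k mpoly} = 0" using PV.dim_le_card[of "{0}" "{}"] by simp
  ultimately have "FV.dim (Poly_Mapping.single i ` ?K) = PV.dim ?K"
    using PF.dim_image_kernel[OF linear_single sub fin, of i] by simp
  moreover have "{v \<in> V. drop_comp i v = 0} = Poly_Mapping.single i ` ?K"
    by (auto simp: drop_comp_eq_0_iff)
  moreover have "fin_spanned FV.span V"
    using V(2) fin_spanned_graded_part[OF \<open>finite I\<close>] by (rule FV.fin_spanned_subset)
  ultimately show ?thesis using FF.dim_image_kernel[OF linear_drop_comp V(1), of i] by simp
qed

lemma poly_line_fvec:
  "\<exists>P. \<forall>t. fcoord c (v + Poly_Mapping.single 0 (l + pscale t l') * w) = poly P t"
proof (cases c)
  case (Pair i s)
  then show ?thesis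
    by (simp add: lookup_add[of v] lookup_single_0_mult poly_line_mult_single)
qed

lemma dominates_monword:
  assumes "e \<le> d"
  shows "dominates (monword n e) (monword n d)"
  using assms by (auto simp: monword_def dominates_Nil intro!: lexword_dominates)

text \<open>The element split off has the smallest \<open>f\<close>, so its component has the
  largest degree and its word is dominated by all others. \<open>V\<close> is replaced by its
  projection to the remaining elements and its intersection with \<open>S e_i\<close>, and the forms
  good for these two parts are joined by a line.\<close>

lemma green_module:
  fixes V :: "'k::field fvec set"
  assumes inf: "infinite (UNIV :: 'k set)"
  shows "distinct is \<Longrightarrow> sorted_wrt (\<lambda>i j. f j \<le> f i) is \<Longrightarrow>
    FV.subspace V \<Longrightarrow> V \<subseteq> graded_part n (set is) f d \<Longrightarrow>
    \<exists>l\<in>poly_comp n 1. FV.dim (graded_part n (set is) f d :: 'k fvec set) \<le>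
      FV.dim (plus_mult V (Poly_Mapping.single 0 l) (graded_part n (set is) f (d - 1))) +
      pre (module_word n f d is) (FV.dim (graded_part n (set is) f d :: 'k fvec set) - FV.dim V)"
proof (induction "is" arbitrary: V rule: rev_induct)
  case Nil
  have "FV.dim (graded_part n (set []) f d :: 'k fvec set) = 0"
    using dim_graded_part[of "[]" n f d] by (simp add: module_word_def)
  then show ?case using PV.subspace_0 subspace_poly_comp by (intro bexI[of _ 0]) auto
next
  case (snoc i js)
  let ?J = "set js" and ?I = "set (js @ [i])"
  let ?FI = "graded_part n ?I f d :: 'k fvec set" and ?FJ = "graded_part n ?J f d :: 'k fvec set"
    and ?GI = "graded_part n ?I f (d - 1) :: 'k fvec set" and ?GJ = "graded_part n ?J f (d - 1) :: 'k fvec set"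
    and ?S = "poly_comp n (d - f i) :: 'k mpoly set" and ?T = "poly_comp n (d - f i - 1) :: 'k mpoly set"
    and ?L = "poly_comp n 1 :: 'k mpoly set"
  have iJ: "i \<notin> ?J" "distinct js" "sorted_wrt (\<lambda>i j. f j \<le> f i) js" "\<And>j. j \<in> ?J \<Longrightarrow> f i \<le> f j"
    using snoc.prems by (auto simp: sorted_wrt_append)
  note V = snoc.prems(3,4)
  interpret s: Vector_Spaces.linear pscale fscale "Poly_Mapping.single i" by (rule linear_single)
  interpret p: Vector_Spaces.linear fscale fscale "drop_comp i" by (rule linear_drop_comp)
  define K where "K = {p. Poly_Mapping.single i p \<in> V}"
  define V' where "V' = drop_comp i ` V"
  have K: "PV.subspace K" "K \<subseteq> ?S"
  proof -
    show "PV.subspace K"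
      using V(1) by (auto simp: K_def PV.subspace_def FV.subspace_def s.add s.scale)
    show "K \<subseteq> ?S" using V(2) single_graded_partD unfolding K_def by blast
  qed
  have drop: "drop_comp i v \<in> ?FJ" if "v \<in> ?FI" for v
    using that PV.subspace_0[OF subspace_poly_comp]
    by (auto simp: graded_part_def keys_subset_iff lookup_drop_comp)
  have V': "FV.subspace V'" "V' \<subseteq> ?FJ"
    using V drop by (auto simp: V'_def p.subspace_image)
  have dimV: "FV.dim V = FV.dim V' + PV.dim K"
    unfolding V'_def K_def by (rule dim_split[OF V]) simp
  have inc: "?FJ \<subseteq> ?FI" "?GJ \<subseteq> ?GI" by (auto simp: graded_part_def)
  have fixJ: "drop_comp i v = v" if "lookup v i = 0" for v :: "'k fvec"
    using that by (auto intro!: poly_mapping_eqI simp: lookup_drop_comp)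
  have J0: "lookup v i = 0" if "v \<in> graded_part n ?J f e" for v :: "'k fvec" and e
    using that iJ(1) by (auto simp: graded_part_def keys_subset_iff)
  have singleI: "Poly_Mapping.single i q \<in> graded_part n ?I f e" if "q \<in> poly_comp n (e - f i)" for e and q :: "'k mpoly"
    using that PV.subspace_0[OF subspace_poly_comp]
    by (auto simp: graded_part_def keys_subset_iff lookup_single when_def)
  have "drop_comp i ` ?FI = ?FJ"
    using drop inc(1) fixJ J0 by (force simp: image_iff)
  moreover have "{p. Poly_Mapping.single i p \<in> ?FI} = ?S"
    using singleI[of _ d] single_graded_partD by blast
  moreover have subFI: "FV.subspace ?FI" by (rule subspace_graded_part)
  ultimately have dimF: "FV.dim ?FI = FV.dim ?FJ + PV.dim ?S"
    using dim_split[OF subFI order_refl, of i] by simp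
  define WJ WS W where "WJ = (\<lambda>l. plus_mult V' (Poly_Mapping.single 0 l) ?GJ)"
    and "WS = (\<lambda>l. plus_mult K l ?T)" and "W = (\<lambda>l. plus_mult V (Poly_Mapping.single 0 l) ?GI)"
  obtain l1 where l1: "l1 \<in> ?L" "FV.dim ?FJ \<le> FV.dim (WJ l1) + pre (module_word n f d js) (FV.dim ?FJ - FV.dim V')"
    using snoc.IH[OF iJ(2,3) V'] unfolding WJ_def by blast
  obtain l2 where l2: "l2 \<in> ?L" "PV.dim ?S \<le> PV.dim (WS l2) + pre (monword n (d - f i)) (PV.dim ?S - PV.dim K)"
    using green_ring_int[OF inf K] unfolding WS_def by blast
  define l where "l = (\<lambda>t. l1 + pscale t (l2 - l1))"
  have L: "l t \<in> ?L" for t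
    unfolding l_def using l1(1) l2(1)
    by (auto intro!: poly_comp_line PV.subspace_diff subspace_poly_comp)
  have l01: "l 0 = l1" "l 1 = l2" by (auto simp: l_def)
  have WJ_sub: "WJ (l t) \<subseteq> ?FJ" for t
    unfolding WJ_def by (rule plus_mult_subset_graded_part[OF V'(2) L order_refl])
  have WS_sub: "WS (l t) \<subseteq> ?S" for t
    unfolding WS_def by (rule plus_mult_subset_poly_comp[OF K(2) L order_refl])
  have W_sub: "W (l t) \<subseteq> ?FI" for t
    unfolding W_def by (rule plus_mult_subset_graded_part[OF V(2) L order_refl])
  have WJ_eq: "WJ (l t) = (\<lambda>j. (\<lambda>(x, q). x + Poly_Mapping.single 0 (l t) * q) j) ` (V' \<times> ?GJ)"
    and WS_eq: "WS (l t) = (\<lambda>j. (\<lambda>(x, q). x + l t * q) j) ` (K \<times> ?T)" for t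
    by (auto simp: WJ_def WS_def plus_mult_image)
  have "finite {t. FV.dim (WJ (l t)) < FV.dim (WJ (l 0))}"
    unfolding WJ_eq
  proof (rule FV.dim_line_semicontinuous)
    show "\<exists>P. \<forall>t. fcoord c (case j of (x, q) \<Rightarrow> x + Poly_Mapping.single 0 (l t) * q) = poly P t" for j c
      unfolding l_def by (cases j) (simp add: poly_line_fvec)
    show "fin_spanned FV.span ((\<lambda>j. (\<lambda>(x, q). x + Poly_Mapping.single 0 (l t) * q) j) ` (V' \<times> ?GJ))" for t
      using FV.fin_spanned_subset[OF WJ_sub fin_spanned_graded_part] unfolding WJ_eq by simp
  qed
  moreover have "finite {t. PV.dim (WS (l t)) < PV.dim (WS (l 1))}"
    unfolding WS_eq
  proof (rule PV.dim_line_semicontinuous)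
    show "\<exists>P. \<forall>t. lookup (case j of (x, q) \<Rightarrow> x + l t * q) c = poly P t" for j c
      unfolding l_def by (cases j) (simp add: poly_line_mult_single)
    show "fin_spanned PV.span ((\<lambda>j. (\<lambda>(x, q). x + l t * q) j) ` (K \<times> ?T))" for t
      using PV.fin_spanned_subset[OF WS_sub fin_spanned_poly_comp] unfolding WS_eq .
  qed
  ultimately have "finite ({t. FV.dim (WJ (l t)) < FV.dim (WJ (l 0))} \<union> {t. PV.dim (WS (l t)) < PV.dim (WS (l 1))})"
    by simp
  from ex_new_if_finite[OF inf this] obtain t where t: "FV.dim (WJ l1) \<le> FV.dim (WJ (l t))" "PV.dim (WS l2) \<le> PV.dim (WS (l t))"
    unfolding l01 by (auto simp: not_less)
  \<comment> \<open>Projecting or intersecting after adding multiples of the form gives at least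
    what is obtained in the opposite order, and inclusions in this direction bound the dimension of
    \<open>W\<close> from below.\<close>
  have "FV.dim (WJ (l t)) \<le> FV.dim (drop_comp i ` W (l t))"
  proof (rule FV.dim_mono)
    show "WJ (l t) \<subseteq> drop_comp i ` W (l t)"
    proof
      fix w assume "w \<in> WJ (l t)"
      then obtain x y where w: "w = drop_comp i x + Poly_Mapping.single 0 (l t) * y" "x \<in> V" "y \<in> ?GJ"
        by (auto simp: WJ_def plus_mult_def V'_def)
      then have "w = drop_comp i (x + Poly_Mapping.single 0 (l t) * y)"
        using J0[OF w(3)] by (simp add: p.add fixJ lookup_single_0_mult)
      moreover have "x + Poly_Mapping.single 0 (l t) * y \<in> W (l t)"
        unfolding W_def plus_mult_def using w(2,3) inc(2) by blast
      ultimately show "w \<in> drop_comp i ` W (l t)" by blast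
    qed
    show "fin_spanned FV.span (drop_comp i ` W (l t))"
      using W_sub[of t] drop by (intro FV.fin_spanned_subset[OF _ fin_spanned_graded_part[of ?J n f d]]) auto
  qed
  moreover have "PV.dim (WS (l t)) \<le> PV.dim {p. Poly_Mapping.single i p \<in> W (l t)}"
  proof (rule PV.dim_mono)
    show "WS (l t) \<subseteq> {p. Poly_Mapping.single i p \<in> W (l t)}"
    proof
      fix p assume "p \<in> WS (l t)"
      then obtain x y where p: "p = x + l t * y" "Poly_Mapping.single i x \<in> V" "y \<in> ?T"
        by (auto simp: WS_def plus_mult_def K_def)
      have "Poly_Mapping.single i p = Poly_Mapping.single i x + Poly_Mapping.single 0 (l t) * Poly_Mapping.single i y"
        by (simp add: p(1) single_add mult_single)
      moreover have "Poly_Mapping.single i y \<in> ?GI"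
        using p(3) by (intro singleI) (simp add: algebra_simps)
      ultimately show "p \<in> {p. Poly_Mapping.single i p \<in> W (l t)}"
        unfolding W_def plus_mult_def using p(2) by blast
    qed
    have "{p. Poly_Mapping.single i p \<in> W (l t)} \<subseteq> ?S"
      using W_sub[of t] single_graded_partD by blast
    then show "fin_spanned PV.span {p. Poly_Mapping.single i p \<in> W (l t)}"
      using fin_spanned_poly_comp by (rule PV.fin_spanned_subset)
  qed
  moreover have "FV.dim (W (l t)) = FV.dim (drop_comp i ` W (l t)) + PV.dim {p. Poly_Mapping.single i p \<in> W (l t)}"
    by (rule dim_split[OF _ W_sub]) (auto simp: W_def intro!: subspace_plus_mult_fvec V subspace_graded_part)
  ultimately have "FV.dim (WJ l1) + PV.dim (WS l2) \<le> FV.dim (W (l t))" using t by linarith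
  moreover define a b where "a = PV.dim ?S - PV.dim K" and "b = FV.dim ?FJ - FV.dim V'"
  have le: "PV.dim K \<le> PV.dim ?S" "FV.dim V' \<le> FV.dim ?FJ"
    using K(2) V'(2) by (auto intro!: PV.dim_mono FV.dim_mono fin_spanned_poly_comp fin_spanned_graded_part)
  have ab: "a + b = FV.dim ?FI - FV.dim V" unfolding a_def b_def dimF dimV using le by linarith
  \<comment> \<open>The codimension is shared as \<open>a + b\<close> in an uncontrolled way;
    merging replaces the two prefixes by one prefix of the joint word.\<close>
  have "pre (monword n (d - f i)) a + pre (module_word n f d js) b
      \<le> pre (module_word n f d js @ monword n (d - f i)) (a + b)"
    unfolding module_word_def
  proof (rule pre_merge)
    show "dominates u (monword n (d - f i))" if "u \<in> set (map (\<lambda>i. monword n (d - f i)) js)" for u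
      using that iJ(4) by (auto intro!: dominates_monword)
    show "a \<le> length (monword n (d - f i))" by (simp add: a_def dim_poly_comp)
    show "b \<le> length (concat (map (\<lambda>i. monword n (d - f i)) js))"
      using iJ(2) by (simp add: b_def dim_graded_part flip: module_word_def)
  qed
  ultimately have "FV.dim ?FI \<le> FV.dim (W (l t)) + pre (module_word n f d (js @ [i])) (FV.dim ?FI - FV.dim V)"
    using l1(2)[folded b_def] l2(2)[folded a_def] unfolding ab[symmetric] unfolding dimF
    by (simp add: module_word_def)
  then show ?case using L[of t] unfolding W_def by blast
qed

section \<open>Macaulay representations\<close>

lemma macaulay_rep_ge: "macaulay_rep d a s c \<Longrightarrow> i \<in> {s..d} \<Longrightarrow> i \<le> c i"
proof (induction i)
  case (Suc i)
  show ?case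
  proof (cases "s = Suc i")
    case True
    then show ?thesis using Suc.prems by (simp add: macaulay_rep_def)
  next
    case False
    then have "i \<in> {s..d}" using Suc.prems by auto
    moreover have "c i < c (Suc i)"
      using Suc.prems \<open>i \<in> {s..d}\<close> unfolding macaulay_rep_def by (auto intro: strict_mono_onD)
    ultimately show ?thesis using Suc by auto
  qed
qed simp

lemma macaulay_rep_pos: "macaulay_rep d a s c \<Longrightarrow> 0 < a"
proof -
  assume r: "macaulay_rep d a s c"
  then have "0 < c s choose s" "s \<in> {s..d}" by (auto simp: macaulay_rep_def)
  then have "0 < (\<Sum>i=s..d. c i choose i)" by (intro sum_pos2[of _ s]) auto
  then show ?thesis using r by (simp add: macaulay_rep_def)
qed

lemma macaulay_rep_Suc:
  assumes "macaulay_rep (Suc d) a s c"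
  obtains "s = Suc d" "a = c (Suc d) choose Suc d"
  | b where "s \<le> d" "macaulay_rep d b s c" "c d < c (Suc d)" "a = b + (c (Suc d) choose Suc d)"
proof (cases "s = Suc d")
  case True
  then show ?thesis using that(1) assms by (simp add: macaulay_rep_def)
next
  case False
  then have "s \<le> d" using assms by (simp add: macaulay_rep_def)
  moreover have "strict_mono_on {s..d} c"
    using assms by (auto simp: macaulay_rep_def intro: monotone_on_subset)
  moreover have "c d < c (Suc d)"
    using assms \<open>s \<le> d\<close> unfolding macaulay_rep_def by (auto intro: strict_mono_onD)
  ultimately show ?thesis using that(2) assms by (simp add: macaulay_rep_def)
qed

text \<open>By induction the lower terms stay below \<open>c (Suc d) choose d\<close>, and Pascal's
  rule adds this to the leading term. Hence the leading entry is the largest possible one, as in a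
  greedy expansion.\<close>

lemma macaulay_rep_less: "macaulay_rep d a s c \<Longrightarrow> a < Suc (c d) choose d"
proof (induction d arbitrary: a)
  case 0
  then show ?case by (auto simp: macaulay_rep_def)
next
  case (Suc d)
  have "d \<le> c (Suc d)" using macaulay_rep_ge[OF Suc.prems, of "Suc d"] Suc.prems by (auto simp: macaulay_rep_def)
  from Suc.prems show ?case
  proof (cases rule: macaulay_rep_Suc)
    case 1
    then show ?thesis using \<open>d \<le> c (Suc d)\<close> by simp
  next
    case (2 b)
    have "b < Suc (c d) choose d" using Suc.IH 2 by blast
    also have "\<dots> \<le> c (Suc d) choose d" using 2 by (intro binomial_right_mono) auto
    finally show ?thesis using 2 by simp
  qed
qed

lemma macaulay_rep_top_le:
  assumes "macaulay_rep d a s c" "macaulay_rep d a s' c'"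
  shows "c d \<le> c' d"
proof (rule ccontr)
  assume "\<not> ?thesis"
  then have "Suc (c' d) choose d \<le> c d choose d" by (intro binomial_right_mono) auto
  also have "\<dots> \<le> a"
    using assms(1) member_le_sum[of d "{s..d}" "\<lambda>i. c i choose i"] by (simp add: macaulay_rep_def)
  finally show False using macaulay_rep_less[OF assms(2)] by simp
qed

text \<open>Lowered sums are compared rather than the functions, because \<open>c\<close> is
  arbitrary outside \<open>{s..d}\<close>. The leading entries agree; after their removal the rests
  agree, and a rest with terms is positive.\<close>

lemma macaulay_rep_unique:
  "macaulay_rep d a s c \<Longrightarrow> macaulay_rep d a s' c' \<Longrightarrow>
    (\<Sum>i=s..d. (c i - 1) choose i) = (\<Sum>i=s'..d. (c' i - 1) choose i)"
proof (induction d arbitrary: a)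
  case 0
  then show ?case by (simp add: macaulay_rep_def)
next
  case (Suc d)
  have top: "c (Suc d) = c' (Suc d)"
    using macaulay_rep_top_le Suc.prems by (meson le_antisym)
  from Suc.prems(1) show ?case
  proof (cases rule: macaulay_rep_Suc)
    case 1
    from Suc.prems(2) show ?thesis
    proof (cases rule: macaulay_rep_Suc)
      case (2 b)
      then show ?thesis using 1 top macaulay_rep_pos[OF 2(2)] by simp
    qed (use 1 top in simp)
  next
    case (2 b)
    note b = this
    from Suc.prems(2) show ?thesis
    proof (cases rule: macaulay_rep_Suc)
      case 1
      then show ?thesis using b top macaulay_rep_pos[OF b(2)] by simp
    next
      case (2 b')
      then have "b' = b" using b top by simp
      then show ?thesis using Suc.IH[OF b(2)] 2 b top by simp
    qed
  qed
qed

text \<open>When the prefix covers the block \<open>u\<close>, the length of \<open>u\<close> is the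
  leading binomial coefficient and its sum is the lowered one. The bound \<open>c d < q + d\<close>
  makes the remaining entries smaller than the leading one.\<close>

lemma macaulay_rep_lexword:
  "0 < d \<Longrightarrow> 0 < a \<Longrightarrow> a < length (lexword (Suc q) d) \<Longrightarrow>
    \<exists>s c. macaulay_rep d a s c \<and> c d < q + d \<and> pre (lexword (Suc q) d) a = (\<Sum>i=s..d. (c i - 1) choose i)"
proof (induction q arbitrary: d a)
  case (Suc p)
  note IHq = Suc.IH
  from Suc.prems show ?case
  proof (induction d arbitrary: a)
    case (Suc d)
    let ?u = "lexword (Suc p) (Suc d)" and ?v = "lexword (Suc (Suc p)) d"
    have w: "lexword (Suc (Suc p)) (Suc d) = ?u @ ?v" using lexword_Suc[of "Suc d" p] by simp
    have lenu: "length ?u = (p + Suc d) choose Suc d" by (simp add: length_lexword)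
    show ?case
    proof (cases "a < length ?u")
      case True
      then obtain s c where "macaulay_rep (Suc d) a s c" "c (Suc d) < p + Suc d"
        "pre ?u a = (\<Sum>i=s..Suc d. (c i - 1) choose i)"
        using IHq[of "Suc d" a] Suc.prems by auto
      then show ?thesis using True by (intro exI[of _ s] exI[of _ c]) (simp add: w pre_append)
    next
      case False
      define a' where "a' = a - length ?u"
      have a: "a = length ?u + a'" "a' < length ?v" using False Suc.prems by (auto simp: a'_def w)
      have sumu: "sum_list ?u = (p + d) choose Suc d"
        using sum_list_lexword[of "Suc d" p] by (cases p) (auto simp: length_lexword)
      show ?thesis
      proof (cases "a' = 0")
        case True
        then show ?thesis using a lenu sumu
          by (intro exI[of _ "Suc d"] exI[of _ "\<lambda>_. p + Suc d"])
            (auto simp: macaulay_rep_def w pre_append pre_all strict_mono_on_def)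
      next
        case False
        then have "0 < d" using a by (cases d) auto
        then obtain s c where r: "macaulay_rep d a' s c" and top: "c d < Suc p + d"
          and val: "pre ?v a' = (\<Sum>i=s..d. (c i - 1) choose i)"
          using Suc.IH[of a'] False a by auto
        let ?c = "c(Suc d := p + Suc d)"
        have s: "1 \<le> s" "s \<le> d" "s \<le> c s" and mono: "strict_mono_on {s..d} c"
          using r by (auto simp: macaulay_rep_def)
        have "?c i < ?c j" if "i \<in> {s..Suc d}" "j \<in> {s..Suc d}" "i < j" for i j
        proof (cases "j = Suc d")
          case True
          have "c i \<le> c d"
            using strict_mono_onD[OF mono, of i d] that True s(2) by (cases "i = d") auto
          then show ?thesis using True that top by simp
        next
          case False
          then show ?thesis using strict_mono_onD[OF mono, of i j] that by auto
        qed
        then have "strict_mono_on {s..Suc d} ?c" by (intro strict_mono_onI) auto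
        moreover have "(\<Sum>i=s..d. ?c i choose i) = (\<Sum>i=s..d. c i choose i)"
          "(\<Sum>i=s..d. (?c i - 1) choose i) = (\<Sum>i=s..d. (c i - 1) choose i)"
          by (auto intro!: sum.cong)
        moreover have "?c s = c s" "?c (Suc d) = p + Suc d" using s(2) by simp_all
        ultimately show ?thesis
          using s r a lenu sumu val
          by (intro exI[of _ s] exI[of _ ?c]) (simp add: macaulay_rep_def w pre_append pre_all del: fun_upd_apply)
      qed
    qed
  qed simp
qed simp

lemma macaulay_lower_eq_pre:
  assumes "a \<le> length (monword n d)"
  shows "macaulay_lower a d = pre (monword n d) a"
proof (cases "a = 0")
  case False
  then have "0 \<le> d" using assms by (auto simp: monword_def split: if_splits)
  show ?thesis
  proof (cases "d = 0")
    case True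
    then have "a = 1" using assms False by (simp add: monword_def)
    then show ?thesis using True by (simp add: macaulay_lower_def monword_def pre_def)
  next
    case False
    define e where "e = nat d"
    have e: "0 < e" "d = int e" using False \<open>0 \<le> d\<close> by (auto simp: e_def)
    have w: "monword n d = lexword n e" using e by (simp add: monword_def)
    \<comment> \<open>The prefix may be the whole word, while the representation was obtained for
      proper prefixes. One more variable prolongs the word and leaves the prefix unchanged.\<close>
    obtain x where x: "lexword (Suc n) e = lexword n e @ x" using lexword_prefix[of n "Suc n" e] e by auto
    have "0 < length (lexword (Suc n) (e - 1))" by (simp add: length_lexword)
    then have "a < length (lexword (Suc n) e)" using assms length_lexword_Suc[OF e(1), of n] unfolding w by linarith
    then obtain s c where r: "macaulay_rep e a s c" "pre (lexword (Suc n) e) a = (\<Sum>i=s..e. (c i - 1) choose i)"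
      using macaulay_rep_lexword[OF e(1), of a n] \<open>a \<noteq> 0\<close> by auto
    have "(THE b. \<exists>s c. macaulay_rep (nat d) a s c \<and> b = (\<Sum>i=s..nat d. (c i - 1) choose i)) = (\<Sum>i=s..e. (c i - 1) choose i)"
    proof (rule the_equality)
      show "\<exists>s' c'. macaulay_rep (nat d) a s' c' \<and> (\<Sum>i=s..e. (c i - 1) choose i) = (\<Sum>i=s'..nat d. (c' i - 1) choose i)"
        using r(1) unfolding e_def by blast
      show "b = (\<Sum>i=s..e. (c i - 1) choose i)"
        if "\<exists>s c. macaulay_rep (nat d) a s c \<and> b = (\<Sum>i=s..nat d. (c i - 1) choose i)" for b
        using that r(1) macaulay_rep_unique unfolding e_def by blast
    qed
    moreover have "pre (lexword (Suc n) e) a = pre (lexword n e) a"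
      using assms w by (simp add: x pre_append)
    ultimately show ?thesis using r(2) w False \<open>a \<noteq> 0\<close> by (simp add: macaulay_lower_def)
  qed
qed (simp add: macaulay_lower_def)

section \<open>Lex-segments\<close>

lemma sorted_wrt_irrefl_distinct: "sorted_wrt P xs \<Longrightarrow> (\<And>x. \<not> P x x) \<Longrightarrow> distinct xs"
  by (induction xs) auto

lemma filter_eq_take:
  assumes "sorted_wrt P xs" "\<And>x y. P x y \<Longrightarrow> \<not> P y x"
    and "\<And>x y. x \<in> set xs \<Longrightarrow> y \<in> set xs \<Longrightarrow> Q x \<Longrightarrow> \<not> Q y \<Longrightarrow> P x y"
  shows "filter Q xs = take (length (filter Q xs)) xs"
  using assms(1,3)
proof (induction xs)
  case (Cons x xs)
  show ?case
  proof (cases "Q x")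
    case True
    then show ?thesis using Cons by simp
  next
    case False
    have "\<not> Q y" if "y \<in> set xs" for y
      using Cons.prems(2)[of y x] Cons.prems(1) that False assms(2) by auto
    then show ?thesis using False by simp
  qed
qed simp

section \<open>Monomials of a free module in increasing order\<close>

definition sorted_monomials :: "nat \<Rightarrow> (nat \<Rightarrow> int) \<Rightarrow> int \<Rightarrow> nat list \<Rightarrow> (nat \<times> pprod) list"
  where "sorted_monomials n f d is = concat (map (\<lambda>i. map (Pair i) (sorted_mons n (d - f i))) is)"

lemma set_sorted_monomials: "set (sorted_monomials n f d is) = (SIGMA i:set is. mons n (d - f i))"
  by (auto simp: sorted_monomials_def set_sorted_mons)

lemma module_word_eq:
  "module_word n f d is = map (\<lambda>(i, t). if n \<in> keys t then 0 else 1) (sorted_monomials n f d is)"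
  by (simp add: module_word_def sorted_monomials_def map_concat monword_eq comp_def)

lemma sorted_sorted_monomials:
  "sorted_wrt (>) is \<Longrightarrow> sorted_wrt (\<lambda>a b. monomial_greater b a) (sorted_monomials n f d is)"
proof (induction "is")
  case (Cons i js)
  have "sorted_wrt (\<lambda>a b. monomial_greater b a) (map (Pair i) (sorted_mons n (d - f i)))"
    using sorted_sorted_mons[of n "d - f i"] by (simp add: sorted_wrt_map monomial_greater_def)
  then show ?case
    using Cons by (auto simp: sorted_monomials_def sorted_wrt_append monomial_greater_def)
qed (simp add: sorted_monomials_def)

lemma monomials_eq: "monomials n r f d = (SIGMA i:{1..r}. mons n (d - f i))"
  by (auto simp: monomials_def mons_def eq_diff_eq)

lemma finite_monomials: "finite (monomials n r f d)"
  by (simp add: monomials_eq finite_mons)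

lemma free_comp_eq_supported: "free_comp n r f d = FV.supported (monomials n r f d)"
  by (simp add: free_comp_eq graded_part_eq_supported monomials_eq)

text \<open>Monomials with a larger basis index are smaller, so the increasing enumeration runs
  backwards through the basis. For monotone \<open>f\<close> the list then has the order that the
  bound for modules requires.\<close>

definition indices :: "nat \<Rightarrow> nat list"
  where "indices r = rev [1..<Suc r]"

lemma set_indices: "set (indices r) = {1..r}"
  unfolding indices_def set_rev set_upt by auto

lemma sorted_indices: "sorted_wrt (>) (indices r)" and distinct_indices: "distinct (indices r)"
  unfolding indices_def sorted_wrt_rev distinct_rev by (rule sorted_wrt_upt distinct_upt)+

text \<open>The complement of a lex-segment is an initial part of the increasing enumeration, and
  the ones in the word mark the monomials without the last variable.\<close>

lemma card_lex_complement:
  assumes "lex_segment n r f d len B"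
  defines "A \<equiv> monomials n r f d - B"
  shows "card {(i, t) \<in> A. n \<notin> keys t} = pre (module_word n f d (indices r)) (card A)"
proof -
  let ?xs = "sorted_monomials n f d (indices r)"
  have set: "set ?xs = monomials n r f d"
    by (simp only: set_sorted_monomials monomials_eq set_indices)
  have sorted: "sorted_wrt (\<lambda>a b. monomial_greater b a) ?xs"
    by (intro sorted_sorted_monomials sorted_indices)
  have asym: "\<not> monomial_greater a b" if "monomial_greater b a" for a b
    using that by (auto simp: monomial_greater_def)
  have dist: "distinct ?xs"
    using sorted by (rule sorted_wrt_irrefl_distinct) (auto simp: monomial_greater_def)
  have setA: "set (filter (\<lambda>a. a \<in> A) ?xs) = A" by (auto simp: set A_def)
  then have len: "length (filter (\<lambda>a. a \<in> A) ?xs) = card A"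
    using dist distinct_card[of "filter (\<lambda>a. a \<in> A) ?xs"] by simp
  have "filter (\<lambda>a. a \<in> A) ?xs = take (length (filter (\<lambda>a. a \<in> A) ?xs)) ?xs"
    using sorted asym
  proof (rule filter_eq_take)
    show "monomial_greater y x" if "x \<in> set ?xs" "y \<in> set ?xs" "x \<in> A" "y \<notin> A" for x y
      using that assms(1) unfolding set lex_segment_def A_def by blast
  qed
  then have take: "take (card A) ?xs = filter (\<lambda>a. a \<in> A) ?xs" by (simp add: len)
  have "pre (module_word n f d (indices r)) (card A) =
      sum_list (map (\<lambda>(i, t). if n \<in> keys t then 0 else 1) (filter (\<lambda>a. a \<in> A) ?xs))"
    unfolding pre_def module_word_eq take_map take ..
  also have "\<dots> = (\<Sum>(i, t)\<in>A. if n \<in> keys t then 0 else 1)"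
    using dist setA by (simp add: sum_list_distinct_conv_sum_set)
  also have "\<dots> = card {a \<in> A. n \<notin> keys (snd a)}"
    using finite_monomials[of n r f d] by (simp add: A_def case_prod_unfold sum.If_cases Int_def)
  also have "{a \<in> A. n \<notin> keys (snd a)} = {(i, t) \<in> A. n \<notin> keys t}" by auto
  finally show ?thesis ..
qed

section \<open>Products of monomials with a linear form\<close>

lemma linear_form_expand:
  assumes "l \<in> poly_comp n 1"
  shows "l = (\<Sum>j\<in>{1..n}. Poly_Mapping.single (Poly_Mapping.single j 1) (lookup l (Poly_Mapping.single j 1)))"
proof (rule poly_mapping_eqI)
  fix t
  show "lookup l t = lookup (\<Sum>j\<in>{1..n}. Poly_Mapping.single (Poly_Mapping.single j 1) (lookup l (Poly_Mapping.single j 1))) t"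
  proof (cases "\<exists>j\<in>{1..n}. t = Poly_Mapping.single j 1")
    case True
    then obtain i where i: "i \<in> {1..n}" "t = Poly_Mapping.single i 1" by blast
    have "Poly_Mapping.single j (1::nat) = Poly_Mapping.single i 1 \<longleftrightarrow> j = i" for j
      by (metis lookup_single_eq lookup_single_not_eq zero_neq_one)
    then show ?thesis using i by (simp add: lookup_sum lookup_single when_def cong: if_cong)
  next
    case False
    have "t \<notin> mons n 1"
    proof
      assume t: "t \<in> mons n 1"
      then have "t \<noteq> 0" by (auto simp: mons_def)
      then obtain i where i: "i \<in> keys t" by (metis keys_eq_empty equals0I)
      then obtain s where s: "t = Poly_Mapping.single i 1 + s" by (rule pprod_split)
      then have "pprod_deg s = 0" using t by (simp add: mons_def pprod_deg_add)
      then have "t = Poly_Mapping.single i 1" using s by (simp add: pprod_deg_eq_0_iff)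
      moreover have "i \<in> {1..n}" using t i by (auto simp: mons_def pprods_def)
      ultimately show False using False by blast
    qed
    then have "lookup l t = 0" using assms by (auto simp: poly_comp_iff in_keys_iff)
    then show ?thesis using False by (auto simp: lookup_sum lookup_single when_def intro!: sum.neutral[symmetric])
  qed
qed

lemma mult_monomial_vec:
  assumes "l \<in> poly_comp n 1"
  shows "Poly_Mapping.single 0 l * monomial_vec (i, v) =
    (\<Sum>j\<in>{1..n}. fscale (lookup l (Poly_Mapping.single j 1)) (monomial_vec (i, Poly_Mapping.single j 1 + v)))"
proof -
  have "l * Poly_Mapping.single v 1 =
    (\<Sum>j\<in>{1..n}. pscale (lookup l (Poly_Mapping.single j 1)) (Poly_Mapping.single (Poly_Mapping.single j 1 + v) 1))"
    by (subst linear_form_expand[OF assms]) (simp add: sum_distrib_right mult_single pscale_def)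
  then have "Poly_Mapping.single 0 l * monomial_vec (i, v) = Poly_Mapping.single i
    (\<Sum>j\<in>{1..n}. pscale (lookup l (Poly_Mapping.single j 1)) (Poly_Mapping.single (Poly_Mapping.single j 1 + v) 1))"
    by (simp add: monomial_vec_def mult_single)
  also have "\<dots> = (\<Sum>j\<in>{1..n}. fscale (lookup l (Poly_Mapping.single j 1)) (monomial_vec (i, Poly_Mapping.single j 1 + v)))"
  proof -
    interpret s: Vector_Spaces.linear pscale fscale "Poly_Mapping.single i" by (rule linear_single)
    show ?thesis by (simp add: s.sum s.scale monomial_vec_def)
  qed
  finally show ?thesis .
qed

lemma single_less_single: "i < j \<Longrightarrow> Poly_Mapping.single j (1::nat) < Poly_Mapping.single i 1"
  unfolding less_poly_mapping.rep_eq less_fun_def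
  by (intro exI[of _ i]) (auto simp: lookup_single when_def)

lemma monomials_mult:
  "(i, v) \<in> monomials n r f (d - 1) \<Longrightarrow> j \<in> {1..n} \<Longrightarrow> (i, Poly_Mapping.single j 1 + v) \<in> monomials n r f d"
  by (auto simp: monomials_def pprods_def keys_add_pprod pprod_deg_add)

lemma monomials_div:
  assumes "(i, t) \<in> monomials n r f d" "n \<in> keys t"
  obtains v where "t = Poly_Mapping.single n 1 + v" "(i, v) \<in> monomials n r f (d - 1)" "n \<in> {1..n}"
proof -
  obtain v where "t = Poly_Mapping.single n 1 + v" using assms(2) by (rule pprod_split)
  moreover from this have "(i, v) \<in> monomials n r f (d - 1)"
    using assms(1) by (auto simp: monomials_def pprods_def keys_add_pprod pprod_deg_add)
  moreover have "n \<in> {1..n}" using assms by (auto simp: monomials_def pprods_def)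
  ultimately show ?thesis using that by blast
qed

lemma lex_segment_subset:
  assumes "lex_segment n r f d len B"
  shows "B \<subseteq> monomials n r f d" "finite B"
  using assms finite_monomials finite_subset unfolding lex_segment_def by blast+

context
  fixes n r len :: nat and f :: "nat \<Rightarrow> int" and d :: int and B :: "(nat \<times> pprod) set" and l :: "'k::field mpoly"
  assumes lex: "lex_segment n r f d len B" and l: "l \<in> poly_comp n 1"
begin

private abbreviation (input) "lexW \<equiv>
  plus_mult (FV.span (monomial_vec ` B)) (Poly_Mapping.single 0 l) (free_comp n r f (d - 1))"

lemma lexW_subset: "lexW \<subseteq> free_comp n r f d"
proof -
  have "FV.span (monomial_vec ` B) \<subseteq> free_comp n r f d"
    using FV.span_mono[of "monomial_vec ` B" "monomial_vec ` monomials n r f d"] lex_segment_subset(1)[OF lex] finite_monomials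
    by (auto simp: FV.span_unit_vec free_comp_eq_supported)
  then show ?thesis
    unfolding free_comp_eq using l by (intro plus_mult_subset_graded_part) auto
qed

text \<open>If \<open>x_n v e_i\<close> lies in the segment, so do all \<open>x_j v e_i\<close>, and
  the product of \<open>l\<close> with \<open>v e_i\<close> gives nothing new. Every other
  \<open>v e_i\<close> contributes at most one dimension and is recorded by the monomial
  \<open>x_n v e_i\<close> outside \<open>B\<close>. This half is valid for every linear
  form.\<close>

lemma dim_lexW_le:
  "FV.dim lexW \<le> card B + card {(i, t) \<in> monomials n r f d - B. n \<in> keys t}"
proof -
  let ?A0 = "{(i, t) \<in> monomials n r f d - B. n \<in> keys t}"
  let ?g = "\<lambda>(i, t). Poly_Mapping.single 0 l * monomial_vec (i, t - Poly_Mapping.single n 1) :: 'k fvec"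
  let ?T = "monomial_vec ` B \<union> ?g ` ?A0"
  have fin: "finite ?A0" using finite_monomials[of n r f d] by (rule finite_subset[rotated]) auto
  have gen: "Poly_Mapping.single 0 l * monomial_vec (i, v) \<in> FV.span ?T"
    if v: "(i, v) \<in> monomials n r f (d - 1)" for i v
  proof (cases "n = 0 \<or> (i, Poly_Mapping.single n 1 + v) \<in> B")
    case True
    \<comment> \<open>For \<open>n = 0\<close> there is no such \<open>j\<close>. Otherwise an
      \<open>x_j v e_i\<close> outside the segment would be smaller than the member
      \<open>x_n v e_i\<close>.\<close>
    have "(i, Poly_Mapping.single j 1 + v) \<in> B" if j: "j \<in> {1..n}" for j
    proof (rule ccontr)
      assume "(i, Poly_Mapping.single j 1 + v) \<notin> B"
      moreover have "(i, Poly_Mapping.single j 1 + v) \<in> monomials n r f d"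
        using v j by (rule monomials_mult)
      ultimately have "monomial_greater (i, Poly_Mapping.single n 1 + v) (i, Poly_Mapping.single j 1 + v)"
        using lex True j unfolding lex_segment_def by auto
      then have "Poly_Mapping.single j (1::nat) < Poly_Mapping.single n 1"
        by (simp add: monomial_greater_def)
      moreover have "j \<le> n" using j by simp
      ultimately show False using single_less_single[of j n] by (cases "j = n") auto
    qed
    then show ?thesis
      unfolding mult_monomial_vec[OF l]
      by (intro FV.span_sum FV.span_scale FV.span_base) auto
  next
    case False
    then have "(i, Poly_Mapping.single n 1 + v) \<in> ?A0"
      using monomials_mult[OF v, of n] by (auto simp: keys_add_pprod)
    then have "?g (i, Poly_Mapping.single n 1 + v) \<in> ?g ` ?A0" by (rule imageI)
    then show ?thesis by (intro FV.span_base) auto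
  qed
  interpret g: Vector_Spaces.linear fscale fscale "(*) (Poly_Mapping.single 0 l)" by (rule linear_mult_fvec)
  have "(*) (Poly_Mapping.single 0 l) ` free_comp n r f (d - 1) =
      FV.span ((*) (Poly_Mapping.single 0 l) ` monomial_vec ` monomials n r f (d - 1))"
    by (simp add: g.span_image FV.span_unit_vec finite_monomials free_comp_eq_supported)
  also have "\<dots> \<subseteq> FV.span ?T" using gen by (intro FV.span_minimal) auto
  finally have "lexW \<subseteq> FV.span ?T"
    using FV.span_mono[of "monomial_vec ` B" ?T]
    by (auto simp: plus_mult_def intro!: FV.span_add)
  then have "FV.dim lexW \<le> card ?T" using lex_segment_subset(2)[OF lex] fin by (intro FV.dim_le_card) auto
  also have "\<dots> \<le> card (monomial_vec ` B :: 'k fvec set) + card (?g ` ?A0)" by (rule card_Un_le)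
  also have "\<dots> \<le> card B + card ?A0" using lex_segment_subset(2)[OF lex] fin by (intro add_mono card_image_le)
  finally show ?thesis .
qed

text \<open>Together with \<open>lexW\<close> the monomials outside \<open>B\<close> without the
  last variable span the component, so their number bounds the codimension. For \<open>n = 0\<close>
  all monomials outside \<open>B\<close> are of this kind.\<close>

lemma dim_lexW_ge:
  assumes ln: "n = 0 \<or> lookup l (Poly_Mapping.single n 1) \<noteq> 0"
  shows "card (monomials n r f d) \<le> FV.dim lexW + card {(i, t) \<in> monomials n r f d - B. n \<notin> keys t}"
proof -
  let ?A1 = "{(i, t) \<in> monomials n r f d - B. n \<notin> keys t}"
  let ?T = "lexW \<union> monomial_vec ` ?A1"
  have zero: "0 \<in> free_comp n r f (d - 1)"
    using FV.subspace_0[OF subspace_graded_part] by (auto simp: free_comp_eq)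
  \<comment> \<open>A largest exception is a multiple of \<open>x\<^sub>n\<close>, hence a combination of larger monomials modulo \<open>l\<close>.\<close>
  have all: "monomial_vec (i, t) \<in> FV.span ?T" if "(i, t) \<in> monomials n r f d" for i t
  proof (rule ccontr)
    define X where "X = {t. (i, t) \<in> monomials n r f d \<and> monomial_vec (i, t) \<notin> FV.span ?T}"
    assume "monomial_vec (i, t) \<notin> FV.span ?T"
    then have "X \<noteq> {}" using that by (auto simp: X_def)
    moreover have "X \<subseteq> snd ` monomials n r f d" by (force simp: X_def)
    then have "finite X" using finite_monomials finite_subset by blast
    ultimately have "Max X \<in> X" and max: "\<And>u. u \<in> X \<Longrightarrow> u \<le> Max X" by auto
    define u where "u = Max X"
    have u: "(i, u) \<in> monomials n r f d" "monomial_vec (i, u) \<notin> FV.span ?T"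
      using \<open>Max X \<in> X\<close> by (auto simp: X_def u_def)
    have "monomial_vec (i, u) \<in> lexW" if "(i, u) \<in> B"
    proof -
      have "monomial_vec (i, u) + Poly_Mapping.single 0 l * 0 \<in> lexW"
        unfolding plus_mult_def using that zero by (blast intro: FV.span_base)
      then show ?thesis by simp
    qed
    then have "(i, u) \<notin> B" using u(2) FV.span_base[of "monomial_vec (i, u)" ?T] by auto
    moreover have "(i, u) \<notin> ?A1" using u(2) FV.span_base[of "monomial_vec (i, u)" ?T] by auto
    ultimately have "n \<in> keys u" using u(1) by auto
    with u(1) obtain v where v: "u = Poly_Mapping.single n 1 + v" "(i, v) \<in> monomials n r f (d - 1)" "n \<in> {1..n}"
      by (rule monomials_div)
    let ?m = "Poly_Mapping.single 0 l * monomial_vec (i, v) :: 'k fvec"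
    let ?b = "\<lambda>j. fscale (lookup l (Poly_Mapping.single j 1)) (monomial_vec (i, Poly_Mapping.single j 1 + v)) :: 'k fvec"
    have m: "?m = ?b n + (\<Sum>j\<in>{1..n} - {n}. ?b j)"
      unfolding mult_monomial_vec[OF l] using v(3) by (intro sum.remove) auto
    have rest: "(\<Sum>j\<in>{1..n} - {n}. ?b j) \<in> FV.span ?T"
    proof (intro FV.span_sum FV.span_scale)
      fix j assume j: "j \<in> {1..n} - {n}"
      then have "u < Poly_Mapping.single j 1 + v"
        using single_less_single[of j n] by (simp add: v(1))
      then have "Poly_Mapping.single j 1 + v \<notin> X" using max u_def by (meson not_less)
      then show "monomial_vec (i, Poly_Mapping.single j 1 + v) \<in> FV.span ?T"
        using monomials_mult[OF v(2)] j by (auto simp: X_def)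
    qed
    have "0 + ?m \<in> lexW"
    proof -
      have "monomial_vec (i, v) \<in> free_comp n r f (d - 1)"
      proof -
        have "monomial_vec (i, v) \<in> FV.span (monomial_vec ` monomials n r f (d - 1))"
          using v(2) by (intro FV.span_base) blast
        then show ?thesis by (simp add: free_comp_eq_supported FV.span_unit_vec finite_monomials)
      qed
      then show ?thesis unfolding plus_mult_def using FV.span_zero by blast
    qed
    then have "?m \<in> FV.span ?T"
      by (intro FV.span_base) auto
    then have "?m - (\<Sum>j\<in>{1..n} - {n}. ?b j) \<in> FV.span ?T" using rest by (rule FV.span_diff)
    then have "?b n \<in> FV.span ?T" by (simp only: m add_diff_cancel_right')
    moreover have "lookup l (Poly_Mapping.single n 1) \<noteq> 0" using ln v(3) by auto
    ultimately have "monomial_vec (i, u) \<in> FV.span ?T"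
      using FV.span_scale[of "?b n" ?T "inverse (lookup l (Poly_Mapping.single n 1))"] by (simp add: v(1))
    then show False using u(2) by simp
  qed
  have finA: "finite ?A1" using finite_monomials[of n r f d] by (rule finite_subset[rotated]) auto
  have "fin_spanned FV.span lexW"
    using lexW_subset by (rule FV.fin_spanned_subset) (simp add: free_comp_eq_supported FV.fin_spanned_supported finite_monomials)
  then obtain C where C: "lexW \<subseteq> FV.span C" "finite C" "card C = FV.dim lexW"
    by (rule FV.fin_spanned_basis)
  let ?C = "C \<union> monomial_vec ` ?A1"
  have "FV.span ?T \<subseteq> FV.span ?C"
  proof (rule FV.span_minimal)
    show "?T \<subseteq> FV.span ?C"
      using C(1) FV.span_mono[of C ?C] FV.span_superset[of ?C] by auto
  qed simp
  then have "monomial_vec ` monomials n r f d \<subseteq> FV.span ?C" using all by auto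
  then have "FV.span (monomial_vec ` monomials n r f d) \<subseteq> FV.span ?C"
    by (rule FV.span_minimal) simp
  then have "FV.dim (FV.supported (monomials n r f d) :: 'k fvec set) \<le> card ?C"
    using C(2) finA by (intro FV.dim_le_card) (auto simp: FV.span_unit_vec finite_monomials)
  also have "\<dots> \<le> card C + card (monomial_vec ` ?A1 :: 'k fvec set)" by (rule card_Un_le)
  also have "\<dots> \<le> FV.dim lexW + card ?A1" using C(3) card_image_le[OF finA] by simp
  finally show ?thesis by (simp add: FV.dim_supported finite_monomials)
qed

end

section \<open>Hilbert functions and generic linear forms\<close>

lemma poly_ring_simps:
  "carrier (poly_ring n) = {p. keys p \<subseteq> pprods n}" "zero (poly_ring n) = 0" "add (poly_ring n) = (+)"
  "module.smult (poly_ring n) = (*)"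
  by (simp_all add: poly_ring_def)

lemma free_module_simps:
  "carrier (free_module n r) = {v. keys v \<subseteq> {1..r} \<and> (\<forall>i. keys (lookup v i) \<subseteq> pprods n)}"
  "zero (free_module n r) = 0" "add (free_module n r) = (+)"
  "module.smult (free_module n r) p v = Poly_Mapping.single 0 p * v"
  by (simp_all add: free_module_def poly_ring_simps mult_map_scale_conv_mult)

lemma k_space_simps:
  "carrier (k_space Q C) = C" "zero (k_space Q C) = zero Q" "add (k_space Q C) = add Q"
  "module.smult (k_space Q C) c = module.smult Q (Poly_Mapping.single 0 c)"
  by (simp_all add: k_space_def)

lemma k_space_free_module:
  "zero (k_space (free_module n r) C) = 0" "add (k_space (free_module n r) C) = (+)"
  "module.smult (k_space (free_module n r) C) = fscale"
  by (auto simp: k_space_simps free_module_simps fscale_def fun_eq_iff)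

lemma k_dim_free_module:
  "FV.subspace C \<Longrightarrow> fin_spanned FV.span C \<Longrightarrow> k_dim (free_module n r) C = FV.dim C"
  unfolding k_dim_def
  by (rule FV.vectorspace_dim_subspace(1)) (simp_all only: k_space_simps(1) k_space_free_module)

lemma k_dim_poly_comp: "k_dim (poly_ring n :: ('k::field mpoly, 'k mpoly) module) (poly_comp n d) = length (monword n d)"
proof -
  have "module.smult (k_space (poly_ring n :: ('k mpoly, 'k mpoly) module) (poly_comp n d)) = pscale"
    by (auto simp: k_space_simps poly_ring_simps pscale_def fun_eq_iff)
  then have "k_dim (poly_ring n :: ('k mpoly, 'k mpoly) module) (poly_comp n d) = PV.dim (poly_comp n d :: 'k mpoly set)"
    unfolding k_dim_def
    by (intro PV.vectorspace_dim_subspace(1) subspace_poly_comp fin_spanned_poly_comp)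
       (simp_all add: k_space_simps poly_ring_simps)
  then show ?thesis by (simp add: dim_poly_comp)
qed

lemma subspace_free_comp: "FV.subspace (free_comp n r f d)"
  and fin_spanned_free_comp: "fin_spanned FV.span (free_comp n r f d)"
  and dim_free_comp: "FV.dim (free_comp n r f d) = card (monomials n r f d)"
  by (simp_all add: free_comp_eq_supported FV.subspace_supported FV.fin_spanned_supported
      FV.dim_supported finite_monomials)

lemma hilbert_sub_eq:
  assumes "FV.subspace N"
  shows "hilbert_sub n r f N d = FV.dim (N \<inter> free_comp n r f d)"
  unfolding hilbert_sub_def
  by (intro k_dim_free_module FV.subspace_inter assms subspace_free_comp
      FV.fin_spanned_subset[OF _ fin_spanned_free_comp]) auto

lemma free_comp_subset_carrier: "free_comp n r f d \<subseteq> carrier (free_module n r)"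
  by (auto simp: free_comp_def)

lemma subspace_carrier_free_module:
  "FV.subspace (carrier (free_module n r :: ('k::field mpoly, 'k fvec) module))"
proof -
  have "carrier (free_module n r :: ('k mpoly, 'k fvec) module) = FV.supported ({1..r} \<times> pprods n)"
    unfolding FV.supported_def free_module_simps keys_subset_iff
    by (auto simp: in_keys_iff subset_iff intro!: poly_mapping_eqI) (metis lookup_zero)+
  then show ?thesis by (simp only: FV.subspace_supported)
qed

lemma hilbert_quot_eq:
  fixes N :: "'k::field fvec set"
  assumes N: "FV.subspace N"
  shows "hilbert_quot n r f N d + FV.dim (N \<inter> free_comp n r f d) = card (monomials n r f d)"
proof -
  let ?F = "free_module n r :: ('k mpoly, 'k fvec) module" and ?C = "free_comp n r f d :: 'k fvec set"
  let ?T = "a_r_coset ?F N"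
  note cl = FV.subspace_0[OF N] FV.subspace_add[OF N] FV.subspace_diff[OF N] FV.subspace_scale[OF N]
  have T: "?T v = (\<lambda>x. x + v) ` N" for v
    by (auto simp: a_r_coset_def' free_module_simps)
  have T_eq: "?T v = ?T w \<longleftrightarrow> v - w \<in> N" for v w
  proof
    assume "?T v = ?T w"
    moreover have "0 + v \<in> ?T v" unfolding T using cl by blast
    ultimately show "v - w \<in> N" unfolding T by auto
  next
    assume vw: "v - w \<in> N"
    have "x + v \<in> ?T w" if "x \<in> N" for x
      unfolding T using cl(2)[OF that vw] by (rule rev_image_eqI) (simp add: algebra_simps)
    moreover have "x + w \<in> ?T v" if "x \<in> N" for x
      unfolding T using cl(3)[OF that vw] by (rule rev_image_eqI) (simp add: algebra_simps)
    ultimately show "?T v = ?T w" unfolding T by blast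
  qed
  have "vectorspace.dim class_ring (k_space (quotient_module ?F N) (?T ` ?C)) + FV.dim (N \<inter> ?C) = FV.dim ?C"
  proof (rule FV.vectorspace_dim_quotient[OF subspace_free_comp fin_spanned_free_comp])
    show "carrier (k_space (quotient_module ?F N) (?T ` ?C)) = ?T ` ?C" by (simp add: k_space_simps)
    show "zero (k_space (quotient_module ?F N) (?T ` ?C)) = ?T 0"
      unfolding T by (simp add: k_space_simps quotient_module_def)
    show "?T v \<oplus>\<^bsub>k_space (quotient_module ?F N) (?T ` ?C)\<^esub> ?T w = ?T (v + w)" for v w
    proof -
      have "?T v <+>\<^bsub>?F\<^esub> ?T w = {x + v + (y + w) |x y. x \<in> N \<and> y \<in> N}"
        unfolding T by (auto simp: set_add_def' free_module_simps)
      also have "\<dots> = ?T (v + w)"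
      proof (intro equalityI subsetI)
        fix u assume "u \<in> {x + v + (y + w) |x y. x \<in> N \<and> y \<in> N}"
        then obtain x y where u: "u = x + v + (y + w)" "x \<in> N" "y \<in> N" by blast
        show "u \<in> ?T (v + w)"
          unfolding T using cl(2)[OF u(2,3)] by (rule rev_image_eqI) (simp add: u(1) algebra_simps)
      next
        fix u assume "u \<in> ?T (v + w)"
        then obtain x where "u = x + v + (0 + w)" "x \<in> N" unfolding T by (auto simp: add.assoc)
        then show "u \<in> {x + v + (y + w) |x y. x \<in> N \<and> y \<in> N}" using cl(1) by blast
      qed
      finally show ?thesis by (simp add: k_space_simps quotient_module_def)
    qed
    show "c \<odot>\<^bsub>k_space (quotient_module ?F N) (?T ` ?C)\<^esub> ?T v = ?T (fscale c v)" for c v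
    proof -
      have "(\<Union>x\<in>?T v. ?T (fscale c x)) = ?T (fscale c v)"
      proof -
        have "?T (fscale c x) = ?T (fscale c v)" if x: "x \<in> ?T v" for x
        proof -
          obtain y where "x = y + v" "y \<in> N" using x unfolding T by auto
          then show ?thesis unfolding T_eq using cl(4) by (simp add: FV.scale_right_distrib)
        qed
        moreover have "0 + v \<in> ?T v" unfolding T using cl(1) by blast
        ultimately show ?thesis by blast
      qed
      then show ?thesis by (simp add: k_space_simps quotient_module_def free_module_simps fscale_def)
    qed
    show "?T v = ?T 0 \<longleftrightarrow> v \<in> N" for v unfolding T_eq by simp
  qed
  then show ?thesis unfolding hilbert_quot_def k_dim_def dim_free_comp by simp
qed

lemma submodule_subspace:
  assumes "Module.submodule N (poly_ring n) (free_module n r)"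
  shows "FV.subspace N" "N \<subseteq> carrier (free_module n r)"
    "\<And>p v. p \<in> carrier (poly_ring n) \<Longrightarrow> v \<in> N \<Longrightarrow> Poly_Mapping.single 0 p * v \<in> N"
proof -
  interpret N: Module.submodule N "poly_ring n" "free_module n r" by (rule assms)
  show sm: "Poly_Mapping.single 0 p * v \<in> N" if "p \<in> carrier (poly_ring n)" "v \<in> N" for p v
    using N.smult_closed[OF that] by (simp add: free_module_simps)
  show "N \<subseteq> carrier (free_module n r)" using N.subset by simp
  have "fscale c v \<in> N" if "v \<in> N" for c v
    unfolding fscale_def using that
    by (intro sm) (auto simp: poly_ring_simps pprods_def)
  then show "FV.subspace N"
    using N.one_closed N.m_closed by (auto simp: FV.subspace_def free_module_simps)
qed

lemma add_multiples_eq: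
  "add_multiples n r N l = plus_mult N (Poly_Mapping.single 0 l) (carrier (free_module n r))"
  by (auto simp: add_multiples_def plus_mult_def set_add_def' free_module_simps(3,4))

text \<open>The projection to degree \<open>d\<close>, by cutting off coefficients; graded
  submodules are mapped into themselves.\<close>

definition homogeneous_part :: "(nat \<Rightarrow> int) \<Rightarrow> int \<Rightarrow> 'k::field fvec \<Rightarrow> 'k fvec"
  where "homogeneous_part f d v = Poly_Mapping.mapp
    (\<lambda>i. Poly_Mapping.mapp (\<lambda>t c. c when int (pprod_deg t) + f i = d)) v"

lemma lookup_hcut:
  "lookup (lookup (homogeneous_part f d v) i) t = (lookup (lookup v i) t when int (pprod_deg t) + f i = d)"
  by (auto simp: homogeneous_part_def lookup_mapp when_def in_keys_iff)

lemma homogeneous_part_add: "homogeneous_part f d (v + w) = homogeneous_part f d v + homogeneous_part f d w"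
  by (auto intro!: poly_mapping_eqI simp: lookup_hcut lookup_add when_def)

lemma homogeneous_part_sum: "finite D \<Longrightarrow> homogeneous_part f d (sum w D) = (\<Sum>e\<in>D. homogeneous_part f d (w e))"
  by (induction D rule: finite_induct) (auto simp: homogeneous_part_add intro!: poly_mapping_eqI simp: lookup_hcut)

lemma homogeneous_part_free_comp:
  assumes "v \<in> free_comp n r f e"
  shows "homogeneous_part f d v = (if e = d then v else 0)"
proof (intro poly_mapping_eqI)
  fix i t
  have "lookup (lookup v i) t \<noteq> 0 \<Longrightarrow> int (pprod_deg t) + f i = e"
    using assms by (auto simp: free_comp_def in_keys_iff)
  then show "lookup (lookup (homogeneous_part f d v) i) t = lookup (lookup (if e = d then v else 0) i) t"
    by (auto simp: lookup_hcut when_def)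
qed

lemma homogeneous_part_in_free_comp:
  assumes "v \<in> carrier (free_module n r)"
  shows "homogeneous_part f d v \<in> free_comp n r f d"
proof -
  have "lookup (homogeneous_part f d v) i = 0" if "i \<notin> {1..r}" for i
  proof (rule poly_mapping_eqI)
    have "lookup v i = 0" using assms that by (simp only: free_module_simps keys_subset_iff) blast
    then show "lookup (lookup (homogeneous_part f d v) i) t = lookup 0 t" for t by (simp add: lookup_hcut)
  qed
  then have "keys (homogeneous_part f d v) \<subseteq> {1..r}" by (simp only: keys_subset_iff) blast
  moreover have "t \<in> pprods n \<and> int (pprod_deg t) + f i = d" if "t \<in> keys (lookup (homogeneous_part f d v) i)" for i t
    using that assms by (auto simp: in_keys_iff lookup_hcut free_module_simps(1) when_def subset_iff split: if_splits)
  ultimately show ?thesis by (auto simp: free_comp_def free_module_simps poly_ring_simps)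
qed

text \<open>What remains of \<open>v\<close> has no terms of degree \<open>d - 1\<close>, so its
  product with a form of degree one has none of degree \<open>d\<close>.\<close>

lemma homogeneous_part_mult:
  assumes l: "l \<in> poly_comp n 1" and v: "v \<in> carrier (free_module n r)"
  shows "homogeneous_part f d (Poly_Mapping.single 0 l * v) = Poly_Mapping.single 0 l * homogeneous_part f (d - 1) v"
proof -
  let ?w = "v - homogeneous_part f (d - 1) v"
  have "homogeneous_part f d (Poly_Mapping.single 0 l * ?w) = 0"
  proof (intro poly_mapping_eqI)
    fix i t
    have "lookup (l * lookup ?w i) t = 0" if t: "int (pprod_deg t) + f i = d"
    proof (rule ccontr)
      assume "lookup (l * lookup ?w i) t \<noteq> 0"
      then have "t \<in> keys (l * lookup ?w i)" by (simp add: in_keys_iff)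
      then obtain a b where ab: "a \<in> keys l" "b \<in> keys (lookup ?w i)" "t = a + b"
        using Poly_Mapping.keys_mult[of l "lookup ?w i"] by auto
      have "pprod_deg a = 1" using l ab(1) by (auto simp: poly_comp_iff mons_def)
      then have "int (pprod_deg b) + f i = d - 1" using t ab(3) by (simp add: pprod_deg_add)
      then show False using ab(2) by (simp add: in_keys_iff lookup_minus lookup_hcut)
    qed
    then show "lookup (lookup (homogeneous_part f d (Poly_Mapping.single 0 l * ?w)) i) t = lookup (lookup 0 i) t"
      by (simp add: lookup_hcut lookup_single_0_mult when_def)
  qed
  moreover have "homogeneous_part f d (Poly_Mapping.single 0 l * homogeneous_part f (d - 1) v) = Poly_Mapping.single 0 l * homogeneous_part f (d - 1) v"
  proof -
    have "Poly_Mapping.single 0 l * homogeneous_part f (d - 1) v \<in> free_comp n r f d"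
      using homogeneous_part_in_free_comp[OF v] l unfolding free_comp_eq by (intro graded_part_mult)
    then show ?thesis using homogeneous_part_free_comp[of _ n r f d d] by simp
  qed
  moreover have "Poly_Mapping.single 0 l * v =
      Poly_Mapping.single 0 l * ?w + Poly_Mapping.single 0 l * homogeneous_part f (d - 1) v"
    by (simp add: algebra_simps)
  ultimately show ?thesis by (metis homogeneous_part_add add_0)
qed

lemma homogeneous_part_graded_submodule:
  assumes "graded_submodule n r f N" "v \<in> N"
  shows "homogeneous_part f d v \<in> N \<inter> free_comp n r f d"
proof -
  have N: "Module.submodule N (poly_ring n) (free_module n r)" using assms(1) by (simp add: graded_submodule_def)
  obtain D w where D: "finite D" "\<And>e. e \<in> D \<Longrightarrow> w e \<in> N \<inter> free_comp n r f e" "v = (\<Sum>e\<in>D. w e)"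
    using assms unfolding graded_submodule_def by blast
  have "homogeneous_part f d (w e) = (if e = d then w e else 0)" if "e \<in> D" for e
    using D(2)[OF that] by (intro homogeneous_part_free_comp) blast
  then have "homogeneous_part f d v = (\<Sum>e\<in>D. if e = d then w e else 0)"
    unfolding D(3) homogeneous_part_sum[OF D(1)] by (rule sum.cong[OF refl])
  also have "\<dots> = (if d \<in> D then w d else 0)" using D(1) by simp
  finally show ?thesis
    using D(2)[of d] FV.subspace_0[OF submodule_subspace(1)[OF N]] FV.subspace_0[OF subspace_free_comp] by auto
qed

text \<open>Taking degree \<open>d\<close> parts in \<open>x + l y\<close> gives the inclusion from
  left to right; the part of \<open>x\<close> stays in \<open>N\<close> because \<open>N\<close> is
  graded.\<close>

lemma add_multiples_comp:
  assumes N: "graded_submodule n r f N" and l: "l \<in> poly_comp n 1"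
  shows "add_multiples n r N l \<inter> free_comp n r f d =
    plus_mult (N \<inter> free_comp n r f d) (Poly_Mapping.single 0 l) (free_comp n r f (d - 1))"
proof (intro equalityI subsetI)
  fix v assume v: "v \<in> add_multiples n r N l \<inter> free_comp n r f d"
  then obtain x y where xy: "v = x + Poly_Mapping.single 0 l * y" "x \<in> N" "y \<in> carrier (free_module n r)"
    by (auto simp: add_multiples_eq plus_mult_def)
  have "v = homogeneous_part f d v" using v homogeneous_part_free_comp[of v n r f d d] by simp
  also have "\<dots> = homogeneous_part f d x + Poly_Mapping.single 0 l * homogeneous_part f (d - 1) y"
    unfolding xy(1) homogeneous_part_add homogeneous_part_mult[OF l xy(3)] ..
  finally show "v \<in> plus_mult (N \<inter> free_comp n r f d) (Poly_Mapping.single 0 l) (free_comp n r f (d - 1))"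
    unfolding plus_mult_def using homogeneous_part_graded_submodule[OF N xy(2)] homogeneous_part_in_free_comp[OF xy(3)] by blast
next
  fix v assume "v \<in> plus_mult (N \<inter> free_comp n r f d) (Poly_Mapping.single 0 l) (free_comp n r f (d - 1))"
  moreover have "plus_mult (N \<inter> free_comp n r f d) (Poly_Mapping.single 0 l) (free_comp n r f (d - 1)) \<subseteq> free_comp n r f d"
    unfolding free_comp_eq using l by (intro plus_mult_subset_graded_part) auto
  ultimately show "v \<in> add_multiples n r N l \<inter> free_comp n r f d"
    using free_comp_subset_carrier by (fastforce simp: add_multiples_eq plus_mult_def)
qed

lemma subspace_add_multiples:
  "FV.subspace N \<Longrightarrow> FV.subspace (add_multiples n r N l)"
  unfolding add_multiples_eq by (intro subspace_plus_mult_fvec subspace_carrier_free_module)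

lemma hilbert_quot_add_multiples:
  assumes N: "graded_submodule n r f N" and l: "l \<in> poly_comp n 1"
  shows "hilbert_quot n r f (add_multiples n r N l) d +
    FV.dim (plus_mult (N \<inter> free_comp n r f d) (Poly_Mapping.single 0 l) (free_comp n r f (d - 1))) =
    card (monomials n r f d)"
proof -
  have "FV.subspace N" using N submodule_subspace(1) by (auto simp: graded_submodule_def)
  then show ?thesis
    using hilbert_quot_eq[OF subspace_add_multiples, of N n r f n r l d] add_multiples_comp[OF N l] by simp
qed

lemma k_span_eq:
  assumes "finite A" "A \<subseteq> carrier (free_module n r)"
  shows "k_span n r A = FV.span A"
  unfolding k_span_def
  by (rule FV.span_subspace_record[OF subspace_carrier_free_module])
     (use assms in \<open>simp_all add: k_space_simps(1) k_space_free_module\<close>)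

section \<open>Evaluation as a ring homomorphism\<close>

definition monom_eval :: "(nat \<Rightarrow> 'k::field) \<Rightarrow> pprod \<Rightarrow> 'k"
  where "monom_eval a t = (\<Prod>i\<in>keys t. a i ^ lookup t i)"

lemma monom_eval_superset: "finite A \<Longrightarrow> keys t \<subseteq> A \<Longrightarrow> monom_eval a t = (\<Prod>i\<in>A. a i ^ lookup t i)"
  unfolding monom_eval_def by (rule prod.mono_neutral_left) (auto simp: in_keys_iff)

lemma monom_eval_add: "monom_eval a (s + t) = monom_eval a s * monom_eval a t"
  using monom_eval_superset[of "keys s \<union> keys t" s a] monom_eval_superset[of "keys s \<union> keys t" t a]
    monom_eval_superset[of "keys s \<union> keys t" "s + t" a]
  by (simp add: keys_add_pprod lookup_add power_add prod.distrib)

lemma poly_eval_superset: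
  "finite A \<Longrightarrow> keys p \<subseteq> A \<Longrightarrow> poly_eval a p = (\<Sum>t\<in>A. lookup p t * monom_eval a t)"
  unfolding poly_eval_def monom_eval_def[symmetric]
  by (rule sum.mono_neutral_left) (auto simp: in_keys_iff)

lemma poly_eval_add: "poly_eval a (p + q) = poly_eval a p + poly_eval a q"
proof -
  have "keys (p + q) \<subseteq> keys p \<union> keys q" by (rule Poly_Mapping.keys_add)
  then show ?thesis
    by (simp add: poly_eval_superset[of "keys p \<union> keys q"] lookup_add distrib_right sum.distrib)
qed

lemma poly_eval_single: "poly_eval a (Poly_Mapping.single t c) = c * monom_eval a t"
  by (subst poly_eval_superset[of "{t}"]) auto

lemma poly_eval_0 [simp]: "poly_eval a 0 = 0"
  by (simp add: poly_eval_def)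

lemma poly_eval_sum: "poly_eval a (sum g A) = (\<Sum>x\<in>A. poly_eval a (g x))"
  by (induction A rule: infinite_finite_induct) (auto simp: poly_eval_add)

lemma poly_mapping_sum_single: "p = (\<Sum>t\<in>keys p. Poly_Mapping.single t (lookup p t))"
  by (rule poly_mapping_eqI) (auto simp: lookup_sum lookup_single when_def in_keys_iff cong: if_cong)

lemma poly_eval_mult: "poly_eval a (p * q) = poly_eval a p * poly_eval a q"
proof -
  have "p * q = (\<Sum>s\<in>keys p. \<Sum>t\<in>keys q. Poly_Mapping.single (s + t) (lookup p s * lookup q t))"
    by (subst (1) poly_mapping_sum_single[of p], subst (1) poly_mapping_sum_single[of q])
       (simp add: sum_product mult_single)
  then have "poly_eval a (p * q) =
      (\<Sum>s\<in>keys p. \<Sum>t\<in>keys q. (lookup p s * monom_eval a s) * (lookup q t * monom_eval a t))"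
    by (simp add: poly_eval_sum poly_eval_single monom_eval_add mult_ac)
  also have "\<dots> = poly_eval a p * poly_eval a q"
    by (simp add: poly_eval_superset[of "keys p" p] poly_eval_superset[of "keys q" q] sum_product)
  finally show ?thesis .
qed

lemma poly_eval_diff: "poly_eval a (p - q) = poly_eval a p - poly_eval a q"
  using poly_eval_add[of a "p - q" q] by simp

text \<open>The non-vanishing of a single polynomial defines an open set, and \<open>l0\<close>
  shows that it is not empty.\<close>

lemma generic_linear_formI:
  assumes p: "p \<in> carrier (poly_ring n)" and l0: "l0 \<in> poly_comp n 1"
    and "poly_eval (\<lambda>i. lookup l0 (Poly_Mapping.single i 1)) p \<noteq> 0"
    and P: "\<And>l. l \<in> poly_comp n 1 \<Longrightarrow> poly_eval (\<lambda>i. lookup l (Poly_Mapping.single i 1)) p \<noteq> 0 \<Longrightarrow> P l"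
  shows "generic_linear_form n P"
proof -
  let ?U = "poly_comp n 1 - {l \<in> poly_comp n 1. \<forall>q\<in>{p}. poly_eval (\<lambda>i. lookup l (Poly_Mapping.single i 1)) q = 0}"
  have "zariski_open n ?U" unfolding zariski_open_def using p by (intro exI[of _ "{p}"]) auto
  moreover have "?U \<noteq> {}" using assms by auto
  ultimately show ?thesis unfolding generic_linear_form_def using P by (intro exI[of _ ?U]) auto
qed

definition linear_form :: "nat \<Rightarrow> (nat \<Rightarrow> 'k::field) \<Rightarrow> 'k mpoly"
  where "linear_form n a = (\<Sum>j\<in>{1..n}. Poly_Mapping.single (Poly_Mapping.single j 1) (a j))"

lemma linear_form_in_poly_comp: "linear_form n a \<in> poly_comp n 1"
  unfolding linear_form_def
  by (intro PV.subspace_sum subspace_poly_comp) (auto simp: poly_comp_iff mons_def pprods_def)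

lemma linear_form_coeffs:
  "l \<in> poly_comp n 1 \<Longrightarrow> linear_form n (\<lambda>i. lookup l (Poly_Mapping.single i 1)) = l"
  unfolding linear_form_def by (rule linear_form_expand[symmetric])

text \<open>Semicontinuity over the space of all linear forms turns one good form into a generic
  statement: what follows from a dimension at least as large as at \<open>l0\<close> holds wherever
  one polynomial does not vanish.\<close>

lemma dim_generic:
  fixes V :: "'k::field fvec set"
  assumes V: "V \<subseteq> free_comp n r f d" and l0: "l0 \<in> poly_comp n 1"
    and P: "\<And>l. l \<in> poly_comp n 1 \<Longrightarrow>
      FV.dim (plus_mult V (Poly_Mapping.single 0 l0) (free_comp n r f (d - 1))) \<le>
      FV.dim (plus_mult V (Poly_Mapping.single 0 l) (free_comp n r f (d - 1))) \<Longrightarrow> P l"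
  shows "generic_linear_form n P"
proof -
  define A :: "((nat \<Rightarrow> 'k) \<Rightarrow> 'k) set" where "A = {\<lambda>a. poly_eval a p |p. p \<in> carrier (poly_ring n)}"
  let ?F = "free_comp n r f (d - 1) :: 'k fvec set"
  define W where "W = (\<lambda>a. plus_mult V (Poly_Mapping.single 0 (linear_form n a)) ?F)"
  define a0 where "a0 = (\<lambda>i. lookup l0 (Poly_Mapping.single i 1))"
  have "\<exists>g\<in>A. g a0 \<noteq> 0 \<and> (\<forall>a. g a \<noteq> 0 \<longrightarrow> FV.dim (W a0) \<le> FV.dim (W a))"
  proof (rule FV.dim_lower_semicontinuous[where \<phi> = fcoord and J = "V \<times> ?F"
        and w = "\<lambda>(x, y) a. x + Poly_Mapping.single 0 (linear_form n a) * y"])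
    have "0 \<in> pprods n" by (auto simp: pprods_def)
    then show "(\<lambda>x. 1) \<in> A"
      unfolding A_def poly_ring_simps
      by (intro CollectI exI[of _ 1]) (auto simp: fun_eq_iff poly_eval_single[of _ 0 1, simplified] monom_eval_def)
    show "(\<lambda>x. g x * h x) \<in> A" if "g \<in> A" "h \<in> A" for g h
    proof -
      obtain p q where pq: "g = (\<lambda>a. poly_eval a p)" "h = (\<lambda>a. poly_eval a q)" "keys p \<subseteq> pprods n" "keys q \<subseteq> pprods n"
        using \<open>g \<in> A\<close> \<open>h \<in> A\<close> by (auto simp: A_def poly_ring_simps)
      have "keys (p * q) \<subseteq> pprods n"
        using Poly_Mapping.keys_mult[of p q] pq(3,4) by (fastforce simp: pprods_def keys_add_pprod)
      then show ?thesis
        unfolding A_def poly_ring_simps by (intro CollectI exI[of _ "p * q"]) (auto simp: pq poly_eval_mult)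
    qed
    show "(\<lambda>x. g x - h x) \<in> A" if "g \<in> A" "h \<in> A" for g h
    proof -
      obtain p q where pq: "g = (\<lambda>a. poly_eval a p)" "h = (\<lambda>a. poly_eval a q)" "keys p \<subseteq> pprods n" "keys q \<subseteq> pprods n"
        using \<open>g \<in> A\<close> \<open>h \<in> A\<close> by (auto simp: A_def poly_ring_simps)
      have "keys (p - q) \<subseteq> pprods n"
        using Poly_Mapping.keys_diff[of p q] pq(3,4) by auto
      then show ?thesis
        unfolding A_def poly_ring_simps
        by (intro CollectI exI[of _ "p - q"]) (auto simp: pq poly_eval_diff)
    qed
    show "Vector_Spaces.linear fscale (*) (fcoord c)" for c by (rule FV.coord_linear)
    show "v = 0" if "\<And>c. fcoord c v = 0" for v :: "'k fvec" using that by (intro FV.coord_eqI) simp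
    show "(\<lambda>a. fcoord c ((case j of (x, y) \<Rightarrow> \<lambda>a. x + Poly_Mapping.single 0 (linear_form n a) * y) a)) \<in> A"
      if "j \<in> V \<times> ?F" for j c
    proof -
      obtain x y where j: "j = (x, y)" by force
      obtain i t where c: "c = (i, t)" by force
      \<comment> \<open>\<open>u k\<close> is a coefficient of the product of \<open>x_k\<close>
        with a component of \<open>y\<close>, so this coordinate of \<open>x + l y\<close> is the
        polynomial \<open>p\<close>, of degree at most one, in the coefficients of
        \<open>l\<close>.\<close>
      define u where "u = (\<lambda>k. lookup (Poly_Mapping.single (Poly_Mapping.single k 1) 1 * lookup y i) t)"
      define p where "p = Poly_Mapping.single 0 (lookup (lookup x i) t) +
        (\<Sum>k\<in>{1..n}. Poly_Mapping.single (Poly_Mapping.single k 1) (u k) :: 'k mpoly)"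
      have "Poly_Mapping.single (Poly_Mapping.single k 1) (a k) * q =
          pscale (a k) (Poly_Mapping.single (Poly_Mapping.single k 1) 1 * q)" for a k and q :: "'k mpoly"
        by (simp add: pscale_def mult_single flip: mult.assoc)
      then have "lookup (linear_form n a * lookup y i) t = (\<Sum>k\<in>{1..n}. a k * u k)" for a
        by (simp add: linear_form_def sum_distrib_right lookup_sum lookup_pscale u_def)
      then have "fcoord c (x + Poly_Mapping.single 0 (linear_form n a) * y) = poly_eval a p" for a
        by (simp add: c p_def lookup_add lookup_single_0_mult poly_eval_add poly_eval_sum poly_eval_single
            monom_eval_def mult.commute[of "u _"])
      moreover have "p \<in> carrier (poly_ring n)"
      proof -
        have "keys p \<subseteq> {0} \<union> (\<Union>k\<in>{1..n}. {Poly_Mapping.single k 1})"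
          unfolding p_def
          by (rule order_trans[OF Poly_Mapping.keys_add Un_mono[OF _ order_trans[OF Poly_Mapping.keys_sum UN_mono]]]) auto
        then show ?thesis by (auto simp: poly_ring_simps pprods_def)
      qed
      ultimately show ?thesis unfolding A_def by (auto simp: j)
    qed
    show "(case j of (x, y) \<Rightarrow> \<lambda>a. x + Poly_Mapping.single 0 (linear_form n a) * y) a \<in> W a"
      if "j \<in> V \<times> ?F" for j a
      using that by (auto simp: W_def plus_mult_def)
    have "W a \<subseteq> free_comp n r f d" for a
      using V linear_form_in_poly_comp unfolding W_def free_comp_eq by (intro plus_mult_subset_graded_part) auto
    then show "fin_spanned FV.span (W a)" for a
      using fin_spanned_free_comp by (rule FV.fin_spanned_subset)
    have W0: "W a0 = (\<lambda>j. (case j of (x, y) \<Rightarrow> \<lambda>a. x + Poly_Mapping.single 0 (linear_form n a) * y) a0) ` (V \<times> ?F)"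
      by (force simp: W_def plus_mult_def)
    show "W a0 \<subseteq> FV.span ((\<lambda>j. (case j of (x, y) \<Rightarrow> \<lambda>a. x + Poly_Mapping.single 0 (linear_form n a) * y) a0) ` (V \<times> ?F))"
      unfolding W0 by (rule FV.span_superset)
  qed
  then obtain p where p: "p \<in> carrier (poly_ring n)" "poly_eval a0 p \<noteq> 0"
    "\<And>a. poly_eval a p \<noteq> 0 \<Longrightarrow> FV.dim (W a0) \<le> FV.dim (W a)"
    by (auto simp: A_def)
  show ?thesis
  proof (rule generic_linear_formI[OF p(1) l0])
    show "poly_eval (\<lambda>i. lookup l0 (Poly_Mapping.single i 1)) p \<noteq> 0" using p(2) by (simp add: a0_def)
    show "P l" if l: "l \<in> poly_comp n 1" "poly_eval (\<lambda>i. lookup l (Poly_Mapping.single i 1)) p \<noteq> 0" for l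
      using P[OF l(1)] p(3)[OF l(2)]
      unfolding W_def a0_def linear_form_coeffs[OF l0] linear_form_coeffs[OF l(1)] by blast
  qed
qed

section \<open>The generic Hilbert function of a lex-segment quotient\<close>

lemma sum_list_concat_map: "sum_list (concat (map g xs)) = sum_list (map (\<lambda>x. sum_list (g x)) xs)"
  for g :: "'a \<Rightarrow> nat list"
  by (induction xs) auto

text \<open>The blocks of the word belong to \<open>e_r\<close>, ..., \<open>e_1\<close> in this
  order. A prefix of length \<open>h\<close> consists of the full blocks with index above
  \<open>j\<close> and a prefix of the block \<open>j\<close>, and each contribution is a lowered
  Macaulay value.\<close>

lemma hilbert_lower_eq:
  assumes "1 \<le> r" "h \<le> card (monomials n r f d)"
  shows "hilbert_lower TYPE('k::field) n r f d h = pre (module_word n f d (indices r)) h"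
proof -
  let ?w = "\<lambda>i. monword n (d - f i)"
  define N where "N = (\<lambda>i. length (?w i))"
  have N: "k_dim (poly_ring n :: ('k mpoly, 'k mpoly) module) (poly_comp n (d - f i)) = N i" for i
    by (simp add: k_dim_poly_comp N_def)
  have card: "card (monomials n r f d) = (\<Sum>i=1..r. N i)"
    by (simp add: monomials_eq finite_mons card_mons N_def)
  let ?P = "\<lambda>j. j \<in> {1..r} \<and> (\<Sum>i=j+1..r. N i) \<le> h \<and> h \<le> (\<Sum>i=j..r. N i)"
  define j where "j = (SOME j. ?P j)"
  have "\<exists>j. ?P j"
  proof -
    \<comment> \<open>The least \<open>j\<close> for which the blocks above it fit into
      \<open>h\<close> is admissible: failure at \<open>j - 1\<close> is the upper bound.\<close>
    let ?Q = "\<lambda>j. 1 \<le> j \<and> (\<Sum>i=j+1..r. N i) \<le> h"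
    define j0 where "j0 = (LEAST j. ?Q j)"
    have r: "?Q r" using assms(1) by simp
    then have j0: "?Q j0" "j0 \<le> r" unfolding j0_def by (rule LeastI, rule Least_le)
    have "h \<le> (\<Sum>i=j0..r. N i)"
    proof (cases "j0 = 1")
      case True
      then show ?thesis using assms(2) card by simp
    next
      case False
      then have "\<not> ?Q (j0 - 1)" using j0(1) not_less_Least[of "j0 - 1" ?Q] unfolding j0_def by simp
      moreover have "j0 - 1 + 1 = j0" "1 \<le> j0 - 1" using False j0(1) by auto
      ultimately show ?thesis by simp
    qed
    then show ?thesis using j0 by auto
  qed
  then have j: "?P j" unfolding j_def by (rule someI_ex)
  have split: "(\<Sum>i=j..r. N i) = N j + (\<Sum>i=j+1..r. N i)"
    using j by (simp add: sum.atLeast_Suc_atMost)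
  define a where "a = h - (\<Sum>i=j+1..r. N i)"
  have a: "a \<le> length (?w j)" using j split unfolding a_def N_def by linarith
  have "[1..<Suc r] = [1..<j] @ j # [j + 1..<Suc r]"
    using j upt_add_eq_append[of 1 j "Suc r - j"] upt_conv_Cons[of j "Suc r"] by (simp del: upt_Suc)
  then have word: "module_word n f d (indices r) =
      module_word n f d (rev [j + 1..<Suc r]) @ ?w j @ module_word n f d (rev [1..<j])"
    by (simp add: module_word_def indices_def)
  have sums: "sum_list (map g (rev [j + 1..<Suc r])) = (\<Sum>i=j+1..r. g i)" for g :: "nat \<Rightarrow> nat"
    by (simp only: rev_map[symmetric] sum_list_rev interv_sum_list_conv_sum_set_nat atLeastLessThanSuc_atLeastAtMost set_upt)
  have len: "length (module_word n f d (rev [j + 1..<Suc r])) = (\<Sum>i=j+1..r. N i)"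
    unfolding module_word_def length_concat map_map comp_def sums N_def ..
  have all: "pre (module_word n f d (rev [j + 1..<Suc r])) h = sum_list (module_word n f d (rev [j + 1..<Suc r]))"
    by (rule pre_all, unfold len) (use j in blast)
  have "sum_list (module_word n f d (rev [j + 1..<Suc r])) = (\<Sum>i=j+1..r. sum_list (?w i))"
    unfolding module_word_def sum_list_concat_map sums ..
  also have "\<dots> = (\<Sum>i=j+1..r. macaulay_lower (N i) (d - f i))"
    by (simp add: macaulay_lower_eq_pre[of _ n] N_def pre_all)
  finally have "pre (module_word n f d (indices r)) h =
      (\<Sum>i=j+1..r. macaulay_lower (N i) (d - f i)) + pre (?w j) a"
    using a all unfolding word pre_append len a_def[symmetric] by (simp del: upt_Suc)
  then show ?thesis
    using macaulay_lower_eq_pre[OF a]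
    unfolding hilbert_lower_def Let_def N j_def[symmetric] a_def[symmetric] by simp
qed

theorem theorem3p18:
  fixes n r m :: nat and f :: "nat \<Rightarrow> int"
    and M L :: "'k::field fvec set" and B :: "(nat \<times> pprod) set"
  assumes "infinite (UNIV :: 'k set)"
    and "1 \<le> r"
    and "mono_on {1..r} f"
    and "graded_submodule n r f M"
    and "graded_submodule n r f L"
    and "lex_segment n r f (int m) (hilbert_sub n r f M (int m)) B"
    and "L \<inter> free_comp n r f (int m) = k_span n r (monomial_vec ` B)"
  shows "generic_linear_form n (\<lambda>l.
           hilbert_quot n r f (add_multiples n r M l) (int m)
             \<le> hilbert_quot n r f (add_multiples n r L l) (int m))
       \<and> generic_linear_form n (\<lambda>l.
           hilbert_quot n r f (add_multiples n r L l) (int m)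
             = hilbert_lower TYPE('k) n r f (int m) (hilbert_quot n r f M (int m)))"
proof -
  note M = assms(4) and L = assms(5) and lex = assms(6)
  let ?\<Omega> = "monomials n r f (int m)"
  define F F' :: "'k fvec set" where "F = free_comp n r f (int m)" and "F' = free_comp n r f (int m - 1)"
  define A where "A = ?\<Omega> - B"
  define h where "h = hilbert_quot n r f M (int m)"
  \<comment> \<open>The value that separates both sides: an upper bound for \<open>M\<close> at good
    forms and a lower bound for \<open>L\<close> at all forms, attained by \<open>L\<close> when the
    coefficient at \<open>x_n\<close> is nonzero.\<close>
  define H where "H = pre (module_word n f (int m) (indices r)) h"
  have subM: "FV.subspace M" using M submodule_subspace(1) by (auto simp: graded_submodule_def)
  have MF: "FV.subspace (M \<inter> F)" "M \<inter> F \<subseteq> F"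
    by (auto simp: F_def intro!: FV.subspace_inter subM subspace_free_comp)
  have h: "h + FV.dim (M \<inter> F) = card ?\<Omega>"
    unfolding h_def F_def by (rule hilbert_quot_eq[OF subM])
  have cardB: "card B = FV.dim (M \<inter> F)"
    using lex hilbert_sub_eq[OF subM] by (simp add: lex_segment_def F_def)
  have cardA: "card A = h"
    unfolding A_def using h cardB lex_segment_subset[OF lex] by (simp add: card_Diff_subset)
  have split: "card {(i, t) \<in> A. n \<notin> keys t} + card {(i, t) \<in> A. n \<in> keys t} = h"
  proof -
    have "finite A" using finite_monomials[of n r f "int m"] by (simp add: A_def)
    then have "card ({(i, t) \<in> A. n \<notin> keys t} \<union> {(i, t) \<in> A. n \<in> keys t}) =
        card {(i, t) \<in> A. n \<notin> keys t} + card {(i, t) \<in> A. n \<in> keys t}"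
      by (intro card_Un_disjoint) (auto elim!: finite_subset[rotated])
    moreover have "{(i, t) \<in> A. n \<notin> keys t} \<union> {(i, t) \<in> A. n \<in> keys t} = A" by auto
    ultimately show ?thesis using cardA by simp
  qed
  have cardH: "card {(i, t) \<in> A. n \<notin> keys t} = H"
    using card_lex_complement[OF lex] unfolding A_def[symmetric] cardA H_def .
  have "monomial_vec ` B \<subseteq> carrier (free_module n r :: ('k mpoly, 'k fvec) module)"
  proof -
    have "monomial_vec ` B \<subseteq> FV.span (monomial_vec ` ?\<Omega>)"
      using lex_segment_subset(1)[OF lex] by (auto intro: FV.span_base)
    then show ?thesis
      using free_comp_subset_carrier[of n r f "int m"]
      by (auto simp: FV.span_unit_vec finite_monomials free_comp_eq_supported)
  qed
  then have LF: "L \<inter> F = FV.span (monomial_vec ` B)"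
    using assms(7) lex_segment_subset(2)[OF lex] by (simp add: F_def k_span_eq)
  have quotM: "hilbert_quot n r f (add_multiples n r M l) (int m) +
      FV.dim (plus_mult (M \<inter> F) (Poly_Mapping.single 0 l) F') = card ?\<Omega>"
    and quotL: "hilbert_quot n r f (add_multiples n r L l) (int m) +
      FV.dim (plus_mult (FV.span (monomial_vec ` B)) (Poly_Mapping.single 0 l) F') = card ?\<Omega>"
    if "l \<in> poly_comp n 1" for l
    using hilbert_quot_add_multiples[OF M that, of "int m"] hilbert_quot_add_multiples[OF L that, of "int m"] LF
    by (simp_all add: F_def F'_def)
  have geL: "H \<le> hilbert_quot n r f (add_multiples n r L l) (int m)" if "l \<in> poly_comp n 1" for l
    using dim_lexW_le[OF lex that] quotL[OF that] cardB h split cardH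
    unfolding A_def[symmetric] F'_def by linarith
  have "generic_linear_form n (\<lambda>l. hilbert_quot n r f (add_multiples n r M l) (int m)
             \<le> hilbert_quot n r f (add_multiples n r L l) (int m))"
  proof -
    have sorted: "sorted_wrt (\<lambda>i j. f j \<le> f i) (indices r)"
      using sorted_indices
    proof (rule sorted_wrt_mono_rel[rotated])
      show "f j \<le> f i" if "i \<in> set (indices r)" "j \<in> set (indices r)" "i > j" for i j
        using that assms(3) by (auto simp: set_indices mono_on_def)
    qed
    have gF: "graded_part n (set (indices r)) f d = free_comp n r f d" for d
      by (simp only: free_comp_eq set_indices)
    have "M \<inter> F \<subseteq> graded_part n (set (indices r)) f (int m)" by (simp only: gF) (simp add: F_def)
    from green_module[OF assms(1) distinct_indices sorted MF(1) this]
    obtain l0 where l0: "l0 \<in> poly_comp n 1"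
      "card ?\<Omega> \<le> FV.dim (plus_mult (M \<inter> F) (Poly_Mapping.single 0 l0) F') +
        pre (module_word n f (int m) (indices r)) (card ?\<Omega> - FV.dim (M \<inter> F))"
      unfolding gF dim_free_comp F'_def[symmetric] by blast
    have ge: "card ?\<Omega> \<le> FV.dim (plus_mult (M \<inter> F) (Poly_Mapping.single 0 l0) F') + H"
      using l0(2) h by (metis H_def add_diff_cancel_right')
    \<comment> \<open>The open set is dictated by \<open>M\<close> alone, since \<open>H\<close>
      bounds the side of \<open>L\<close> at every form.\<close>
    show ?thesis
    proof (rule dim_generic[of "M \<inter> F" n r f "int m" l0])
      show "M \<inter> F \<subseteq> free_comp n r f (int m)" by (simp add: F_def)
      fix l assume l: "l \<in> poly_comp n 1"
        and "FV.dim (plus_mult (M \<inter> F) (Poly_Mapping.single 0 l0) (free_comp n r f (int m - 1))) \<le>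
          FV.dim (plus_mult (M \<inter> F) (Poly_Mapping.single 0 l) (free_comp n r f (int m - 1)))"
      then show "hilbert_quot n r f (add_multiples n r M l) (int m)
             \<le> hilbert_quot n r f (add_multiples n r L l) (int m)"
        using ge quotM[OF l] geL[OF l] unfolding F'_def by linarith
    qed (rule l0)
  qed
  moreover have "generic_linear_form n (\<lambda>l. hilbert_quot n r f (add_multiples n r L l) (int m) =
      hilbert_lower TYPE('k) n r f (int m) h)"
  proof -
    have lower: "hilbert_lower TYPE('k) n r f (int m) h = H"
      unfolding H_def using h by (intro hilbert_lower_eq assms(2)) simp
    have eq: "hilbert_quot n r f (add_multiples n r L l) (int m) = H"
      if l: "l \<in> poly_comp n 1" "n = 0 \<or> lookup l (Poly_Mapping.single n 1) \<noteq> 0" for l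
      using geL[OF l(1)] dim_lexW_ge[OF lex l] quotL[OF l(1)] cardH
      unfolding A_def[symmetric] F'_def by linarith
    \<comment> \<open>The open condition is a nonzero coefficient at \<open>x_n\<close>. Without
      variables 0 is the only linear form, and the constant 1 keeps the open set non-empty.\<close>
    let ?p = "if n = 0 then 1 else Poly_Mapping.single (Poly_Mapping.single n 1) 1 :: 'k mpoly"
    have p: "poly_eval a ?p = (if n = 0 then 1 else a n)" for a
      using poly_eval_single[of a 0 1] by (simp add: poly_eval_single monom_eval_def)
    show ?thesis
    proof (rule generic_linear_formI[where p = ?p])
      show "?p \<in> carrier (poly_ring n)" by (auto simp: poly_ring_simps pprods_def)
      show "linear_form n (\<lambda>_. 1) \<in> poly_comp n 1" by (rule linear_form_in_poly_comp)
      have "lookup (linear_form n (\<lambda>_. 1 :: 'k)) (Poly_Mapping.single n 1) = 1" if "n \<noteq> 0"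
      proof -
        have "Poly_Mapping.single j (1::nat) = Poly_Mapping.single n 1 \<longleftrightarrow> j = n" for j
          by (metis lookup_single_eq lookup_single_not_eq zero_neq_one)
        then show ?thesis using that by (simp add: linear_form_def lookup_sum lookup_single when_def)
      qed
      then show "poly_eval (\<lambda>i. lookup (linear_form n (\<lambda>_. 1 :: 'k)) (Poly_Mapping.single i 1)) ?p \<noteq> 0"
        unfolding p by simp
      show "hilbert_quot n r f (add_multiples n r L l) (int m) = hilbert_lower TYPE('k) n r f (int m) h"
        if "l \<in> poly_comp n 1" "poly_eval (\<lambda>i. lookup l (Poly_Mapping.single i 1)) ?p \<noteq> 0" for l
        using that eq unfolding p lower by (auto split: if_splits)
    qed
  qed
  ultimately show ?thesis unfolding h_def by (rule conjI)
qed

end
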